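(* Let $\mathfrak{F}:\mathcal{U}\times\mathcal{P}\to\mathcal{Y}$ be an input-output function. Then $\mathfrak{F}$ has an LPV-SSA realization if and only if $\mathfrak{F}$ has an impulse response representation (IIR) and its Hankel matrix $\mathcal{H}_{\mathfrak{F}}$ satisfies $$\mathrm{rank}(\mathcal{H}_{\mathfrak{F}})=n_{\mathfrak{F}}<\infty .$$ Any minimal LPV-SSA realization of $\mathfrak{F}$ has state dimension equal to $n_{\mathfrak{F}}$.
   Context: Time is either continuous (CT: $\mathbb{T}=[0,\infty)$, $\xi=\frac{d}{dt}$) or discrete (DT: $\mathbb{T}=\mathbb{N}=\{0,1,\ldots\}$, $(\xi z)(t)=z(t+1)$); the statement is asserted in each of the two cases. The scheduling set $\mathbb{P}\subseteq\mathbb{R}^{n_\mathrm{p}}$ is fixed and its affine hull is $\mathbb{R}^{n_\mathrm{p}}$; $n_\mathrm{u},n_\mathrm{y}$ are fixed. In CT, $\mathcal{U},\mathcal{P},\mathcal{Y}$ are the sets of piecewise-continuous functions from $[0,\infty)$ to $\mathbb{R}^{n_\mathrm{u}}$, $\mathbb{P}$, $\mathbb{R}^{n_\mathrm{y}}$ respectively (finitely many discontinuities on each compact interval, with finite one-sided limits there); in DT they are the sets of all functions from $\mathbb{N}$ to these sets. An LPV-SSA representation $\Sigma=(\mathbb{P},\{A_i,B_i,C_i,0\}_{i=0}^{n_\mathrm{p}})$ of state dimension $\dim(\Sigma)=n_\mathrm{x}$ (a nonnegative integer) is the system $\xi x(t)=A(p(t))x(t)+B(p(t))u(t)$, $y(t)=C(p(t))x(t)$,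 where $A(\mathbf{p})=A_0+\sum_{i=1}^{n_\mathrm{p}}A_i\mathbf{p}_i$, and similarly $B(\mathbf{p})$, $C(\mathbf{p})$, with constant matrices $A_i\in\mathbb{R}^{n_\mathrm{x}\times n_\mathrm{x}}$, $B_i\in\mathbb{R}^{n_\mathrm{x}\times n_\mathrm{u}}$, $C_i\in\mathbb{R}^{n_\mathrm{y}\times n_\mathrm{x}}$. For $x_\mathrm{o}\in\mathbb{R}^{n_\mathrm{x}}$ and $(u,p)\in\mathcal{U}\times\mathcal{P}$, let $x$ be the unique state trajectory with $x(0)=x_\mathrm{o}$ (in CT: locally absolutely continuous, satisfying the state equation for almost all $t$), and put $\mathfrak{Y}_{\Sigma,x_\mathrm{o}}(u,p)(t)=C(p(t))x(t)$. $\Sigma$ is a realization of $\mathfrak{F}$ if $\mathfrak{F}=\mathfrak{Y}_{\Sigma,x_\mathrm{o}}$ for some $x_\mathrm{o}$; it is a minimal realization of $\mathfrak{F}$ if in addition $\dim(\Sigma)\le\dim(\Sigma')$ for every LPV-SSA realization $\Sigma'$ of $\mathfrak{F}$. Let $\mathbb{I}_0^{n_\mathrm{p}}=\{0,\ldots,n_\mathrm{p}\}$ and let $\mathcal{S}(\mathbb{I}_0^{n_\mathrm{p}})$ be the set of finite sequences over it, including the empty sequence $\epsilon$; $|s|$ is the length of $s$ and juxtaposition is concatenation. Write $p_0(t)=1$ and $p_i(t)$ for the $i$th component of $p(t)$. For $s\in\mathcal{S}(\mathbb{I}_0^{n_\mathrm{p}})$ and $\tau\le t$: in CT, $(w_\epsilon\diamond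 p)(t,\tau)=1$ and $(w_{s_1\cdots s_n}\diamond p)(t,\tau)=\int_\tau^t p_{s_n}(\delta)(w_{s_1\cdots s_{n-1}}\diamond p)(\delta,\tau)\,d\delta$; in DT, $(w_{s_1\cdots s_n}\diamond p)(t,\tau)=p_{s_1}(\tau)p_{s_2}(\tau+1)\cdots p_{s_n}(t)$ if $n=t-\tau+1$ and $0$ otherwise (for $t=\tau-1$: value $1$ for $s=\epsilon$ and $0$ otherwise). $\mathfrak{F}$ has an IIR if there is a function $\theta_{\mathfrak{F}}:\mathcal{S}(\mathbb{I}_0^{n_\mathrm{p}})\to\mathbb{R}^{(n_\mathrm{p}+1)n_\mathrm{y}\times(n_\mathrm{u}(n_\mathrm{p}+1)+1)}$, whose $i$th block row ($i=0,\ldots,n_\mathrm{p}$) is $[\eta_{i,\mathfrak{F}}(s)\ \theta_{i,0,\mathfrak{F}}(s)\ \cdots\ \theta_{i,n_\mathrm{p},\mathfrak{F}}(s)]$ with $\eta_{i,\mathfrak{F}}(s)\in\mathbb{R}^{n_\mathrm{y}}$, $\theta_{i,j,\mathfrak{F}}(s)\in\mathbb{R}^{n_\mathrm{y}\times n_\mathrm{u}}$, such that (1) there are $K,R>0$ with $\|\theta_{\mathfrak{F}}(s)\|_F\le KR^{|s|}$ for all $s$ (Frobenius norm); (2) for all $(u,p)\in\mathcal{U}\times\mathcal{P}$, $t\in\mathbb{T}$: in CT, $\mathfrak{F}(u,p)(t)=(g\diamond p)(t)+\int_0^t(h\diamond p)(\delta,t)u(\delta)\,d\delta$ with $(g\diamond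 p)(t)=\sum_{i}\sum_{s}p_i(t)\eta_{i,\mathfrak{F}}(s)(w_s\diamond p)(t,0)$ and $(h\diamond p)(\delta,t)=\sum_{i,j}\sum_s\theta_{i,j,\mathfrak{F}}(s)p_i(t)p_j(\delta)(w_s\diamond p)(t,\delta)$; in DT, $\mathfrak{F}(u,p)(t)=(g\diamond p)(t)+\sum_{\delta=0}^{t-1}(h\diamond p)(\delta,t)u(\delta)$ with $(g\diamond p)(t)=\sum_{i,s}\eta_{i,\mathfrak{F}}(s)p_i(t)(w_s\diamond p)(t-1,0)$ and $(h\diamond p)(\delta,t)=\sum_{i,j,s}\theta_{i,j,\mathfrak{F}}(s)p_i(t)p_j(\delta)(w_s\diamond p)(t-1,\delta+1)$; here $i,j$ range over $\mathbb{I}_0^{n_\mathrm{p}}$ and $s$ over $\mathcal{S}(\mathbb{I}_0^{n_\mathrm{p}})$. The function $\theta_{\mathfrak{F}}$ is uniquely determined by $\mathfrak{F}$. Order $\mathcal{S}(\mathbb{I}_0^{n_\mathrm{p}})$ by length and, within equal length, lexicographically; let $\epsilon=s^{(0)}\prec s^{(1)}\prec\cdots$ be the resulting enumeration. The Hankel matrix $\mathcal{H}_{\mathfrak{F}}$ is the infinite block matrix whose block in block row $i$ and block column $j$ ($i,j\ge0$) is $\theta_{\mathfrak{F}}(s^{(j)}s^{(i)})$. Its rank is the dimension of the span of its columns. *)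

theory Defs
  imports
    "HOL-Analysis.Analysis"
    "HOL-Library.Function_Algebras"
    "HOL-Library.Option_ord"
    "HOL-Library.Extended_Nat"
begin

(* The positive dimensions n_u, n_y, n_p are the cardinalities of the index types 'u, 'y, 'p.
   The index set {0, ..., n_p} is the type 'p option: None is the index 0, and Some i is the
   i-th coordinate.  Theory Option_ord makes None the least element. *)

instantiation "fun" :: (type, real_vector) real_vector
begin

definition scaleR_fun :: "real \<Rightarrow> ('a \<Rightarrow> 'b) \<Rightarrow> 'a \<Rightarrow> 'b"
  where "scaleR_fun c f = (\<lambda>x. c *\<^sub>R f x)"

instance
  by standard (simp_all add: scaleR_fun_def fun_eq_iff algebra_simps)

end

lemma scaleR_fun_apply [simp]: "(c *\<^sub>R f) x = c *\<^sub>R f x"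
  by (simp add: scaleR_fun_def)


definition piecewise_continuous :: "(real \<Rightarrow> 'a::real_normed_vector) \<Rightarrow> bool"
  where "piecewise_continuous f \<longleftrightarrow>
    (\<forall>a b. 0 \<le> a \<longrightarrow> finite {t \<in> {a..b}. \<not> continuous (at t within {0..}) f}) \<and>
    (\<forall>t\<ge>0. \<not> continuous (at t within {0..}) f \<longrightarrow>
       (\<exists>l. (f \<longlongrightarrow> l) (at_right t)) \<and> (t > 0 \<longrightarrow> (\<exists>l. (f \<longlongrightarrow> l) (at_left t))))"

(* Functions on the half line are extensional functions on the reals, so that the elements of
   this set correspond one to one to functions defined on the half line only. *)
definition ct_signals :: "'a::real_normed_vector set \<Rightarrow> (real \<Rightarrow> 'a) set"
  where "ct_signals X = {f \<in> {0..} \<rightarrow>\<^sub>E X. piecewise_continuous f}"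

definition dt_signals :: "'a set \<Rightarrow> (nat \<Rightarrow> 'a) set"
  where "dt_signals X = UNIV \<rightarrow> X"


(* Row and column indices over the state space range over {..<sdim S}; only those entries of
   the coefficient matrices are ever used. *)
datatype ('p, 'u, 'y) lpv_ssa = LPV_SSA
  (sdim: nat)
  (Acoef: "'p option \<Rightarrow> nat \<Rightarrow> nat \<Rightarrow> real")
  (Bcoef: "'p option \<Rightarrow> nat \<Rightarrow> 'u \<Rightarrow> real")
  (Ccoef: "'p option \<Rightarrow> 'y \<Rightarrow> nat \<Rightarrow> real")

definition affine_dep :: "('p option \<Rightarrow> 'a::real_vector) \<Rightarrow> real^'p \<Rightarrow> 'a"
  where "affine_dep M q = M None + (\<Sum>i\<in>UNIV. (q $ i) *\<^sub>R M (Some i))"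

definition state_space :: "('p, 'u, 'y) lpv_ssa \<Rightarrow> (nat \<Rightarrow> real) set"
  where "state_space S = {..<sdim S} \<rightarrow>\<^sub>E UNIV"

definition state_rhs ::
  "('p, 'u, 'y) lpv_ssa \<Rightarrow> real^'p \<Rightarrow> (nat \<Rightarrow> real) \<Rightarrow> real^'u \<Rightarrow> nat \<Rightarrow> real"
  where "state_rhs S q x v = (\<lambda>k\<in>{..<sdim S}.
    (\<Sum>l<sdim S. affine_dep (Acoef S) q k l * x l) +
    (\<Sum>j\<in>UNIV. affine_dep (Bcoef S) q k j * v $ j))"

definition output_map :: "('p, 'u, 'y) lpv_ssa \<Rightarrow> real^'p \<Rightarrow> (nat \<Rightarrow> real) \<Rightarrow> real^'y"
  where "output_map S q x = (\<chi> i. \<Sum>l<sdim S. affine_dep (Ccoef S) q i l * x l)"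

definition absolutely_continuous_on :: "real set \<Rightarrow> (real \<Rightarrow> real) \<Rightarrow> bool"
  where "absolutely_continuous_on X f \<longleftrightarrow>
    (\<forall>\<epsilon>>0. \<exists>\<delta>>0. \<forall>d. d division_of \<Union>d \<and> \<Union>d \<subseteq> X \<and> (\<Sum>K\<in>d. Sup K - Inf K) < \<delta> \<longrightarrow>
       (\<Sum>K\<in>d. \<bar>f (Sup K) - f (Inf K)\<bar>) < \<epsilon>)"

definition ct_is_trajectory ::
  "('p, 'u, 'y) lpv_ssa \<Rightarrow> (nat \<Rightarrow> real) \<Rightarrow> (real \<Rightarrow> real^'u) \<Rightarrow> (real \<Rightarrow> real^'p) \<Rightarrow>
   (real \<Rightarrow> nat \<Rightarrow> real) \<Rightarrow> bool"
  where "ct_is_trajectory S x0 u p x \<longleftrightarrow>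
    x \<in> {0..} \<rightarrow>\<^sub>E state_space S \<and> x 0 = x0 \<and>
    (\<forall>k<sdim S. \<forall>T\<ge>0. absolutely_continuous_on {0..T} (\<lambda>t. x t k)) \<and>
    (AE t in lebesgue. t \<ge> 0 \<longrightarrow> (\<forall>k<sdim S.
       ((\<lambda>\<tau>. x \<tau> k) has_real_derivative state_rhs S (p t) (x t) (u t) k) (at t within {0..})))"

(* The trajectory is unique as a function because values outside the half line and components
   outside {..<sdim S} are fixed by extensionality; the same holds for theta below, all of whose
   arguments range over whole types. *)
definition ct_state ::
  "('p, 'u, 'y) lpv_ssa \<Rightarrow> (nat \<Rightarrow> real) \<Rightarrow> (real \<Rightarrow> real^'u) \<Rightarrow> (real \<Rightarrow> real^'p) \<Rightarrow>
   real \<Rightarrow> nat \<Rightarrow> real"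
  where "ct_state S x0 u p = (THE x. ct_is_trajectory S x0 u p x)"

definition ct_output ::
  "('p, 'u, 'y) lpv_ssa \<Rightarrow> (nat \<Rightarrow> real) \<Rightarrow> (real \<Rightarrow> real^'u) \<times> (real \<Rightarrow> real^'p) \<Rightarrow>
   real \<Rightarrow> real^'y"
  where "ct_output S x0 = (\<lambda>(u, p). \<lambda>t\<in>{0..}. output_map S (p t) (ct_state S x0 u p t))"

primrec dt_state ::
  "('p, 'u, 'y) lpv_ssa \<Rightarrow> (nat \<Rightarrow> real) \<Rightarrow> (nat \<Rightarrow> real^'u) \<Rightarrow> (nat \<Rightarrow> real^'p) \<Rightarrow>
   nat \<Rightarrow> nat \<Rightarrow> real"
  where
    "dt_state S x0 u p 0 = x0"
  | "dt_state S x0 u p (Suc t) = state_rhs S (p t) (dt_state S x0 u p t) (u t)"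

definition dt_output ::
  "('p, 'u, 'y) lpv_ssa \<Rightarrow> (nat \<Rightarrow> real) \<Rightarrow> (nat \<Rightarrow> real^'u) \<times> (nat \<Rightarrow> real^'p) \<Rightarrow>
   nat \<Rightarrow> real^'y"
  where "dt_output S x0 = (\<lambda>(u, p) t. output_map S (p t) (dt_state S x0 u p t))"

definition ct_realization ::
  "(real^'p) set \<Rightarrow> ('p, 'u, 'y) lpv_ssa \<Rightarrow>
   ((real \<Rightarrow> real^'u) \<times> (real \<Rightarrow> real^'p) \<Rightarrow> real \<Rightarrow> real^'y) \<Rightarrow> bool"
  where "ct_realization P S F \<longleftrightarrow>
    (\<exists>x0\<in>state_space S. \<forall>w\<in>ct_signals UNIV \<times> ct_signals P. F w = ct_output S x0 w)"

definition dt_realization ::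
  "(real^'p) set \<Rightarrow> ('p, 'u, 'y) lpv_ssa \<Rightarrow>
   ((nat \<Rightarrow> real^'u) \<times> (nat \<Rightarrow> real^'p) \<Rightarrow> nat \<Rightarrow> real^'y) \<Rightarrow> bool"
  where "dt_realization P S F \<longleftrightarrow>
    (\<exists>x0\<in>state_space S. \<forall>w\<in>dt_signals UNIV \<times> dt_signals P. F w = dt_output S x0 w)"

definition ct_minimal_realization ::
  "(real^'p) set \<Rightarrow> ('p, 'u, 'y) lpv_ssa \<Rightarrow>
   ((real \<Rightarrow> real^'u) \<times> (real \<Rightarrow> real^'p) \<Rightarrow> real \<Rightarrow> real^'y) \<Rightarrow> bool"
  where "ct_minimal_realization P S F \<longleftrightarrow>
    ct_realization P S F \<and> (\<forall>S'. ct_realization P S' F \<longrightarrow> sdim S \<le> sdim S')"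

definition dt_minimal_realization ::
  "(real^'p) set \<Rightarrow> ('p, 'u, 'y) lpv_ssa \<Rightarrow>
   ((nat \<Rightarrow> real^'u) \<times> (nat \<Rightarrow> real^'p) \<Rightarrow> nat \<Rightarrow> real^'y) \<Rightarrow> bool"
  where "dt_minimal_realization P S F \<longleftrightarrow>
    dt_realization P S F \<and> (\<forall>S'. dt_realization P S' F \<longrightarrow> sdim S \<le> sdim S')"


definition sched :: "real^'p \<Rightarrow> 'p option \<Rightarrow> real"
  where "sched q i = (case i of None \<Rightarrow> 1 | Some k \<Rightarrow> q $ k)"

(* The recursion removes the last letter of a word, hence works on the reversed word. *)
primrec ct_w_rev :: "'p option list \<Rightarrow> (real \<Rightarrow> real^'p) \<Rightarrow> real \<Rightarrow> real \<Rightarrow> real"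
  where
    "ct_w_rev [] p t \<tau> = 1"
  | "ct_w_rev (i # r) p t \<tau> = integral {\<tau>..t} (\<lambda>\<delta>. sched (p \<delta>) i * ct_w_rev r p \<delta> \<tau>)"

definition ct_w :: "'p option list \<Rightarrow> (real \<Rightarrow> real^'p) \<Rightarrow> real \<Rightarrow> real \<Rightarrow> real"
  where "ct_w s = ct_w_rev (rev s)"

(* The first time argument may be -1, so times are integers here. *)
definition dt_w :: "'p option list \<Rightarrow> (nat \<Rightarrow> real^'p) \<Rightarrow> int \<Rightarrow> int \<Rightarrow> real"
  where "dt_w s p t \<tau> =
    (if int (length s) = t - \<tau> + 1
     then \<Prod>k<length s. sched (p (nat (\<tau> + int k))) (s ! k) else 0)"

(* Values of theta are indexed by (i, row) with i in {0, ..., n_p}, and by columns None (the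
   column eta) and Some (j, column) (the block theta_{.,j}).  The Euclidean norm of such a
   matrix is its Frobenius norm. *)
type_synonym ('p, 'u, 'y) theta_mat = "real^(('p option \<times> 'u) option)^('p option \<times> 'y)"

definition eta_block :: "('p::finite, 'u::finite, 'y::finite) theta_mat \<Rightarrow> 'p option \<Rightarrow> real^'y"
  where "eta_block M i = (\<chi> r. M $ (i, r) $ None)"

definition theta_block ::
  "('p::finite, 'u::finite, 'y::finite) theta_mat \<Rightarrow> 'p option \<Rightarrow> 'p option \<Rightarrow> real^'u^'y"
  where "theta_block M i j = (\<chi> r c. M $ (i, r) $ Some (j, c))"

(* The sums over all words are unconditional; in continuous time they converge absolutely
   under the growth bound, in discrete time only finitely many terms are nonzero. *)

definition ct_g ::
  "('p option list \<Rightarrow> ('p::finite, 'u::finite, 'y::finite) theta_mat) \<Rightarrow>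
   (real \<Rightarrow> real^'p) \<Rightarrow> real \<Rightarrow> real^'y"
  where "ct_g \<theta> p t =
    (\<Sum>i\<in>UNIV. \<Sum>\<^sub>\<infinity>s. (sched (p t) i * ct_w s p t 0) *\<^sub>R eta_block (\<theta> s) i)"

definition ct_h ::
  "('p option list \<Rightarrow> ('p::finite, 'u::finite, 'y::finite) theta_mat) \<Rightarrow>
   (real \<Rightarrow> real^'p) \<Rightarrow> real \<Rightarrow> real \<Rightarrow> real^'u^'y"
  where "ct_h \<theta> p \<delta> t =
    (\<Sum>i\<in>UNIV. \<Sum>j\<in>UNIV. \<Sum>\<^sub>\<infinity>s.
       (sched (p t) i * sched (p \<delta>) j * ct_w s p t \<delta>) *\<^sub>R theta_block (\<theta> s) i j)"

definition dt_g ::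
  "('p option list \<Rightarrow> ('p::finite, 'u::finite, 'y::finite) theta_mat) \<Rightarrow>
   (nat \<Rightarrow> real^'p) \<Rightarrow> nat \<Rightarrow> real^'y"
  where "dt_g \<theta> p t =
    (\<Sum>i\<in>UNIV. \<Sum>\<^sub>\<infinity>s. (sched (p t) i * dt_w s p (int t - 1) 0) *\<^sub>R eta_block (\<theta> s) i)"

definition dt_h ::
  "('p option list \<Rightarrow> ('p::finite, 'u::finite, 'y::finite) theta_mat) \<Rightarrow>
   (nat \<Rightarrow> real^'p) \<Rightarrow> nat \<Rightarrow> nat \<Rightarrow> real^'u^'y"
  where "dt_h \<theta> p \<delta> t =
    (\<Sum>i\<in>UNIV. \<Sum>j\<in>UNIV. \<Sum>\<^sub>\<infinity>s.
       (sched (p t) i * sched (p \<delta>) j * dt_w s p (int t - 1) (int \<delta> + 1))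
         *\<^sub>R theta_block (\<theta> s) i j)"

definition growth_bounded ::
  "('p option list \<Rightarrow> ('p::finite, 'u::finite, 'y::finite) theta_mat) \<Rightarrow> bool"
  where "growth_bounded \<theta> \<longleftrightarrow> (\<exists>K>0. \<exists>R>0. \<forall>s. norm (\<theta> s) \<le> K * R ^ length s)"

definition ct_is_iir ::
  "(real^'p) set \<Rightarrow> ((real \<Rightarrow> real^'u) \<times> (real \<Rightarrow> real^'p) \<Rightarrow> real \<Rightarrow> real^'y) \<Rightarrow>
   ('p option list \<Rightarrow> ('p::finite, 'u::finite, 'y::finite) theta_mat) \<Rightarrow> bool"
  where "ct_is_iir P F \<theta> \<longleftrightarrow> growth_bounded \<theta> \<and>
    (\<forall>u\<in>ct_signals UNIV. \<forall>p\<in>ct_signals P. \<forall>t\<ge>0.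
       F (u, p) t = ct_g \<theta> p t + integral {0..t} (\<lambda>\<delta>. ct_h \<theta> p \<delta> t *v u \<delta>))"

definition dt_is_iir ::
  "(real^'p) set \<Rightarrow> ((nat \<Rightarrow> real^'u) \<times> (nat \<Rightarrow> real^'p) \<Rightarrow> nat \<Rightarrow> real^'y) \<Rightarrow>
   ('p option list \<Rightarrow> ('p::finite, 'u::finite, 'y::finite) theta_mat) \<Rightarrow> bool"
  where "dt_is_iir P F \<theta> \<longleftrightarrow> growth_bounded \<theta> \<and>
    (\<forall>u\<in>dt_signals UNIV. \<forall>p\<in>dt_signals P. \<forall>t.
       F (u, p) t = dt_g \<theta> p t + (\<Sum>\<delta><t. dt_h \<theta> p \<delta> t *v u \<delta>))"

definition ct_has_iir ::
  "(real^'p::finite) set \<Rightarrow>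
   ((real \<Rightarrow> real^'u::finite) \<times> (real \<Rightarrow> real^'p) \<Rightarrow> real \<Rightarrow> real^'y::finite) \<Rightarrow> bool"
  where "ct_has_iir P F \<longleftrightarrow> (\<exists>\<theta>. ct_is_iir P F \<theta>)"

definition dt_has_iir ::
  "(real^'p::finite) set \<Rightarrow>
   ((nat \<Rightarrow> real^'u::finite) \<times> (nat \<Rightarrow> real^'p) \<Rightarrow> nat \<Rightarrow> real^'y::finite) \<Rightarrow> bool"
  where "dt_has_iir P F \<longleftrightarrow> (\<exists>\<theta>. dt_is_iir P F \<theta>)"

definition ct_theta ::
  "(real^'p::finite) set \<Rightarrow>
   ((real \<Rightarrow> real^'u::finite) \<times> (real \<Rightarrow> real^'p) \<Rightarrow> real \<Rightarrow> real^'y::finite) \<Rightarrow>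
   'p option list \<Rightarrow> ('p, 'u, 'y) theta_mat"
  where "ct_theta P F = (THE \<theta>. ct_is_iir P F \<theta>)"

definition dt_theta ::
  "(real^'p::finite) set \<Rightarrow>
   ((nat \<Rightarrow> real^'u::finite) \<times> (nat \<Rightarrow> real^'p) \<Rightarrow> nat \<Rightarrow> real^'y::finite) \<Rightarrow>
   'p option list \<Rightarrow> ('p, 'u, 'y) theta_mat"
  where "dt_theta P F = (THE \<theta>. dt_is_iir P F \<theta>)"


(* word_enum n is the unique word with exactly n predecessors in the length-lexicographic
   order. *)
definition word_enum :: "nat \<Rightarrow> 'a::{finite, linorder} list"
  where "word_enum n = (THE s. card {r. (r, s) \<in> lenlex {(a, b). a < b}} = n)"

definition hankel ::
  "('p option list \<Rightarrow> ('p::{finite, linorder}, 'u::finite, 'y::finite) theta_mat) \<Rightarrow>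
   nat \<times> ('p option \<times> 'y) \<Rightarrow> nat \<times> (('p option \<times> 'u) option) \<Rightarrow> real"
  where "hankel \<theta> = (\<lambda>(i, r) (j, c). \<theta> (word_enum j @ word_enum i) $ r $ c)"

(* The library function dim is only meaningful on finite-dimensional subspaces. *)
definition col_rank :: "('r \<Rightarrow> 'c \<Rightarrow> real) \<Rightarrow> enat"
  where "col_rank H =
    (let V = span (range (\<lambda>c r. H r c))
     in if \<exists>B. finite B \<and> V = span B then enat (dim V) else \<infinity>)"

end

theory Submission
  imports Defs
begin

text \<open>The impulse response coefficients of a realization are \<open>\<theta>\<^sub>i\<^sub>j(s) = C\<^sub>i A\<^sub>s B\<^sub>j\<close>, where \<open>A\<^sub>s\<close> is the
  product of the state matrices along the word \<open>s\<close>, and \<open>C\<^sub>i A\<^sub>s x\<^sub>0\<close> for the free response. They are unique,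
  because extending a scheduling signal by a constant value strips the last letter off all words,
  and values of the scheduling signal affinely span the whole space. Every column of the Hankel
  matrix of a realization is a linear combination of the columns \<open>(C\<^sub>i A\<^sub>s e\<^sub>k)\<close>, so the rank is at most
  the state dimension; conversely, a finite-dimensional column space carries a realization of its
  own dimension, in which letters act by shifts. In continuous time the state is a word series over
  an alphabet that also contains the products of scheduling and input components: removing the last
  letter of the words yields the differential equation, and removing the first letter yields the
  impulse response formula.\<close>

section \<open>Absolutely and piecewise continuous functions\<close>

text \<open>Everything about realizations passes through one equivalence: a system realizes
  \<open>F\<close> exactly when its coefficient family \<open>theta_of\<close> is an impulse
  response of \<open>F\<close>. Once that family is unique, what remains is linear algebra of Hankel
  matrices, the same in both time domains; a minimal dimension is squeezed between the rank as a
  lower bound and a system attaining it. The affine hull assumption enters through uniqueness: it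
  makes the functions 1, q_1, ..., q_n linearly independent on \<open>P\<close>. The main work in
  continuous time comes from the weak notion of trajectory. \<open>ct_state\<close> is a definite
  description, so existence and uniqueness of absolutely continuous solutions driven by
  discontinuous signals must both be shown, which calls for a fundamental theorem of calculus with a
  null set of exceptions. Uniqueness of the coefficients is also more delicate there: changing the
  scheduling signal at one instant leaves all iterated integrals unchanged, so a switched signal has
  to run a little longer and the result is differentiated.\<close>

lemma absolutely_continuous_imp_has_integral:
  fixes f f' :: "real \<Rightarrow> real"
  assumes "a \<le> b" and ac: "absolutely_continuous_on {a..b} f" and N: "negligible N"
    and deriv: "\<And>x. x \<in> {a..b} - N \<Longrightarrow> (f has_real_derivative f' x) (at x within {a..b})"
  shows "(f' has_integral (f b - f a)) {a..b}"
proof (cases "a = b")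
  case True
  then show ?thesis by auto
next
  case False
  with \<open>a \<le> b\<close> have "a < b" by simp
  \<comment> \<open>With the value 0 on \<open>N\<close>, a term of the Riemann sum tagged in
    \<open>N\<close> leaves only the increment of \<open>f\<close>. The original \<open>f'\<close>
    is restored at the end, as \<open>N\<close> is negligible.\<close>
  define g where "g x = (if x \<in> N then 0 else f' x)" for x
  have "(g has_integral (f b - f a)) {a..b}"
    unfolding has_integral_factor_content box_real[symmetric]
  proof safe
    fix e :: real
    assume "e > 0"
    \<comment> \<open>Half of the permitted error \<open>e * (b - a)\<close> is reserved for the
      intervals tagged in \<open>N\<close>; all others receive \<open>e/2\<close> per unit of
      length.\<close>
    define e1 where "e1 = e * (b - a) / 2"
    have "e1 > 0" using \<open>e > 0\<close> \<open>a < b\<close> by (simp add: e1_def)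
    obtain \<delta> where "\<delta> > 0" and \<delta>: "\<And>d. d division_of \<Union>d \<Longrightarrow> \<Union>d \<subseteq> {a..b} \<Longrightarrow>
        (\<Sum>K\<in>d. Sup K - Inf K) < \<delta> \<Longrightarrow> (\<Sum>K\<in>d. \<bar>f (Sup K) - f (Inf K)\<bar>) < e1"
      using ac[unfolded absolutely_continuous_on_def, rule_format, OF \<open>e1 > 0\<close>] by auto
    have "N \<in> sets lebesgue" "N \<in> null_sets lebesgue"
      using N negligible_iff_null_sets by auto
    then obtain T where "open T" "N \<subseteq> T" "T - N \<in> lmeasurable" "emeasure lebesgue (T - N) < ennreal \<delta>"
      using sets_lebesgue_outer_open[OF _ \<open>\<delta> > 0\<close>] by metis
    then have T: "T \<in> lmeasurable" "measure lebesgue T < \<delta>"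
    proof -
      have "T = (T - N) \<union> N" using \<open>N \<subseteq> T\<close> by auto
      moreover have "N \<in> lmeasurable"
        using N negligible_imp_measurable by blast
      ultimately show "T \<in> lmeasurable"
        by (metis \<open>T - N \<in> lmeasurable\<close> fmeasurable.Un)
      have "measure lebesgue (T - N) < \<delta>"
        using \<open>emeasure lebesgue (T - N) < ennreal \<delta>\<close> \<open>T - N \<in> lmeasurable\<close> \<open>\<delta> > 0\<close>
        by (simp add: emeasure_eq_measure2 ennreal_less_iff)
      then show "measure lebesgue T < \<delta>"
        using \<open>N \<in> null_sets lebesgue\<close> \<open>T \<in> lmeasurable\<close> by (simp add: measure_Diff_null_set fmeasurableD)
    qed
    \<comment> \<open>At points of \<open>N\<close> the gauge keeps intervals inside the thin open
      set \<open>T\<close>, so that their total length stays below \<delta>; elsewhere it enforces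
      the derivative estimate.\<close>
    have "\<exists>d>0. (x \<in> N \<longrightarrow> ball x d \<subseteq> T) \<and> (x \<in> {a..b} - N \<longrightarrow>
         (\<forall>y\<in>{a..b}. norm (y - x) < d \<longrightarrow> norm (f y - f x - (y - x) *\<^sub>R g x) \<le> e/2 * norm (y - x)))" for x
    proof (cases "x \<in> N")
      case True
      then show ?thesis using \<open>open T\<close> \<open>N \<subseteq> T\<close> open_contains_ball by auto
    next
      case False
      show ?thesis
      proof (cases "x \<in> {a..b}")
        case True
        then have "(f has_vector_derivative f' x) (at x within {a..b})"
          using deriv False by (simp add: has_real_derivative_iff_has_vector_derivative)
        then have "\<exists>d>0. \<forall>y\<in>{a..b}. norm (y - x) < d \<longrightarrow>
            norm (f y - f x - (y - x) *\<^sub>R f' x) \<le> e/2 * norm (y - x)"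
          using half_gt_zero[OF \<open>e > 0\<close>]
          unfolding has_vector_derivative_def has_derivative_within_alt by blast
        then show ?thesis using False by (auto simp: g_def)
      qed (use False in \<open>auto intro: exI[of _ 1]\<close>)
    qed
    then obtain d where d: "\<And>x. 0 < d x" "\<And>x. x \<in> N \<Longrightarrow> ball x (d x) \<subseteq> T"
      "\<And>x y. x \<in> {a..b} - N \<Longrightarrow> y \<in> {a..b} \<Longrightarrow> norm (y - x) < d x \<Longrightarrow>
         norm (f y - f x - (y - x) *\<^sub>R g x) \<le> e/2 * norm (y - x)"
      by metis
    show "\<exists>d. gauge d \<and> (\<forall>p. p tagged_division_of (cbox a b) \<and> d fine p \<longrightarrow>
      norm ((\<Sum>(x, k)\<in>p. measure lborel k *\<^sub>R g x) - (f b - f a)) \<le> e * measure lborel (cbox a b))"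
    proof (rule exI, safe)
      show "gauge (\<lambda>x. ball x (d x))"
        using d(1) gauge_ball_dependent by blast
    next
      fix p
      assume ptag: "p tagged_division_of cbox a b" and finep: "(\<lambda>x. ball x (d x)) fine p"
      have ba: "b - a = (\<Sum>(x,K)\<in>p. Sup K - Inf K)" "f b - f a = (\<Sum>(x,K)\<in>p. f(Sup K) - f(Inf K))"
        using additive_tagged_division_1[where f= "\<lambda>x. x"] additive_tagged_division_1[where f= f]
              \<open>a \<le> b\<close> ptag by auto
      have finp: "finite p" using ptag by blast
      define r where "r = {(x, K) \<in> p. x \<in> N}"
      have rp: "r \<subseteq> p" by (auto simp: r_def)
      define h where "h K = (if K = {} then 0 else \<bar>f (Sup K) - f (Inf K)\<bar>)" for K
      have K: "\<exists>u v. K = {u..v} \<and> u \<le> v \<and> x \<in> K \<and> K \<subseteq> {a..b} \<and> measure lborel K = Sup K - Inf K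
           \<and> Sup K = v \<and> Inf K = u" if xK: "(x, K) \<in> p" for x K
      proof -
        have "x \<in> K" "K \<subseteq> cbox a b" using ptag xK by blast+
        moreover obtain u v where "K = cbox u v" using tagged_division_ofD(4)[OF ptag xK] by blast
        ultimately show ?thesis by force
      qed
      have 1: "norm (measure lborel K *\<^sub>R g x - (f (Sup K) - f (Inf K)))
          \<le> (if (x, K) \<in> r then h K else 0) + e/2 * (Sup K - Inf K)" if xK: "(x, K) \<in> p" for x K
      proof -
        obtain u v where uv: "K = {u..v}" "u \<le> v" "x \<in> K" "K \<subseteq> {a..b}" "measure lborel K = Sup K - Inf K"
           "Sup K = v" "Inf K = u" using K[OF xK] by blast
        have m: "measure lborel K = v - u" using uv(5-7) by simp
        show ?thesis
        proof (cases "x \<in> N")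
          case True
          then show ?thesis using uv xK \<open>e > 0\<close> by (auto simp: r_def h_def g_def abs_minus_commute[of "f u"])
        next
          case False
          have ball: "\<forall>y\<in>K. y \<in> ball x (d x)"
            using finep \<open>(x, K) \<in> p\<close> by blast
          have "u \<in> K" "v \<in> K" using uv by auto
          have "norm ((v - u) *\<^sub>R g x - (f v - f u))
              = norm (f u - f x - (u - x) *\<^sub>R g x - (f v - f x - (v - x) *\<^sub>R g x))"
            by (auto simp: algebra_simps)
          also have "\<dots> \<le> norm (f u - f x - (u - x) *\<^sub>R g x) + norm (f v - f x - (v - x) *\<^sub>R g x)"
            by (rule norm_triangle_ineq4)
          also have "\<dots> \<le> e/2 * norm (u - x) + e/2 * norm (v - x)"
          proof (intro add_mono d(3))
            show "norm (u - x) < d x" "norm (v - x) < d x"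
              using ball \<open>u \<in> K\<close> \<open>v \<in> K\<close> by (auto simp: dist_norm norm_minus_commute)
          qed (use uv False in auto)
          also have "\<dots> = e/2 * (v - u)" using uv by (auto simp: field_simps)
          finally show ?thesis using uv xK False by (auto simp: r_def)
        qed
      qed
      have rpart: "r tagged_partial_division_of cbox a b"
        by (rule tagged_partial_division_subset[OF _ rp]) (use ptag in \<open>simp add: tagged_division_of_def\<close>)
      note rdiv = tagged_partial_division_of_Union_self[OF rpart]
      have sdiv: "snd ` r division_of \<Union>(snd ` r)"
        using division_of_tagged_division[OF rdiv] .
      \<comment> \<open>Absolute continuity speaks of sets of intervals, a tagged division of pairs.
        Two tags can share only an interval with empty interior, where \<open>h\<close> vanishes;
        the case \<open>{}\<close> is explicit in \<open>h\<close> because \<open>Sup {}\<close> and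
        \<open>Inf {}\<close> are unspecified.\<close>
      have hsum: "(\<Sum>(x, K)\<in>r. h K) = sum h (snd ` r)"
      proof (rule sum.over_tagged_division_lemma[OF rdiv])
        fix u v :: real assume "box u v = {}"
        then show "h (cbox u v) = 0" by (cases "u = v") (auto simp: h_def)
      qed
      have Kr: "K \<noteq> {} \<and> K \<subseteq> {a..b} \<and> K \<subseteq> T \<and> measure lborel K = Sup K - Inf K \<and> (\<exists>u v. K = cbox u v)" 
        if Kr: "K \<in> snd ` r" for K
      proof -
        obtain x where xK: "(x, K) \<in> p" "x \<in> N" using Kr by (auto simp: r_def)
        then have "K \<subseteq> ball x (d x)" using finep by blast
        then have "K \<subseteq> T" using d(2)[OF xK(2)] by auto
        then show ?thesis using K[OF xK(1)] by force
      qed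
      have "(\<Sum>K\<in>snd ` r. Sup K - Inf K) = (\<Sum>K\<in>snd ` r. measure lebesgue K)"
      proof (rule sum.cong[OF refl])
        fix K assume Kin: "K \<in> snd ` r"
        obtain u v where "K = cbox u v" using Kr[OF Kin] by (elim conjE exE)
        moreover have "measure lborel K = Sup K - Inf K" using Kr[OF Kin] by (elim conjE)
        ultimately show "Sup K - Inf K = measure lebesgue K"
          using measure_completion[of "cbox u v" lborel] by (metis sets_lborel borel_closed closed_cbox)
      qed
      also have "\<dots> = measure lebesgue (\<Union>(snd ` r))"
      proof (rule measure_negligible_finite_Union[symmetric])
        show "finite (snd ` r)" using finp rp finite_subset by auto
        show "S \<in> lmeasurable" if "S \<in> snd ` r" for S
          using Kr[OF that] by (elim conjE exE) simp
        show "pairwise (\<lambda>S T. negligible (S \<inter> T)) (snd ` r)"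
        proof (rule pairwiseI)
          fix S T assume ST: "S \<in> snd ` r" "T \<in> snd ` r" "S \<noteq> T"
          then have "interior (S \<inter> T) = {}" using division_ofD(5)[OF sdiv ST] by simp
          moreover have "convex S" "convex T"
            using Kr[OF ST(1)] Kr[OF ST(2)] by (elim conjE exE; simp)+
          then have "convex (S \<inter> T)" by (rule convex_Int)
          ultimately show "negligible (S \<inter> T)" by (simp add: negligible_convex_interior)
        qed
      qed
      also have "\<dots> \<le> measure lebesgue T"
      proof (rule measure_mono_fmeasurable)
        show "\<Union>(snd ` r) \<subseteq> T" using Kr by blast
        show "\<Union>(snd ` r) \<in> sets lebesgue"
        proof (intro sets.finite_Union finite_imageI subsetI)
          show "finite r" using rp finp by (rule finite_subset)
          show "K \<in> sets lebesgue" if "K \<in> snd ` r" for K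
            using Kr[OF that] by (elim conjE exE) simp
        qed
      qed (fact T)
      finally have "(\<Sum>K\<in>snd ` r. Sup K - Inf K) < \<delta>" using T by linarith
      then have "(\<Sum>K\<in>snd ` r. \<bar>f (Sup K) - f (Inf K)\<bar>) < e1"
        using Kr by (intro \<delta> sdiv) auto
      moreover have "(\<Sum>K\<in>snd ` r. \<bar>f (Sup K) - f (Inf K)\<bar>) = sum h (snd ` r)"
        using Kr by (intro sum.cong) (auto simp: h_def)
      ultimately have hle: "(\<Sum>(x, K)\<in>r. h K) \<le> e1" using hsum by linarith
      have "norm ((\<Sum>(x, k)\<in>p. measure lborel k *\<^sub>R g x) - (f b - f a))
          = norm (\<Sum>(x, K)\<in>p. measure lborel K *\<^sub>R g x - (f (Sup K) - f (Inf K)))"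
        unfolding ba(2) by (simp add: sum_subtractf split_def)
      also have "\<dots> \<le> (\<Sum>(x, K)\<in>p. (if (x, K) \<in> r then h K else 0) + e/2 * (Sup K - Inf K))"
        using 1 by (intro sum_norm_le) auto
      also have "\<dots> = (\<Sum>z\<in>p. if z \<in> r then h (snd z) else 0) + e/2 * (b - a)"
        unfolding ba(1) by (simp add: split_def sum.distrib sum_distrib_left)
      also have "(\<Sum>z\<in>p. if z \<in> r then h (snd z) else 0) = (\<Sum>(x, K)\<in>r. h K)"
        using rp finp by (simp add: sum.If_cases split_def Int_absorb1)
      also have "(\<Sum>(x, K)\<in>r. h K) + e/2 * (b - a) \<le> e * measure lborel (cbox a b)"
        using hle \<open>a \<le> b\<close> by (simp add: e1_def field_simps)
      finally show "norm ((\<Sum>(x, k)\<in>p. measure lborel k *\<^sub>R g x) - (f b - f a)) \<le> e * measure lborel (cbox a b)"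
        by simp
    qed
  qed
  then show ?thesis
    by (rule has_integral_spike[OF N, rotated]) (auto simp: g_def)
qed

lemma lipschitz_imp_absolutely_continuous:
  fixes f :: "real \<Rightarrow> real"
  assumes L: "\<And>s t. s \<in> {a..b} \<Longrightarrow> t \<in> {a..b} \<Longrightarrow> s \<le> t \<Longrightarrow> \<bar>f t - f s\<bar> \<le> L * (t - s)" and "L \<ge> 0"
  shows "absolutely_continuous_on {a..b} f"
  unfolding absolutely_continuous_on_def
proof (intro allI impI)
  fix e :: real assume "e > 0"
  show "\<exists>\<delta>>0. \<forall>d. d division_of \<Union>d \<and> \<Union>d \<subseteq> {a..b} \<and> (\<Sum>K\<in>d. Sup K - Inf K) < \<delta> \<longrightarrow>
       (\<Sum>K\<in>d. \<bar>f (Sup K) - f (Inf K)\<bar>) < e"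
  proof (intro exI conjI allI impI)
    show "e / (L + 1) > 0" using \<open>e > 0\<close> \<open>L \<ge> 0\<close> by simp
    fix d assume d: "d division_of \<Union>d \<and> \<Union>d \<subseteq> {a..b} \<and> (\<Sum>K\<in>d. Sup K - Inf K) < e / (L + 1)"
    have Kd: "\<bar>f (Sup K) - f (Inf K)\<bar> \<le> L * (Sup K - Inf K) \<and> Sup K - Inf K \<ge> 0" if Kd: "K \<in> d" for K
    proof -
      obtain u v where "K = cbox u v" "K \<noteq> {}"
        using division_ofD(3)[OF conjunct1[OF d] Kd] division_ofD(4)[OF conjunct1[OF d] Kd] by blast
      then have "K = {u..v}" "u \<le> v" by auto
      moreover have "K \<subseteq> {a..b}" using d that by auto
      ultimately show ?thesis using L[of u v] by auto
    qed
    have "(\<Sum>K\<in>d. \<bar>f (Sup K) - f (Inf K)\<bar>) \<le> (\<Sum>K\<in>d. L * (Sup K - Inf K))"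
      using Kd by (intro sum_mono) auto
    also have "\<dots> \<le> L * (e / (L + 1))"
      unfolding sum_distrib_left[symmetric] using d \<open>L \<ge> 0\<close> by (intro mult_left_mono) auto
    also have "\<dots> < e" using \<open>L \<ge> 0\<close> \<open>e > 0\<close> by (simp add: field_simps)
    finally show "(\<Sum>K\<in>d. \<bar>f (Sup K) - f (Inf K)\<bar>) < e" .
  qed
qed

lemma absolutely_continuous_imp_continuous:
  fixes f :: "real \<Rightarrow> real"
  assumes ac: "absolutely_continuous_on {a..b} f"
  shows "continuous_on {a..b} f"
  unfolding continuous_on_iff
proof (intro ballI allI impI)
  fix x e :: real assume x: "x \<in> {a..b}" and "e > 0"
  obtain \<delta> where "\<delta> > 0" and \<delta>: "\<And>d. d division_of \<Union>d \<Longrightarrow> \<Union>d \<subseteq> {a..b} \<Longrightarrow>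
        (\<Sum>K\<in>d. Sup K - Inf K) < \<delta> \<Longrightarrow> (\<Sum>K\<in>d. \<bar>f (Sup K) - f (Inf K)\<bar>) < e"
    using ac[unfolded absolutely_continuous_on_def, rule_format, OF \<open>e > 0\<close>] by auto
  have *: "\<bar>f v - f u\<bar> < e" if "u \<in> {a..b}" "v \<in> {a..b}" "u \<le> v" "v - u < \<delta>" for u v
  proof -
    have "{{u..v}} division_of \<Union>{{u..v}}"
      using division_of_self[of u v] that by simp
    from \<delta>[OF this] show ?thesis using that by auto
  qed
  show "\<exists>d>0. \<forall>y\<in>{a..b}. dist y x < d \<longrightarrow> dist (f y) (f x) < e"
  proof (intro exI conjI ballI impI)
    fix y assume "y \<in> {a..b}" "dist y x < \<delta>"
    then show "dist (f y) (f x) < e"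
      using *[of x y] *[of y x] x by (cases "x \<le> y") (auto simp: dist_real_def)
  qed (fact \<open>\<delta> > 0\<close>)
qed

text \<open>A common home for signals, states and kernels: unlike integrability, the property
  survives products, and it still gives integrability and Lipschitz bounds for indefinite integrals
  on compact intervals.\<close>

definition loc_bdd_meas :: "(real \<Rightarrow> real) \<Rightarrow> bool"
  where "loc_bdd_meas f \<longleftrightarrow>
    (\<forall>T\<ge>0. f \<in> borel_measurable (lebesgue_on {0..T}) \<and> (\<exists>B. \<forall>t\<in>{0..T}. \<bar>f t\<bar> \<le> B))"

lemma loc_bdd_meas_bound:
  assumes "loc_bdd_meas f"
  obtains B where "B \<ge> 0" "\<And>t. t \<in> {0..T} \<Longrightarrow> \<bar>f t\<bar> \<le> B"
proof (cases "T \<ge> 0")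
  case True
  then obtain B where "\<forall>t\<in>{0..T}. \<bar>f t\<bar> \<le> B" using assms unfolding loc_bdd_meas_def by blast
  then show ?thesis using that[of "max B 0"] by force
qed (use that[of 0] in auto)

lemma loc_bdd_meas_uniform_bound:
  fixes f :: "'i::finite \<Rightarrow> real \<Rightarrow> real"
  assumes "\<And>i. loc_bdd_meas (f i)"
  obtains B where "B \<ge> 0" "\<And>i t. t \<in> {0..T} \<Longrightarrow> \<bar>f i t\<bar> \<le> B"
proof -
  have "\<forall>i. \<exists>B. \<forall>t\<in>{0..T}. \<bar>f i t\<bar> \<le> B"
    using loc_bdd_meas_bound[OF assms] by metis
  then obtain B where B: "\<And>i t. t \<in> {0..T} \<Longrightarrow> \<bar>f i t\<bar> \<le> B i" by metis
  have "B i \<le> Max (range B)" for i by simp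
  then show ?thesis using that[of "max 0 (Max (range B))"] B by (metis max.cobounded1 max.cobounded2 order_trans)
qed

lemma loc_bdd_meas_continuous:
  assumes "continuous_on {0..} f"
  shows "loc_bdd_meas f"
  unfolding loc_bdd_meas_def
proof (intro allI impI conjI)
  fix T :: real assume "T \<ge> 0"
  have c: "continuous_on {0..T} f" using assms by (rule continuous_on_subset) auto
  then show "f \<in> borel_measurable (lebesgue_on {0..T})"
    by (intro continuous_imp_measurable_on_sets_lebesgue) auto
  have "bounded (f ` {0..T})" using c compact_continuous_image compact_imp_bounded by blast
  then show "\<exists>B. \<forall>t\<in>{0..T}. \<bar>f t\<bar> \<le> B" by (auto simp: bounded_real)
qed

lemma loc_bdd_meas_const: "loc_bdd_meas (\<lambda>_. c)"
  by (rule loc_bdd_meas_continuous) simp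

lemma loc_bdd_meas_mult:
  assumes "loc_bdd_meas f" "loc_bdd_meas g"
  shows "loc_bdd_meas (\<lambda>t. f t * g t)"
  unfolding loc_bdd_meas_def
proof (intro allI impI conjI)
  fix T :: real assume "T \<ge> 0"
  then show "(\<lambda>t. f t * g t) \<in> borel_measurable (lebesgue_on {0..T})"
    using assms by (intro borel_measurable_times) (auto simp: loc_bdd_meas_def)
  obtain B C where "B \<ge> 0" "\<And>t. t \<in> {0..T} \<Longrightarrow> \<bar>f t\<bar> \<le> B" "\<And>t. t \<in> {0..T} \<Longrightarrow> \<bar>g t\<bar> \<le> C"
    using loc_bdd_meas_bound[OF assms(1)] loc_bdd_meas_bound[OF assms(2)] by metis
  then have "\<forall>t\<in>{0..T}. \<bar>f t * g t\<bar> \<le> B * C" by (simp add: abs_mult mult_mono)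
  then show "\<exists>B. \<forall>t\<in>{0..T}. \<bar>f t * g t\<bar> \<le> B" ..
qed

lemma loc_bdd_meas_add:
  assumes "loc_bdd_meas f" "loc_bdd_meas g"
  shows "loc_bdd_meas (\<lambda>t. f t + g t)"
  unfolding loc_bdd_meas_def
proof (intro allI impI conjI)
  fix T :: real assume "T \<ge> 0"
  then show "(\<lambda>t. f t + g t) \<in> borel_measurable (lebesgue_on {0..T})"
    using assms by (intro borel_measurable_add) (auto simp: loc_bdd_meas_def)
  obtain B C where "\<And>t. t \<in> {0..T} \<Longrightarrow> \<bar>f t\<bar> \<le> B" "\<And>t. t \<in> {0..T} \<Longrightarrow> \<bar>g t\<bar> \<le> C"
    using loc_bdd_meas_bound[OF assms(1)] loc_bdd_meas_bound[OF assms(2)] by metis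
  then have "\<forall>t\<in>{0..T}. \<bar>f t + g t\<bar> \<le> B + C" by (meson abs_triangle_ineq add_mono order_trans)
  then show "\<exists>B. \<forall>t\<in>{0..T}. \<bar>f t + g t\<bar> \<le> B" ..
qed

lemma loc_bdd_meas_diff:
  assumes "loc_bdd_meas f" "loc_bdd_meas g"
  shows "loc_bdd_meas (\<lambda>t. f t - g t)"
  using loc_bdd_meas_add[OF assms(1) loc_bdd_meas_mult[OF loc_bdd_meas_const[of "-1"] assms(2)]]
  by simp

lemma loc_bdd_meas_sum:
  assumes "\<And>i. i \<in> I \<Longrightarrow> loc_bdd_meas (f i)"
  shows "loc_bdd_meas (\<lambda>t. \<Sum>i\<in>I. f i t)"
  using assms
  by (induction I rule: infinite_finite_induct) (auto intro: loc_bdd_meas_add loc_bdd_meas_const)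

lemma loc_bdd_meas_integrable:
  assumes "loc_bdd_meas f" "0 \<le> a"
  shows "f integrable_on {a..b}"
proof (cases "a \<le> b")
  case True
  then have b: "0 \<le> b" using assms by simp
  obtain B where B: "\<And>t. t \<in> {0..b} \<Longrightarrow> \<bar>f t\<bar> \<le> B"
    using loc_bdd_meas_bound[OF assms(1)] by metis
  have "f \<in> borel_measurable (lebesgue_on {0..b})" using assms b by (simp add: loc_bdd_meas_def)
  then have "f integrable_on {0..b}"
  proof (rule measurable_bounded_by_integrable_imp_integrable)
    show "(\<lambda>_. B) integrable_on {0..b}" by (rule integrable_const_ivl)
    show "norm (f t) \<le> B" if "t \<in> {0..b}" for t using B[OF that] by simp
  qed simp
  then show ?thesis by (rule integrable_subinterval_real) (use assms in auto)
qed auto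

text \<open>Kernels depend continuously on their start time only up to the end time
  \<open>t\<close>. Freezing the argument by \<open>min \<delta> t\<close> extends them to the half
  line, as \<open>loc_bdd_meas\<close> requires.\<close>

lemma integrable_mult_continuous:
  assumes "loc_bdd_meas f" "continuous_on {0..t} g" "0 \<le> a" "a \<le> t"
  shows "loc_bdd_meas (\<lambda>\<delta>. f \<delta> * g (min \<delta> t))"
    and "(\<lambda>\<delta>. f \<delta> * g \<delta>) integrable_on {a..t}"
proof -
  have "continuous_on {0..} (\<lambda>\<delta>. g (min \<delta> t))"
    by (rule continuous_on_compose2[OF assms(2)]) (use assms(3,4) in \<open>auto intro!: continuous_intros\<close>)
  then show lbm: "loc_bdd_meas (\<lambda>\<delta>. f \<delta> * g (min \<delta> t))"
    by (intro loc_bdd_meas_mult assms(1) loc_bdd_meas_continuous)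
  then have "(\<lambda>\<delta>. f \<delta> * g (min \<delta> t)) integrable_on {a..t}"
    using assms(3) by (rule loc_bdd_meas_integrable)
  then show "(\<lambda>\<delta>. f \<delta> * g \<delta>) integrable_on {a..t}"
    by (rule integrable_eq) simp
qed

lemma integral_abs_le:
  assumes f: "loc_bdd_meas f" and "0 \<le> a" "a \<le> b"
    and B: "\<And>t. t \<in> {a..b} \<Longrightarrow> \<bar>f t\<bar> \<le> B"
  shows "\<bar>integral {a..b} f\<bar> \<le> B * (b - a)"
proof -
  have "norm (integral {a..b} f) \<le> integral {a..b} (\<lambda>_. B)"
    using assms by (intro integral_norm_bound_integral loc_bdd_meas_integrable integrable_const_ivl) auto
  then show ?thesis using assms by (simp add: mult.commute)
qed

lemma loc_bdd_meas_integral_lipschitz: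
  assumes f: "loc_bdd_meas f" and "0 \<le> a" "a \<le> s" "s \<le> t" "t \<le> T"
    and B: "\<And>t. t \<in> {0..T} \<Longrightarrow> \<bar>f t\<bar> \<le> B"
  shows "\<bar>integral {a..t} f - integral {a..s} f\<bar> \<le> B * (t - s)"
proof -
  have "integral {a..s} f + integral {s..t} f = integral {a..t} f"
    using assms by (intro Henstock_Kurzweil_Integration.integral_combine loc_bdd_meas_integrable) auto
  moreover have "\<bar>integral {s..t} f\<bar> \<le> B * (t - s)"
    using assms by (intro integral_abs_le) auto
  ultimately show ?thesis by auto
qed

lemma continuous_on_Ici:
  fixes f :: "real \<Rightarrow> 'a::topological_space"
  assumes "\<And>T. continuous_on {a..T} f"
  shows "continuous_on {a..} f"
  unfolding continuous_on_eq_continuous_within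
proof
  fix t :: real assume t: "t \<in> {a..}"
  then have "continuous (at t within {a..t+1}) f"
    using assms[of "t+1"] by (auto simp: continuous_on_eq_continuous_within)
  moreover have "at t within {a..t+1} = at t within {a..}"
    by (rule at_within_nhd[of _ "{..<t+1}"]) auto
  ultimately show "continuous (at t within {a..}) f" by simp
qed

text \<open>Below \<open>a\<close> the interval is empty and the integral is 0. Gluing at
  \<open>a\<close> gives continuity on the whole half line, so that the result is again an
  admissible factor of an integrand.\<close>

lemma continuous_on_integral_loc_bdd_meas:
  assumes f: "loc_bdd_meas f" and "0 \<le> a"
  shows "continuous_on {0..} (\<lambda>t. integral {a..t} f)"
proof -
  have *: "continuous_on {0..T} (\<lambda>t. integral {a..t} f)" for T
  proof (cases "a \<le> T")
    case True
    have 1: "continuous_on {a..T} (\<lambda>t. integral {a..t} f)"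
      by (intro indefinite_integral_continuous_1 loc_bdd_meas_integrable assms)
    have "continuous_on ({0..a} \<union> {a..T}) (\<lambda>t. integral {a..t} f)"
    proof (intro continuous_on_closed_Un 1)
      have "continuous_on {0..a} (\<lambda>t. 0 :: real)" by simp
      then show "continuous_on {0..a} (\<lambda>t. integral {a..t} f)"
        by (rule continuous_on_eq) (metis atLeastAtMost_iff integral_null content_real_eq_0 box_real(2))
    qed auto
    then show ?thesis using True \<open>0 \<le> a\<close> by (simp add: ivl_disj_un)
  next
    case False
    have "continuous_on {0..T} (\<lambda>t. 0 :: real)" by simp
    then show ?thesis
      by (rule continuous_on_eq) (use False in auto)
  qed
  then show ?thesis by (rule continuous_on_Ici)
qed

section \<open>Regularity of piecewise continuous signals\<close>

lemma piecewise_continuous_vec_nth: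
  assumes "piecewise_continuous f"
  shows "piecewise_continuous (\<lambda>t. f t $ k)"
proof -
  have *: "continuous (at t within {0..}) (\<lambda>t. f t $ k)" if "continuous (at t within {0..}) f" for t
    using that by (intro continuous_intros)
  have "finite {t \<in> {a..b}. \<not> continuous (at t within {0..}) (\<lambda>t. f t $ k)}" if "0 \<le> a" for a b
  proof (rule finite_subset)
    show "finite {t \<in> {a..b}. \<not> continuous (at t within {0..}) f}"
      using assms that unfolding piecewise_continuous_def by blast
  qed (use * in auto)
  moreover have "(\<exists>l. ((\<lambda>t. f t $ k) \<longlongrightarrow> l) (at_right t)) \<and> (t > 0 \<longrightarrow> (\<exists>l. ((\<lambda>t. f t $ k) \<longlongrightarrow> l) (at_left t)))"
    if "t \<ge> 0" "\<not> continuous (at t within {0..}) (\<lambda>t. f t $ k)" for t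
  proof -
    have "\<not> continuous (at t within {0..}) f" using * that by blast
    then show ?thesis
      using assms[unfolded piecewise_continuous_def, THEN conjunct2, rule_format, OF \<open>t \<ge> 0\<close>]
      by (auto intro: tendsto_vec_nth)
  qed
  ultimately show ?thesis unfolding piecewise_continuous_def by blast
qed

text \<open>One-sided limits bound \<open>f\<close> near every point, and compactness makes the
  bound uniform. For measurability, cut \<open>f\<close> off outside \<open>{0..T}\<close>: the
  result is continuous except at the finitely many jumps and the two end points.\<close>

lemma piecewise_continuous_loc_bdd_meas:
  fixes f :: "real \<Rightarrow> real"
  assumes f: "piecewise_continuous f"
  shows "loc_bdd_meas f"
  unfolding loc_bdd_meas_def
proof (intro allI impI conjI)
  fix T :: real assume "T \<ge> 0"
  define D where "D = {t \<in> {0..T}. \<not> continuous (at t within {0..}) f}"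
  have "finite D" using f unfolding piecewise_continuous_def D_def by blast
  have lim_bdd: "\<exists>B. eventually (\<lambda>s. \<bar>f s\<bar> \<le> B) F" if "(f \<longlongrightarrow> l) F" for l F
  proof -
    have "eventually (\<lambda>s. dist (f s) l < 1) F" using that tendstoD zero_less_one by blast
    then have "eventually (\<lambda>s. \<bar>f s\<bar> \<le> \<bar>l\<bar> + 1) F"
      by eventually_elim (auto simp: dist_real_def)
    then show ?thesis ..
  qed
  have "\<exists>e B. e > 0 \<and> (\<forall>s\<ge>0. dist s t < e \<longrightarrow> \<bar>f s\<bar> \<le> B)" if t: "t \<in> {0..T}" for t
  proof -
    have "\<exists>B. eventually (\<lambda>s. \<bar>f s\<bar> \<le> B) (at t within {0..})"
    proof (cases "continuous (at t within {0..}) f")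
      case True
      then show ?thesis using lim_bdd unfolding continuous_within by blast
    next
      case False
      have lims: "\<exists>l. (f \<longlongrightarrow> l) (at_right t)" "t > 0 \<Longrightarrow> \<exists>l. (f \<longlongrightarrow> l) (at_left t)"
        using f[unfolded piecewise_continuous_def, THEN conjunct2, rule_format, OF _ False] t by auto
      have R: "\<exists>B. eventually (\<lambda>s. \<bar>f s\<bar> \<le> B) (at_right t)"
        using lims(1) lim_bdd by blast
      show ?thesis
      proof (cases "t = 0")
        case True
        have "at (0::real) within {0..} = at_right 0" by (rule at_within_nhd[of _ UNIV]) auto
        then show ?thesis using R True by metis
      next
        case False
        have L: "\<exists>B. eventually (\<lambda>s. \<bar>f s\<bar> \<le> B) (at_left t)"
          using lims(2) lim_bdd False t by force
        obtain B1 B2 where "eventually (\<lambda>s. \<bar>f s\<bar> \<le> B1) (at_left t)" "eventually (\<lambda>s. \<bar>f s\<bar> \<le> B2) (at_right t)"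
          using L R by blast
        then have "eventually (\<lambda>s. \<bar>f s\<bar> \<le> max B1 B2) (at t)"
          unfolding eventually_at_split by (auto elim: eventually_mono)
        then have "eventually (\<lambda>s. \<bar>f s\<bar> \<le> max B1 B2) (at t within {0..})"
          by (rule filter_leD[OF at_le, rotated]) auto
        then show ?thesis ..
      qed
    qed
    then obtain B e where "e > 0" "\<forall>s\<in>{0..}. s \<noteq> t \<and> dist s t < e \<longrightarrow> \<bar>f s\<bar> \<le> B"
      unfolding eventually_at by blast
    then show ?thesis by (intro exI[of _ e] exI[of _ "max B \<bar>f t\<bar>"]) (auto simp: le_max_iff_disj)
  qed
  then obtain e B where eB: "\<And>t. t \<in> {0..T} \<Longrightarrow> e t > 0 \<and> (\<forall>s\<ge>0. dist s t < e t \<longrightarrow> \<bar>f s\<bar> \<le> B t)"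
    by metis
  have "{0..T} \<subseteq> (\<Union>t\<in>{0..T}. ball t (e t))" using eB by auto
  then obtain C where C: "C \<subseteq> {0..T}" "finite C" "{0..T} \<subseteq> (\<Union>t\<in>C. ball t (e t))"
    using compactE_image[of "{0..T}" "{0..T}" "\<lambda>t. ball t (e t)"] by (metis compact_Icc open_ball)
  have "\<bar>f s\<bar> \<le> Max (B ` C)" if s: "s \<in> {0..T}" for s
  proof -
    obtain t where t: "t \<in> C" "dist s t < e t" using C(3) s by (auto simp: dist_commute)
    then have "\<bar>f s\<bar> \<le> B t" using eB C(1) s by auto
    also have "\<dots> \<le> Max (B ` C)" using t C(2) by simp
    finally show ?thesis .
  qed
  then show "\<exists>B. \<forall>t\<in>{0..T}. \<bar>f t\<bar> \<le> B" by blast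
  define h where "h s = (if s \<in> {0..T} then f s else 0)" for s
  have "continuous_on (- (D \<union> {0, T})) h"
  proof (rule continuous_at_imp_continuous_on, rule ballI)
    fix x assume x: "x \<in> - (D \<union> {0, T})"
    consider "x \<in> {0<..<T}" | "x \<notin> {0..T}" using x by force
    then show "continuous (at x) h"
    proof cases
      case 1
      then have "continuous (at x within {0..}) f" using x by (auto simp: D_def)
      moreover have "at x within {0..} = at x"
        by (rule at_within_interior) (use 1 in \<open>auto simp: interior_real_atLeast\<close>)
      ultimately have "continuous (at x) f" by simp
      moreover have "eventually (\<lambda>s. s \<in> {0<..<T}) (nhds x)"
        using 1 by (intro eventually_nhds_in_open) auto
      then have "eventually (\<lambda>s. f s = h s) (nhds x)" by eventually_elim (auto simp: h_def)
      ultimately show ?thesis by (simp add: isCont_cong)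
    next
      case 2
      have "eventually (\<lambda>s. s \<in> - {0..T}) (nhds x)"
        using 2 by (intro eventually_nhds_in_open) auto
      then have "eventually (\<lambda>s. h s = 0) (nhds x)" by eventually_elim (auto simp: h_def)
      then show ?thesis by (simp add: isCont_cong)
    qed
  qed
  then have "h \<in> borel_measurable borel"
    by (rule borel_measurable_continuous_countable_exceptions[rotated])
      (use \<open>finite D\<close> in \<open>simp add: countable_finite\<close>)
  then have "h \<in> borel_measurable (lebesgue_on {0..T})"
    by (intro measurable_restrict_space1 measurable_completion) auto
  then show "f \<in> borel_measurable (lebesgue_on {0..T})"
    by (rule measurable_cong[THEN iffD1, rotated]) (auto simp: h_def)
qed

text \<open>With the integrating factor \<open>exp (- M * t)\<close>, the integral of
  \<open>f\<close> becomes nonincreasing; it starts at 0, so the integral is nonpositive, and then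
  so is \<open>f\<close>.\<close>

lemma gronwall_zero:
  fixes f :: "real \<Rightarrow> real"
  assumes cont: "continuous_on {a..b} f" and "M \<ge> 0"
    and nonneg: "\<And>t. t \<in> {a..b} \<Longrightarrow> f t \<ge> 0"
    and le: "\<And>t. t \<in> {a..b} \<Longrightarrow> f t \<le> M * integral {a..t} f"
    and t: "t \<in> {a..b}"
  shows "f t = 0"
proof -
  define E where "E t = exp (- M * t) * integral {a..t} f" for t
  have E': "(E has_real_derivative exp (- M * s) * (f s - M * integral {a..s} f)) (at s within {a..b})"
    if "s \<in> {a..b}" for s
    unfolding E_def using that cont
    by (auto intro!: derivative_eq_intros integral_has_real_derivative simp: algebra_simps)
  have "E t \<le> E a"
  proof (rule DERIV_nonpos_imp_decreasing_open[of a t E])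
    show "a \<le> t" using t by simp
    show "\<exists>y. (E has_real_derivative y) (at x) \<and> y \<le> 0" if "a < x" "x < t" for x
    proof -
      have "at x within {a..b} = at x" using that t by (intro at_within_interior) auto
      then have "(E has_real_derivative exp (- M * x) * (f x - M * integral {a..x} f)) (at x)"
        using E'[of x] that t by auto
      moreover have "exp (- M * x) * (f x - M * integral {a..x} f) \<le> 0"
        using le[of x] that t by (intro mult_nonneg_nonpos) auto
      ultimately show ?thesis by blast
    qed
    have "continuous_on {a..b} E"
      using E' by (intro continuous_on_vector_derivative) (auto simp: has_real_derivative_iff_has_vector_derivative)
    then show "continuous_on {a..t} E" by (rule continuous_on_subset) (use t in auto)
  qed
  then have "integral {a..t} f \<le> 0" by (simp add: E_def mult_le_0_iff)
  then have "f t \<le> 0" using le[OF t] \<open>M \<ge> 0\<close> by (smt (verit) mult_nonneg_nonpos)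
  then show ?thesis using nonneg[OF t] by simp
qed

text \<open>Difference quotients are bounded by \<open>C\<close> times the distance, hence the
  derivative vanishes throughout the interval.\<close>

lemma quadratic_increments_imp_constant:
  fixes D :: "real \<Rightarrow> real"
  assumes D: "\<And>x y. a \<le> x \<Longrightarrow> x \<le> y \<Longrightarrow> y \<le> b \<Longrightarrow> \<bar>D x - D y\<bar> \<le> C * (y - x)^2"
    and "a \<le> x" "x \<le> b"
  shows "D x = D b"
proof -
  have *: "\<bar>D y - D z\<bar> \<le> C * \<bar>y - z\<bar> * \<bar>y - z\<bar>" if "y \<in> {a..b}" "z \<in> {a..b}" for y z
    using D[of y z] D[of z y] that by (cases "y \<le> z") (auto simp: power2_eq_square abs_minus_commute algebra_simps)
  have "(D has_derivative (\<lambda>h. 0)) (at z within {a..b})" if z: "z \<in> {a..b}" for z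
    unfolding has_derivative_within_alt
  proof (intro conjI allI impI)
    fix e :: real assume "e > 0"
    show "\<exists>d>0. \<forall>y\<in>{a..b}. norm (y - z) < d \<longrightarrow> norm (D y - D z - 0) \<le> e * norm (y - z)"
    proof (intro exI conjI ballI impI)
      \<comment> \<open>The shift by 1 covers \<open>C = 0\<close>, and the absolute value a
        negative \<open>C\<close>.\<close>
      show "e / (\<bar>C\<bar> + 1) > 0" using \<open>e > 0\<close> by simp
      fix y assume y: "y \<in> {a..b}" "norm (y - z) < e / (\<bar>C\<bar> + 1)"
      have "C * \<bar>y - z\<bar> \<le> (\<bar>C\<bar> + 1) * \<bar>y - z\<bar>" by (intro mult_right_mono) auto
      also have "\<dots> \<le> e" using y(2) by (simp add: field_simps)
      finally have "C * \<bar>y - z\<bar> * \<bar>y - z\<bar> \<le> e * \<bar>y - z\<bar>" by (intro mult_right_mono) auto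
      then show "norm (D y - D z - 0) \<le> e * norm (y - z)" using *[OF y(1) z] by simp
    qed
  qed simp
  then obtain c where "\<And>y. y \<in> {a..b} \<Longrightarrow> D y = c"
    using has_derivative_zero_constant[of "{a..b}" D] by auto
  then show ?thesis using assms by auto
qed

section \<open>Iterated integrals\<close>

text \<open>The alphabet is abstract because it is later enlarged by letters for the input. Words
  are stored reversed: the head is the letter read at the latest time, which is the outermost
  integration.\<close>

primrec iter_int :: "('i \<Rightarrow> real \<Rightarrow> real) \<Rightarrow> 'i list \<Rightarrow> real \<Rightarrow> real \<Rightarrow> real"
  where
    "iter_int q [] t \<tau> = 1"
  | "iter_int q (i # r) t \<tau> = integral {\<tau>..t} (\<lambda>z. q i z * iter_int q r z \<tau>)"

lemma ct_w_conv_iter_int: "ct_w s p t \<tau> = iter_int (\<lambda>i z. sched (p z) i) (rev s) t \<tau>"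
proof -
  have "ct_w_rev r p t \<tau> = iter_int (\<lambda>i z. sched (p z) i) r t \<tau>" for r
    by (induction r arbitrary: t) simp_all
  then show ?thesis by (simp add: ct_w_def)
qed

text \<open>Agreement before \<open>t\<close> suffices, since one point does not affect an integral.
  This half-open form is what allows the scheduling value at the end time to be replaced
  freely.\<close>

lemma iter_int_cong:
  assumes "\<And>i z. i \<in> set r \<Longrightarrow> \<tau> \<le> z \<Longrightarrow> z < t \<Longrightarrow> q i z = q' i z"
  shows "iter_int q r t \<tau> = iter_int q' r t \<tau>"
  using assms
proof (induction r arbitrary: t)
  case (Cons i r)
  have "integral {\<tau>..t} (\<lambda>z. q i z * iter_int q r z \<tau>) = integral {\<tau>..t} (\<lambda>z. q' i z * iter_int q' r z \<tau>)"
  proof (rule integral_spike[of "{t}"])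
    fix z assume "z \<in> {\<tau>..t} - {t}"
    then show "q' i z * iter_int q' r z \<tau> = q i z * iter_int q r z \<tau>"
      using Cons.IH[of z] Cons.prems by auto
  qed simp
  then show ?case by simp
qed simp

lemma iter_int_map: "iter_int q (map f r) t \<tau> = iter_int (\<lambda>i. q (f i)) r t \<tau>"
  by (induction r arbitrary: t) simp_all

lemma has_integral_power_fact:
  fixes M :: real
  assumes "\<tau> \<le> t"
  shows "((\<lambda>z. M * ((M * (z - \<tau>)) ^ n / fact n)) has_integral (M * (t - \<tau>)) ^ Suc n / fact (Suc n)) {\<tau>..t}"
proof -
  have "((\<lambda>z. (M * (z - \<tau>)) ^ Suc n / fact (Suc n)) has_real_derivative M * ((M * (z - \<tau>)) ^ n / fact n)) (at z within {\<tau>..t})" for z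
  proof -
    have *: "real (Suc n) * x / fact (Suc n) = x / fact n" for x :: real
      by (subst fact_Suc) (rule mult_divide_mult_cancel_left, simp)
    have "((\<lambda>z. (M * (z - \<tau>)) ^ Suc n / fact (Suc n)) has_real_derivative
        real (Suc n) * (M * (M * (z - \<tau>)) ^ n) / fact (Suc n)) (at z within {\<tau>..t})"
      by (auto intro!: derivative_eq_intros simp del: power_Suc fact_Suc of_nat_Suc)
    then show ?thesis unfolding * by simp
  qed
  then have "((\<lambda>z. M * ((M * (z - \<tau>)) ^ n / fact n)) has_integral
     ((M * (t - \<tau>)) ^ Suc n / fact (Suc n) - (M * (\<tau> - \<tau>)) ^ Suc n / fact (Suc n))) {\<tau>..t}"
    using assms by (intro fundamental_theorem_of_calculus)
      (auto simp: has_real_derivative_iff_has_vector_derivative)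
  then show ?thesis by simp
qed

locale letters =
  fixes q :: "'i::finite \<Rightarrow> real \<Rightarrow> real"
  assumes q: "\<And>i. loc_bdd_meas (q i)"
begin

lemma letter_bound:
  obtains M where "M \<ge> 0" "\<And>i t. t \<in> {0..T} \<Longrightarrow> \<bar>q i t\<bar> \<le> M"
  using loc_bdd_meas_uniform_bound[of q T, OF q] by blast

lemma iter_int_continuous: "0 \<le> \<tau> \<Longrightarrow> continuous_on {0..} (\<lambda>t. iter_int q r t \<tau>)"
proof (induction r)
  case (Cons i r)
  then have "loc_bdd_meas (\<lambda>z. q i z * iter_int q r z \<tau>)"
    by (intro loc_bdd_meas_mult q loc_bdd_meas_continuous) auto
  then show ?case using Cons by (simp add: continuous_on_integral_loc_bdd_meas)
qed simp

lemma iter_int_lbm: "0 \<le> \<tau> \<Longrightarrow> loc_bdd_meas (\<lambda>t. iter_int q r t \<tau>)"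
  by (intro loc_bdd_meas_continuous iter_int_continuous)

lemma iter_int_lbm_mult: "0 \<le> \<tau> \<Longrightarrow> loc_bdd_meas (\<lambda>t. q i t * iter_int q r t \<tau>)"
  by (intro loc_bdd_meas_mult q iter_int_lbm)

lemma iter_int_split:
  assumes "0 \<le> \<tau>" "\<tau> \<le> y" "y \<le> t"
  shows "iter_int q (i # r) t \<tau> = iter_int q (i # r) y \<tau> + integral {y..t} (\<lambda>z. q i z * iter_int q r z \<tau>)"
  using assms
  by (simp add: Henstock_Kurzweil_Integration.integral_combine loc_bdd_meas_integrable[OF iter_int_lbm_mult])

text \<open>The domain of integration is a simplex of volume
  \<open>(t - \<tau>) ^ n / fact n\<close>. The factorial is what makes series over all words
  converge although both the number of words and the coefficients grow exponentially.\<close>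

lemma iter_int_bound:
  assumes M: "\<And>i t. t \<in> {0..T} \<Longrightarrow> \<bar>q i t\<bar> \<le> M" and "0 \<le> M" "0 \<le> \<tau>" "\<tau> \<le> t" "t \<le> T"
  shows "\<bar>iter_int q r t \<tau>\<bar> \<le> (M * (t - \<tau>)) ^ length r / fact (length r)"
  using assms(4,5)
proof (induction r arbitrary: t)
  case (Cons i r)
  have "norm (integral {\<tau>..t} (\<lambda>z. q i z * iter_int q r z \<tau>))
      \<le> integral {\<tau>..t} (\<lambda>z. M * ((M * (z - \<tau>)) ^ length r / fact (length r)))"
  proof (rule integral_norm_bound_integral)
    show "(\<lambda>z. q i z * iter_int q r z \<tau>) integrable_on {\<tau>..t}"
      using loc_bdd_meas_integrable[OF iter_int_lbm_mult] assms by blast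
    show "(\<lambda>z. M * ((M * (z - \<tau>)) ^ length r / fact (length r))) integrable_on {\<tau>..t}"
      using has_integral_power_fact[OF Cons.prems(1)] by blast
    fix z assume "z \<in> {\<tau>..t}"
    then show "norm (q i z * iter_int q r z \<tau>) \<le> M * ((M * (z - \<tau>)) ^ length r / fact (length r))"
      using Cons.IH[of z] Cons.prems M[of z i] assms
      unfolding real_norm_def abs_mult by (intro mult_mono) auto
  qed
  also have "\<dots> = (M * (t - \<tau>)) ^ length (i # r) / fact (length (i # r))"
    using integral_unique[OF has_integral_power_fact[OF Cons.prems(1), of M "length r"]] by simp
  finally show ?case by simp
qed simp

lemma iter_int_bounded:
  assumes "0 \<le> T"
  obtains B where "B \<ge> 0" "\<And>t \<tau>. 0 \<le> \<tau> \<Longrightarrow> \<tau> \<le> t \<Longrightarrow> t \<le> T \<Longrightarrow> \<bar>iter_int q r t \<tau>\<bar> \<le> B"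
proof -
  obtain M where M: "M \<ge> 0" "\<And>i t. t \<in> {0..T} \<Longrightarrow> \<bar>q i t\<bar> \<le> M"
    using letter_bound by blast
  show ?thesis
  proof (rule that)
    show "0 \<le> (M * T) ^ length r / fact (length r)" using M assms by simp
    fix t \<tau> assume *: "0 \<le> \<tau>" "\<tau> \<le> t" "t \<le> T"
    have "\<bar>iter_int q r t \<tau>\<bar> \<le> (M * (t - \<tau>)) ^ length r / fact (length r)"
      using iter_int_bound[OF M(2) M(1) *] .
    also have "\<dots> \<le> (M * T) ^ length r / fact (length r)"
      using * M by (intro divide_right_mono power_mono mult_left_mono) auto
    finally show "\<bar>iter_int q r t \<tau>\<bar> \<le> (M * T) ^ length r / fact (length r)" .
  qed
qed

lemma iter_int_linear_bound:
  assumes "0 \<le> T"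
  obtains B where "B \<ge> 0" "\<And>t \<tau>. 0 \<le> \<tau> \<Longrightarrow> \<tau> \<le> t \<Longrightarrow> t \<le> T \<Longrightarrow> \<bar>iter_int q (i # r) t \<tau>\<bar> \<le> B * (t - \<tau>)"
proof -
  obtain B where B: "B \<ge> 0" "\<And>t \<tau>. 0 \<le> \<tau> \<Longrightarrow> \<tau> \<le> t \<Longrightarrow> t \<le> T \<Longrightarrow> \<bar>iter_int q r t \<tau>\<bar> \<le> B"
    using iter_int_bounded[OF assms] by metis
  obtain M where M: "M \<ge> 0" "\<And>i t. t \<in> {0..T} \<Longrightarrow> \<bar>q i t\<bar> \<le> M"
    using letter_bound by blast
  show ?thesis
  proof (rule that[of "M * B"])
    fix t \<tau> assume *: "0 \<le> \<tau>" "\<tau> \<le> t" "t \<le> T"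
    show "\<bar>iter_int q (i # r) t \<tau>\<bar> \<le> M * B * (t - \<tau>)"
      unfolding iter_int.simps using * B M
      by (intro integral_abs_le iter_int_lbm_mult) (auto simp: abs_mult intro!: mult_mono)
  qed (use B M in auto)
qed

text \<open>By Chen's relation, cutting \<open>{\<tau>..t}\<close> at \<open>y\<close> gives a sum
  over the ways to cut the word. The three terms shown are those with at most one letter in
  \<open>{\<tau>..y}\<close>; all others contain two integrations over this short interval and are
  quadratically small. As the word is reversed, \<open>i\<close> is the letter read first.\<close>

lemma iter_int_start_estimate:
  assumes "0 \<le> T"
  shows "\<exists>C\<ge>0. \<forall>\<tau> y t. 0 \<le> \<tau> \<and> \<tau> \<le> y \<and> y \<le> t \<and> t \<le> T \<longrightarrow>
    \<bar>iter_int q (r @ [i]) t \<tau> - iter_int q (r @ [i]) t y - iter_int q [i] y \<tau> * iter_int q r t y\<bar> \<le> C * (y - \<tau>)^2"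
proof (induction r)
  case Nil
  have "iter_int q [i] t \<tau> - iter_int q [i] t y - iter_int q [i] y \<tau> = 0"
    if "0 \<le> \<tau>" "\<tau> \<le> y" "y \<le> t" for t y \<tau>
    using iter_int_split[OF that, of i "[]"] by simp
  then show ?case by (intro exI[of _ 0]) (simp del: iter_int.simps add: iter_int.simps(1))
next
  case (Cons j r)
  then obtain C where C: "C \<ge> 0" "\<And>\<tau> y t. 0 \<le> \<tau> \<Longrightarrow> \<tau> \<le> y \<Longrightarrow> y \<le> t \<Longrightarrow> t \<le> T \<Longrightarrow>
    \<bar>iter_int q (r @ [i]) t \<tau> - iter_int q (r @ [i]) t y - iter_int q [i] y \<tau> * iter_int q r t y\<bar> \<le> C * (y - \<tau>)^2"
    by blast
  obtain B where B: "B \<ge> 0" "\<And>t \<tau>. 0 \<le> \<tau> \<Longrightarrow> \<tau> \<le> t \<Longrightarrow> t \<le> T \<Longrightarrow> \<bar>iter_int q (r @ [i]) t \<tau>\<bar> \<le> B * (t - \<tau>)"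
    using iter_int_linear_bound[OF assms, of "hd (r @ [i])" "tl (r @ [i])"] by auto
  obtain M where M: "M \<ge> 0" "\<And>i t. t \<in> {0..T} \<Longrightarrow> \<bar>q i t\<bar> \<le> M"
    using letter_bound by blast
  show ?case
  proof (intro exI conjI allI impI)
    \<comment> \<open>\<open>M * B\<close> comes from the outer integral over
      \<open>{\<tau>..y}\<close>, whose integrand is already linearly small because the word
      \<open>r @ [i]\<close> is nonempty; \<open>M * C * T\<close> comes from integrating the
      induction hypothesis over \<open>{y..t}\<close>.\<close>
    show "0 \<le> M * B + M * C * T" using M B C assms by simp
    fix \<tau> y t assume *: "0 \<le> \<tau> \<and> \<tau> \<le> y \<and> y \<le> t \<and> t \<le> T"
    let ?W = "iter_int q (r @ [i])" and ?k = "iter_int q [i] y \<tau>"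
    let ?d = "\<lambda>z. ?W z \<tau> - ?W z y - ?k * iter_int q r z y"
    have lbm: "loc_bdd_meas (\<lambda>z. q j z * ?d z)"
      using * by (intro loc_bdd_meas_mult loc_bdd_meas_diff q iter_int_lbm loc_bdd_meas_const) auto
    have int: "(\<lambda>z. q j z * ?W z \<tau>) integrable_on {y..t}" "(\<lambda>z. q j z * ?W z y) integrable_on {y..t}"
       "(\<lambda>z. q j z * iter_int q r z y) integrable_on {y..t}"
      using * by (auto intro!: loc_bdd_meas_integrable iter_int_lbm_mult)
    have "integral {y..t} (\<lambda>z. q j z * ?d z) = integral {y..t} (\<lambda>z. q j z * ?W z \<tau>)
        - integral {y..t} (\<lambda>z. q j z * ?W z y) - ?k * integral {y..t} (\<lambda>z. q j z * iter_int q r z y)"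
    proof -
      have "(\<lambda>z. q j z * ?d z) = (\<lambda>z. q j z * ?W z \<tau> - q j z * ?W z y - ?k * (q j z * iter_int q r z y))"
        by (simp add: algebra_simps)
      then show ?thesis
        using int by (simp only: Henstock_Kurzweil_Integration.integral_diff integrable_diff
           integrable_on_mult_right Henstock_Kurzweil_Integration.integral_mult_right)
    qed
    then have "iter_int q ((j # r) @ [i]) t \<tau> - iter_int q ((j # r) @ [i]) t y - ?k * iter_int q (j # r) t y
       = integral {\<tau>..y} (\<lambda>z. q j z * ?W z \<tau>) + integral {y..t} (\<lambda>z. q j z * ?d z)"
      using iter_int_split[of \<tau> y t j "r @ [i]"] * by simp
    moreover have "\<bar>integral {\<tau>..y} (\<lambda>z. q j z * ?W z \<tau>)\<bar> \<le> M * (B * (y - \<tau>)) * (y - \<tau>)"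
    proof (intro integral_abs_le iter_int_lbm_mult)
      fix z assume d: "z \<in> {\<tau>..y}"
      then have "\<bar>?W z \<tau>\<bar> \<le> B * (z - \<tau>)" using * by (intro B) auto
      also have "\<dots> \<le> B * (y - \<tau>)" using d B by (intro mult_left_mono) auto
      finally show "\<bar>q j z * ?W z \<tau>\<bar> \<le> M * (B * (y - \<tau>))"
        using M(1) M(2)[of z j] d * by (simp add: abs_mult mult_mono)
    qed (use * in auto)
    moreover have "\<bar>integral {y..t} (\<lambda>z. q j z * ?d z)\<bar> \<le> M * (C * (y - \<tau>)^2) * (t - y)"
    proof (intro integral_abs_le lbm)
      fix z assume d: "z \<in> {y..t}"
      then have "\<bar>?d z\<bar> \<le> C * (y - \<tau>)^2" using * by (intro C) auto
      then show "\<bar>q j z * ?d z\<bar> \<le> M * (C * (y - \<tau>)^2)"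
        using M(1) M(2)[of z j] d * unfolding abs_mult by (intro mult_mono) auto
    qed (use * in auto)
    moreover have "M * (C * (y - \<tau>)^2) * (t - y) \<le> M * (C * (y - \<tau>)^2) * T"
      using * M C by (intro mult_left_mono) auto
    ultimately show "\<bar>iter_int q ((j # r) @ [i]) t \<tau> - iter_int q ((j # r) @ [i]) t y
       - ?k * iter_int q (j # r) t y\<bar> \<le> (M * B + M * C * T) * (y - \<tau>)^2"
      by (simp del: iter_int.simps add: algebra_simps power2_eq_square)
  qed
qed

text \<open>The term with one letter before \<open>y\<close> is linear in \<open>y - \<tau>\<close>;
  in the quadratic remainder one of the two factors is absorbed into \<open>T\<close>.\<close>

lemma iter_int_start_lipschitz:
  assumes "0 \<le> T"
  obtains L where "L \<ge> 0" "\<And>\<tau> y t. 0 \<le> \<tau> \<Longrightarrow> \<tau> \<le> y \<Longrightarrow> y \<le> t \<Longrightarrow> t \<le> T \<Longrightarrow>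
    \<bar>iter_int q r t \<tau> - iter_int q r t y\<bar> \<le> L * (y - \<tau>)"
proof (cases r rule: rev_cases)
  case Nil
  then show ?thesis using that[of 0] by simp
next
  case (snoc r' i)
  obtain C where C: "C \<ge> 0" "\<And>\<tau> y t. 0 \<le> \<tau> \<Longrightarrow> \<tau> \<le> y \<Longrightarrow> y \<le> t \<Longrightarrow> t \<le> T \<Longrightarrow>
    \<bar>iter_int q r t \<tau> - iter_int q r t y - iter_int q [i] y \<tau> * iter_int q r' t y\<bar> \<le> C * (y - \<tau>)^2"
    using iter_int_start_estimate[OF assms, of r' i] snoc by blast
  obtain B where B: "B \<ge> 0" "\<And>t \<tau>. 0 \<le> \<tau> \<Longrightarrow> \<tau> \<le> t \<Longrightarrow> t \<le> T \<Longrightarrow> \<bar>iter_int q [i] t \<tau>\<bar> \<le> B * (t - \<tau>)"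
    using iter_int_linear_bound[OF assms] by metis
  obtain A where A: "A \<ge> 0" "\<And>t \<tau>. 0 \<le> \<tau> \<Longrightarrow> \<tau> \<le> t \<Longrightarrow> t \<le> T \<Longrightarrow> \<bar>iter_int q r' t \<tau>\<bar> \<le> A"
    using iter_int_bounded[OF assms] by metis
  show ?thesis
  proof (rule that)
    show "0 \<le> B * A + C * T" using A B C assms by simp
    fix \<tau> y t :: real assume *: "0 \<le> \<tau>" "\<tau> \<le> y" "y \<le> t" "t \<le> T"
    have "\<bar>iter_int q [i] y \<tau> * iter_int q r' t y\<bar> \<le> (B * (y - \<tau>)) * A"
      unfolding abs_mult using * A B by (intro mult_mono) auto
    moreover have "C * (y - \<tau>)^2 \<le> C * (T * (y - \<tau>))"
      unfolding power2_eq_square using * C by (intro mult_left_mono mult_right_mono) auto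
    ultimately show "\<bar>iter_int q r t \<tau> - iter_int q r t y\<bar> \<le> (B * A + C * T) * (y - \<tau>)"
      using C(2)[OF *] by (simp del: iter_int.simps add: algebra_simps)
  qed
qed

lemma iter_int_start_continuous:
  assumes "0 \<le> t"
  shows "continuous_on {0..t} (\<lambda>\<tau>. iter_int q r t \<tau>)"
proof -
  obtain L where L: "L \<ge> 0" "\<And>\<tau> y. 0 \<le> \<tau> \<Longrightarrow> \<tau> \<le> y \<Longrightarrow> y \<le> t \<Longrightarrow>
    \<bar>iter_int q r t \<tau> - iter_int q r t y\<bar> \<le> L * (y - \<tau>)"
    using iter_int_start_lipschitz[OF assms, of r] by (metis order_refl)
  have "L-lipschitz_on {0..t} (\<lambda>\<tau>. iter_int q r t \<tau>)"
  proof (rule lipschitz_onI)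
    fix x y assume "x \<in> {0..t}" "y \<in> {0..t}"
    then show "dist (iter_int q r t x) (iter_int q r t y) \<le> L * dist x y"
      using L(2)[of x y] L(2)[of y x] by (cases "x \<le> y") (auto simp: dist_real_def abs_minus_commute)
  qed (fact L)
  then show ?thesis by (rule lipschitz_on_continuous_on)
qed

text \<open>The first letter of a word can be integrated last. Both sides agree at \<open>\<tau> = t\<close>, and the
  increments in \<open>\<tau>\<close> of their difference are quadratically small, which avoids Fubini's theorem.\<close>

lemma iter_int_snoc:
  assumes "0 \<le> \<tau>" "\<tau> \<le> t"
  shows "iter_int q (r @ [i]) t \<tau> = integral {\<tau>..t} (\<lambda>z. q i z * iter_int q r t z)"
proof -
  \<comment> \<open>The argument is frozen at \<open>t\<close> so that \<open>f\<close> is an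
    admissible integrand on the whole half line; up to \<open>t\<close> it is the intended
    one.\<close>
  define f where "f z = q i z * iter_int q r t (min z t)" for z
  have t: "0 \<le> t" using assms by simp
  have f: "loc_bdd_meas f"
    unfolding f_def by (rule integrable_mult_continuous(1)[OF q iter_int_start_continuous[OF t] order_refl t])
  obtain C where C: "C \<ge> 0" "\<And>\<tau> y. 0 \<le> \<tau> \<Longrightarrow> \<tau> \<le> y \<Longrightarrow> y \<le> t \<Longrightarrow>
    \<bar>iter_int q (r @ [i]) t \<tau> - iter_int q (r @ [i]) t y - iter_int q [i] y \<tau> * iter_int q r t y\<bar> \<le> C * (y - \<tau>)^2"
    using iter_int_start_estimate[OF t, of r i] by blast
  obtain L where L: "L \<ge> 0" "\<And>\<tau> y. 0 \<le> \<tau> \<Longrightarrow> \<tau> \<le> y \<Longrightarrow> y \<le> t \<Longrightarrow>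
    \<bar>iter_int q r t \<tau> - iter_int q r t y\<bar> \<le> L * (y - \<tau>)"
    using iter_int_start_lipschitz[OF t, of r] by (metis order_refl)
  obtain M where M: "M \<ge> 0" "\<And>i s. s \<in> {0..t} \<Longrightarrow> \<bar>q i s\<bar> \<le> M"
    using letter_bound by blast
  define D where "D \<tau> = iter_int q (r @ [i]) t \<tau> - integral {\<tau>..t} f" for \<tau>
  have "\<bar>D x - D y\<bar> \<le> (C + M * L) * (y - x)^2" if xy: "0 \<le> x" "x \<le> y" "y \<le> t" for x y
  proof -
    \<comment> \<open>\<open>?g\<close> is the error of freezing the kernel at its value for start
      time \<open>y\<close>. The Lipschitz bound makes it linearly small, and integrating over
      \<open>{x..y}\<close> makes it quadratic, which explains the constant
      \<open>C + M * L\<close>.\<close>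
    let ?g = "\<lambda>z. q i z * iter_int q r t y - f z"
    have qy: "loc_bdd_meas (\<lambda>z. q i z * iter_int q r t y)"
      by (intro loc_bdd_meas_mult q loc_bdd_meas_const)
    have "integral {x..y} f + integral {y..t} f = integral {x..t} f"
      using xy by (intro Henstock_Kurzweil_Integration.integral_combine loc_bdd_meas_integrable f)
    moreover have "integral {x..y} ?g = iter_int q [i] y x * iter_int q r t y - integral {x..y} f"
      using xy by (simp add: Henstock_Kurzweil_Integration.integral_diff loc_bdd_meas_integrable f qy)
    ultimately have "D x - D y = (iter_int q (r @ [i]) t x - iter_int q (r @ [i]) t y - iter_int q [i] y x * iter_int q r t y)
       + integral {x..y} ?g"
      by (simp add: D_def del: iter_int.simps)
    moreover have "\<bar>integral {x..y} ?g\<bar> \<le> (M * (L * (y - x))) * (y - x)"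
    proof (intro integral_abs_le loc_bdd_meas_diff f qy)
      fix z assume d: "z \<in> {x..y}"
      have "\<bar>iter_int q r t y - iter_int q r t z\<bar> \<le> L * (y - z)"
        using L(2)[of z y] xy d by (simp add: abs_minus_commute)
      also have "\<dots> \<le> L * (y - x)" using d L by (intro mult_left_mono) auto
      finally have "\<bar>q i z\<bar> * \<bar>iter_int q r t y - iter_int q r t z\<bar> \<le> M * (L * (y - x))"
        using M(1) M(2)[of z i] xy d by (intro mult_mono) auto
      moreover have "?g z = q i z * (iter_int q r t y - iter_int q r t z)"
        using xy d by (simp add: f_def min_absorb1 algebra_simps)
      ultimately show "\<bar>?g z\<bar> \<le> M * (L * (y - x))"
        by (simp add: abs_mult)
    qed (use xy in auto)
    ultimately show ?thesis using C(2)[OF xy] by (simp add: algebra_simps power2_eq_square del: iter_int.simps)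
  qed
  then have "D \<tau> = D t" using assms by (rule quadratic_increments_imp_constant)
  also have "D t = 0" by (cases r) (simp_all add: D_def)
  finally have "iter_int q (r @ [i]) t \<tau> = integral {\<tau>..t} f" by (simp add: D_def)
  also have "\<dots> = integral {\<tau>..t} (\<lambda>z. q i z * iter_int q r t z)"
    by (intro Henstock_Kurzweil_Integration.integral_cong) (simp add: f_def min_absorb1)
  finally show ?thesis .
qed

end

section \<open>Word series\<close>

text \<open>The entrywise form of \<open>growth_bounded\<close>, so that series can be treated as
  scalars.\<close>

definition word_growth :: "('i list \<Rightarrow> real) \<Rightarrow> bool"
  where "word_growth c \<longleftrightarrow> (\<exists>K>0. \<exists>R>0. \<forall>s. \<bar>c s\<bar> \<le> K * R ^ length s)"

lemma word_growthI:
  assumes "\<And>s. \<bar>c s\<bar> \<le> K * R ^ length s"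
  shows "word_growth c"
  unfolding word_growth_def
proof (intro exI conjI allI)
  fix s :: "'a list"
  have "\<bar>c s\<bar> \<le> \<bar>K * R ^ length s\<bar>" using assms[of s] by simp
  also have "\<dots> = \<bar>K\<bar> * \<bar>R\<bar> ^ length s" by (simp add: abs_mult power_abs)
  also have "\<dots> \<le> (\<bar>K\<bar> + 1) * (\<bar>R\<bar> + 1) ^ length s"
    by (intro mult_mono power_mono) auto
  finally show "\<bar>c s\<bar> \<le> (\<bar>K\<bar> + 1) * (\<bar>R\<bar> + 1) ^ length s" .
qed auto

lemma word_growth_mult:
  assumes "word_growth c"
  shows "word_growth (\<lambda>s. a * c s)"
proof -
  obtain K R where KR: "\<And>s. \<bar>c s\<bar> \<le> K * R ^ length s" using assms unfolding word_growth_def by blast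
  have "\<bar>a * c s\<bar> \<le> (\<bar>a\<bar> * K) * R ^ length s" for s
    using mult_left_mono[OF KR[of s], of "\<bar>a\<bar>"] by (simp add: abs_mult mult.assoc)
  then show ?thesis by (rule word_growthI)
qed

lemma word_growth_add:
  assumes "word_growth c" "word_growth d"
  shows "word_growth (\<lambda>s. c s + d s)"
proof -
  obtain K R where K: "K > 0" "R > 0" "\<And>s. \<bar>c s\<bar> \<le> K * R ^ length s" 
    using assms(1) unfolding word_growth_def by blast
  obtain K' R' where K': "K' > 0" "R' > 0" "\<And>s. \<bar>d s\<bar> \<le> K' * R' ^ length s" 
    using assms(2) unfolding word_growth_def by blast
  have "\<bar>c s + d s\<bar> \<le> (K + K') * (max R R') ^ length s" for s
  proof -
    have "K * R ^ length s \<le> K * (max R R') ^ length s"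
      using K by (intro mult_left_mono power_mono) auto
    moreover have "K' * R' ^ length s \<le> K' * (max R R') ^ length s"
      using K' by (intro mult_left_mono power_mono) auto
    ultimately show ?thesis using K(3)[of s] K'(3)[of s] by (simp add: distrib_right)
  qed
  then show ?thesis by (rule word_growthI)
qed

lemma word_growth_zero: "word_growth (\<lambda>s. 0)"
  by (rule word_growthI[of _ 0 1]) simp

lemma word_growth_sum: "(\<And>k. k \<in> A \<Longrightarrow> word_growth (c k)) \<Longrightarrow> word_growth (\<lambda>s. \<Sum>k\<in>A. c k s)"
  by (induction A rule: infinite_finite_induct) (auto intro: word_growth_add word_growth_zero)

lemma word_growth_shift:
  assumes "word_growth c" and "\<And>s. length (f s) = Suc (length s)"
  shows "word_growth (\<lambda>s. c (f s))"
proof -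
  obtain K R where KR: "\<And>s. \<bar>c s\<bar> \<le> K * R ^ length s" using assms unfolding word_growth_def by blast
  have "\<bar>c (f s)\<bar> \<le> (K * R) * R ^ length s" for s
    using KR[of "f s"] assms(2) by (simp add: mult.assoc)
  then show ?thesis by (rule word_growthI)
qed

lemma word_growth_snoc: "word_growth c \<Longrightarrow> word_growth (\<lambda>s. c (s @ [i]))"
  and word_growth_cons: "word_growth c \<Longrightarrow> word_growth (\<lambda>s. c (i # s))"
  by (rule word_growth_shift; simp)+

lemma finite_words_le: "finite {s :: 'i::finite list. length s \<le> n}"
  using finite_lists_length_le[of "UNIV :: 'i set" n] by simp

lemma
  fixes h :: "'i::finite list \<Rightarrow> real"
  shows sum_words_le_Suc_snoc: "(\<Sum>s | length s \<le> Suc n. h s) = h [] + (\<Sum>i\<in>UNIV. \<Sum>s | length s \<le> n. h (s @ [i]))"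
    and sum_words_le_Suc_cons: "(\<Sum>s | length s \<le> Suc n. h s) = h [] + (\<Sum>i\<in>UNIV. \<Sum>s | length s \<le> n. h (i # s))"
proof -
  \<comment> \<open>Both claims are one reindexing: \<open>f\<close> is any bijection from pairs of
    a letter and a word onto the nonempty words that lengthens the word by one.\<close>
  have *: "(\<Sum>s | length s \<le> Suc n. h s) = h [] + (\<Sum>i\<in>UNIV. \<Sum>s | length s \<le> n. h (f i s))"
    if inj: "inj (\<lambda>(i, s). f i s)" and ne: "\<And>i s. f i s \<noteq> []" and len: "\<And>i s. length (f i s) = Suc (length s)"
      and surj: "\<And>s. s \<noteq> [] \<Longrightarrow> \<exists>i s'. s = f i s'" for f :: "'i \<Rightarrow> 'i list \<Rightarrow> 'i list"
  proof -
    let ?X = "(UNIV :: 'i set) \<times> {s :: 'i list. length s \<le> n}"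
    have fin: "finite ?X" by (intro finite_cartesian_product finite finite_words_le)
    have "{s. length s \<le> Suc n} = insert [] ((\<lambda>(i, s). f i s) ` ?X)"
    proof (intro set_eqI iffI)
      fix s :: "'i list" assume s: "s \<in> {s. length s \<le> Suc n}"
      show "s \<in> insert [] ((\<lambda>(i, s). f i s) ` ?X)"
      proof (cases "s = []")
        case False
        then obtain i s' where "s = f i s'" using surj by blast
        with s len show ?thesis by force
      qed simp
    qed (use len in auto)
    moreover have "[] \<notin> (\<lambda>(i, s). f i s) ` ?X"
    proof
      assume "[] \<in> (\<lambda>(i, s). f i s) ` ?X"
      then obtain i s where "f i s = []" by (metis (no_types, lifting) case_prod_beta imageE)
      then show False using ne by blast
    qed
    ultimately have "(\<Sum>s | length s \<le> Suc n. h s) = h [] + sum h ((\<lambda>(i, s). f i s) ` ?X)"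
      using fin by (simp add: sum.insert)
    also have "sum h ((\<lambda>(i, s). f i s) ` ?X) = (\<Sum>(i, s)\<in>?X. h (f i s))"
      using inj by (subst sum.reindex) (auto intro: inj_on_subset sum.cong)
    also have "\<dots> = (\<Sum>i\<in>UNIV. \<Sum>s | length s \<le> n. h (f i s))"
      by (rule sum.cartesian_product[symmetric])
    finally show ?thesis .
  qed
  show "(\<Sum>s | length s \<le> Suc n. h s) = h [] + (\<Sum>i\<in>UNIV. \<Sum>s | length s \<le> n. h (s @ [i]))"
    by (rule *[of "\<lambda>i s. s @ [i]"]) (auto simp: inj_def intro: rev_exhaust)
  show "(\<Sum>s | length s \<le> Suc n. h s) = h [] + (\<Sum>i\<in>UNIV. \<Sum>s | length s \<le> n. h (i # s))"
    by (rule *[of "\<lambda>i s. i # s"]) (auto simp: inj_def neq_Nil_conv)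
qed

text \<open>There are \<open>CARD('i) ^ n\<close> words of length \<open>n\<close>, so a majorant
  depending on the length alone reduces everything to an ordinary series. The limit along
  truncations by length turns unconditional sums into sequences, to which dominated convergence
  applies.\<close>

lemma words_summable:
  fixes f :: "'i::finite list \<Rightarrow> real"
  assumes f: "\<And>s. \<bar>f s\<bar> \<le> g (length s)" and g: "summable (\<lambda>n. real CARD('i) ^ n * g n)"
  shows "f summable_on UNIV" "(\<lambda>n. \<Sum>s | length s \<le> n. f s) \<longlonglongrightarrow> infsum f UNIV"
    "\<bar>\<Sum>s | length s \<le> n. f s\<bar> \<le> (\<Sum>n. real CARD('i) ^ n * g n)"
proof -
  have g0: "g n \<ge> 0" for n
    using f[of "replicate n undefined"] by (metis abs_ge_zero length_replicate order_trans)
  have part: "(\<Sum>s | length s \<le> n. \<bar>f s\<bar>) \<le> (\<Sum>n. real CARD('i) ^ n * g n)" for n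
  proof -
    have "(\<Sum>s | length s \<le> n. \<bar>f s\<bar>) \<le> (\<Sum>s :: 'i list | length s \<le> n. g (length s))"
      by (intro sum_mono f)
    also have "\<dots> = (\<Sum>k\<in>{..n}. \<Sum>s\<in>{s \<in> {s :: 'i list. length s \<le> n}. length s = k}. g (length s))"
      by (rule sum.group[symmetric]) (use finite_words_le in auto)
    also have "\<dots> = (\<Sum>k\<in>{..n}. real CARD('i) ^ k * g k)"
    proof (rule sum.cong[OF refl])
      fix k assume "k \<in> {..n}"
      then have "{s \<in> {s. length s \<le> n}. length s = k} = {s :: 'i list. set s \<subseteq> UNIV \<and> length s = k}" by auto
      then show "(\<Sum>s\<in>{s :: 'i list \<in> {s. length s \<le> n}. length s = k}. g (length s)) = real CARD('i) ^ k * g k"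
        by (simp add: card_lists_length_eq[of "UNIV :: 'i set", simplified])
    qed
    also have "\<dots> \<le> (\<Sum>n. real CARD('i) ^ n * g n)"
      using g g0 by (intro sum_le_suminf) auto
    finally show ?thesis .
  qed
  have "(\<lambda>s. \<bar>f s\<bar>) summable_on UNIV"
  proof (rule nonneg_bdd_above_summable_on)
    show "bdd_above (sum (\<lambda>s. \<bar>f s\<bar>) ` {F. F \<subseteq> UNIV \<and> finite F})"
    proof (rule bdd_aboveI2)
      fix F :: "'i list set" assume F: "F \<in> {F. F \<subseteq> UNIV \<and> finite F}"
      then have "F \<subseteq> {s. length s \<le> Max (length ` F)}" by auto
      then have "sum (\<lambda>s. \<bar>f s\<bar>) F \<le> (\<Sum>s | length s \<le> Max (length ` F). \<bar>f s\<bar>)"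
        using finite_words_le by (intro sum_mono2) auto
      then show "sum (\<lambda>s. \<bar>f s\<bar>) F \<le> (\<Sum>n. real CARD('i) ^ n * g n)" using part order_trans by blast
    qed
  qed simp
  then show s: "f summable_on UNIV"
    using summable_on_iff_abs_summable_on_real[of f UNIV] by simp
  have "(f has_sum infsum f UNIV) UNIV" using s by simp
  then have "(sum f \<longlongrightarrow> infsum f UNIV) (finite_subsets_at_top UNIV)" by (simp add: has_sum_def)
  moreover have "filterlim (\<lambda>n. {s :: 'i list. length s \<le> n}) (finite_subsets_at_top UNIV) sequentially"
    unfolding filterlim_finite_subsets_at_top
  proof (intro allI impI)
    fix X :: "'i list set" assume X: "finite X \<and> X \<subseteq> UNIV"
    show "\<forall>\<^sub>F n in sequentially. finite {s :: 'i list. length s \<le> n} \<and> X \<subseteq> {s. length s \<le> n} \<and> {s :: 'i list. length s \<le> n} \<subseteq> UNIV"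
    proof (rule eventually_sequentiallyI[of "Max (length ` X)"])
      fix n assume n: "Max (length ` X) \<le> n"
      have "length s \<le> n" if "s \<in> X" for s using Max_ge[of "length ` X" "length s"] X that n by (meson finite_imageI imageI order_trans)
      then show "finite {s :: 'i list. length s \<le> n} \<and> X \<subseteq> {s. length s \<le> n} \<and> {s :: 'i list. length s \<le> n} \<subseteq> UNIV"
        using finite_words_le by auto
    qed
  qed
  ultimately show "(\<lambda>n. \<Sum>s | length s \<le> n. f s) \<longlonglongrightarrow> infsum f UNIV"
    by (rule filterlim_compose)
  have "\<bar>\<Sum>s | length s \<le> n. f s\<bar> \<le> (\<Sum>s | length s \<le> n. \<bar>f s\<bar>)" by (rule sum_abs)
  then show "\<bar>\<Sum>s | length s \<le> n. f s\<bar> \<le> (\<Sum>n. real CARD('i) ^ n * g n)" using part order_trans by blast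
qed

text \<open>A Chen-Fliess generating series; \<open>rev\<close> is due to the reversed words of
  \<open>iter_int\<close>.\<close>

definition wseries :: "('i \<Rightarrow> real \<Rightarrow> real) \<Rightarrow> ('i list \<Rightarrow> real) \<Rightarrow> real \<Rightarrow> real \<Rightarrow> real"
  where "wseries q c t \<tau> = (\<Sum>\<^sub>\<infinity>s. c s * iter_int q (rev s) t \<tau>)"

lemma wseries_cong:
  assumes "\<And>i z. \<tau> \<le> z \<Longrightarrow> z < t \<Longrightarrow> q i z = q' i z"
  shows "wseries q c t \<tau> = wseries q' c t \<tau>"
  unfolding wseries_def
proof (rule infsum_cong)
  fix s
  have "iter_int q (rev s) t \<tau> = iter_int q' (rev s) t \<tau>" by (rule iter_int_cong) (use assms in auto)
  then show "c s * iter_int q (rev s) t \<tau> = c s * iter_int q' (rev s) t \<tau>" by simp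
qed

lemma wseries_refl: "wseries q c t t = c []"
proof -
  have "wseries q c t t = (\<Sum>\<^sub>\<infinity>s\<in>{[]}. c s * iter_int q (rev s) t t)"
    unfolding wseries_def
  proof (rule infsum_cong_neutral)
    fix s :: "'a list" assume "s \<in> UNIV - {[]}"
    then have "rev s \<noteq> []" by simp
    then obtain i r where "rev s = i # r" by (meson neq_Nil_conv)
    then show "c s * iter_int q (rev s) t t = 0" by simp
  qed auto
  then show ?thesis by simp
qed

context letters
begin

text \<open>Truncation by length is stable under peeling: removing a first or a last letter from
  level \<open>Suc n\<close> leaves level \<open>n\<close>.\<close>

definition wpartial :: "nat \<Rightarrow> ('i list \<Rightarrow> real) \<Rightarrow> real \<Rightarrow> real \<Rightarrow> real"
  where "wpartial n c t \<tau> = (\<Sum>s | length s \<le> n. c s * iter_int q (rev s) t \<tau>)"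

lemma word_term_bound:
  assumes c: "word_growth c" and "0 \<le> T"
  obtains g where "summable (\<lambda>n. real CARD('i) ^ n * g n)"
    "\<And>s t \<tau>. 0 \<le> \<tau> \<Longrightarrow> \<tau> \<le> t \<Longrightarrow> t \<le> T \<Longrightarrow> \<bar>c s * iter_int q (rev s) t \<tau>\<bar> \<le> g (length s)"
proof -
  obtain K R where K: "K > 0" "R > 0" "\<And>s. \<bar>c s\<bar> \<le> K * R ^ length s" 
    using c unfolding word_growth_def by blast
  obtain M where M: "M \<ge> 0" "\<And>i s. s \<in> {0..T} \<Longrightarrow> \<bar>q i s\<bar> \<le> M"
    using letter_bound by blast
  define g where "g n = K * R ^ n * ((M * T) ^ n / fact n)" for n
  have b: "\<bar>c s * iter_int q (rev s) t \<tau>\<bar> \<le> g (length s)" if "0 \<le> \<tau>" "\<tau> \<le> t" "t \<le> T" for s t \<tau>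
  proof -
    have "\<bar>iter_int q (rev s) t \<tau>\<bar> \<le> (M * (t - \<tau>)) ^ length s / fact (length s)"
      using iter_int_bound[OF M(2) M(1) that, of "rev s"] by simp
    also have "\<dots> \<le> (M * T) ^ length s / fact (length s)"
      using that M by (intro divide_right_mono power_mono mult_left_mono) auto
    finally show ?thesis using K unfolding abs_mult g_def by (intro mult_mono) auto
  qed
  \<comment> \<open>Summed over all words, the majorant is a multiple of an exponential series; it
    is uniform in both times, as dominated convergence will require.\<close>
  have "(\<lambda>n. real CARD('i) ^ n * g n) = (\<lambda>n. K * ((real CARD('i) * R * M * T) ^ n /\<^sub>R fact n))"
    by (simp add: g_def power_mult_distrib divide_inverse ac_simps)
  then have s: "summable (\<lambda>n. real CARD('i) ^ n * g n)"
    by (simp only: summable_mult summable_exp_generic)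
  show ?thesis using that[OF s b] .
qed

lemma wseries_summable:
  assumes c: "word_growth c" and "0 \<le> \<tau>" "\<tau> \<le> t"
  shows "(\<lambda>s. c s * iter_int q (rev s) t \<tau>) summable_on UNIV" (is ?S)
    and "(\<lambda>n. wpartial n c t \<tau>) \<longlonglongrightarrow> wseries q c t \<tau>" (is ?L)
proof -
  have "0 \<le> t" using assms by simp
  obtain g where "summable (\<lambda>n. real CARD('i) ^ n * g n)"
    "\<And>s. \<bar>c s * iter_int q (rev s) t \<tau>\<bar> \<le> g (length s)"
    using word_term_bound[OF c \<open>0 \<le> t\<close>] assms(2,3) by (metis order_refl)
  then show ?S ?L
    using words_summable[of "\<lambda>s. c s * iter_int q (rev s) t \<tau>" g] by (simp_all add: wpartial_def wseries_def)
qed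

lemma wpartial_bound:
  assumes c: "word_growth c" and "0 \<le> T"
  obtains E where "E \<ge> 0" "\<And>n \<tau> t. 0 \<le> \<tau> \<Longrightarrow> \<tau> \<le> t \<Longrightarrow> t \<le> T \<Longrightarrow> \<bar>wpartial n c t \<tau>\<bar> \<le> E"
proof -
  obtain g where s: "summable (\<lambda>n. real CARD('i) ^ n * g n)"
    and b: "\<And>s t \<tau>. 0 \<le> \<tau> \<Longrightarrow> \<tau> \<le> t \<Longrightarrow> t \<le> T \<Longrightarrow> \<bar>c s * iter_int q (rev s) t \<tau>\<bar> \<le> g (length s)"
    using word_term_bound[OF assms] by blast
  have E: "\<bar>wpartial n c t \<tau>\<bar> \<le> (\<Sum>n. real CARD('i) ^ n * g n)" if "0 \<le> \<tau>" "\<tau> \<le> t" "t \<le> T" for n t \<tau>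
    using words_summable(3)[OF b[OF that] s] by (simp add: wpartial_def)
  moreover have "0 \<le> (\<Sum>n. real CARD('i) ^ n * g n)"
    using E[of 0 0 0] assms(2) by simp
  ultimately show ?thesis using that by blast
qed

lemma wpartial_Suc_snoc:
  assumes "0 \<le> \<tau>"
  shows "wpartial (Suc n) c t \<tau> = c [] + (\<Sum>i\<in>UNIV. integral {\<tau>..t} (\<lambda>z. q i z * wpartial n (\<lambda>s. c (s @ [i])) z \<tau>))"
proof -
  have "(\<Sum>s | length s \<le> n. c (s @ [i]) * iter_int q (rev (s @ [i])) t \<tau>)
      = integral {\<tau>..t} (\<lambda>z. q i z * wpartial n (\<lambda>s. c (s @ [i])) z \<tau>)" for i
  proof -
    have "(\<Sum>s | length s \<le> n. c (s @ [i]) * iter_int q (rev (s @ [i])) t \<tau>)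
        = (\<Sum>s | length s \<le> n. integral {\<tau>..t} (\<lambda>z. c (s @ [i]) * (q i z * iter_int q (rev s) z \<tau>)))"
      by simp
    also have "\<dots> = integral {\<tau>..t} (\<lambda>z. \<Sum>s | length s \<le> n. c (s @ [i]) * (q i z * iter_int q (rev s) z \<tau>))"
      using assms finite_words_le
      by (intro integral_sum[symmetric] integrable_on_mult_right loc_bdd_meas_integrable iter_int_lbm_mult)
    also have "(\<lambda>z. \<Sum>s | length s \<le> n. c (s @ [i]) * (q i z * iter_int q (rev s) z \<tau>))
       = (\<lambda>z. q i z * wpartial n (\<lambda>s. c (s @ [i])) z \<tau>)"
      by (simp add: wpartial_def sum_distrib_left algebra_simps)
    finally show ?thesis .
  qed
  then show ?thesis unfolding wpartial_def[of "Suc n"] sum_words_le_Suc_snoc by simp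
qed

lemma wpartial_Suc_cons:
  assumes "0 \<le> \<tau>" "\<tau> \<le> t"
  shows "wpartial (Suc n) c t \<tau> = c [] + (\<Sum>i\<in>UNIV. integral {\<tau>..t} (\<lambda>z. q i z * wpartial n (\<lambda>s. c (i # s)) t z))"
proof -
  have "(\<Sum>s | length s \<le> n. c (i # s) * iter_int q (rev (i # s)) t \<tau>)
      = integral {\<tau>..t} (\<lambda>z. q i z * wpartial n (\<lambda>s. c (i # s)) t z)" for i
  proof -
    have "(\<Sum>s | length s \<le> n. c (i # s) * iter_int q (rev (i # s)) t \<tau>)
        = (\<Sum>s | length s \<le> n. integral {\<tau>..t} (\<lambda>z. c (i # s) * (q i z * iter_int q (rev s) t z)))"
      using assms by (simp add: iter_int_snoc)
    also have "\<dots> = integral {\<tau>..t} (\<lambda>z. \<Sum>s | length s \<le> n. c (i # s) * (q i z * iter_int q (rev s) t z))"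
      using assms finite_words_le
      by (intro integral_sum[symmetric] integrable_on_mult_right integrable_mult_continuous(2)[OF q] iter_int_start_continuous) auto
    also have "(\<lambda>z. \<Sum>s | length s \<le> n. c (i # s) * (q i z * iter_int q (rev s) t z))
       = (\<lambda>z. q i z * wpartial n (\<lambda>s. c (i # s)) t z)"
      by (simp add: wpartial_def sum_distrib_left algebra_simps)
    finally show ?thesis .
  qed
  then show ?thesis unfolding wpartial_def[of "Suc n"] sum_words_le_Suc_cons by simp
qed

lemma wpartial_end_continuous: "0 \<le> \<tau> \<Longrightarrow> continuous_on {0..} (\<lambda>t. wpartial n c t \<tau>)"
  unfolding wpartial_def by (intro continuous_intros iter_int_continuous)

lemma wpartial_start_continuous: "0 \<le> t \<Longrightarrow> continuous_on {0..t} (\<lambda>\<tau>. wpartial n c t \<tau>)"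
  unfolding wpartial_def by (intro continuous_intros iter_int_start_continuous)

text \<open>The maps \<open>a\<close> and \<open>b\<close> let one dominated convergence argument
  serve both peelings: a fixed start with moving end for the last letter, and a moving start with
  fixed end for the first.\<close>

lemma wseries_integral_limit:
  assumes c: "word_growth c" and "0 \<le> \<tau>" "\<tau> \<le> t"
    and ab: "\<And>z. z \<in> {\<tau>..t} \<Longrightarrow> 0 \<le> a z \<and> a z \<le> b z \<and> b z \<le> t"
    and int: "\<And>n. (\<lambda>z. q i z * wpartial n c (b z) (a z)) integrable_on {\<tau>..t}"
  shows "(\<lambda>z. q i z * wseries q c (b z) (a z)) integrable_on {\<tau>..t}"
    and "(\<lambda>n. integral {\<tau>..t} (\<lambda>z. q i z * wpartial n c (b z) (a z))) \<longlonglongrightarrow>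
      integral {\<tau>..t} (\<lambda>z. q i z * wseries q c (b z) (a z))"
proof -
  have "0 \<le> t" using assms by simp
  then obtain E where E: "E \<ge> 0" "\<And>n \<tau> s. 0 \<le> \<tau> \<Longrightarrow> \<tau> \<le> s \<Longrightarrow> s \<le> t \<Longrightarrow> \<bar>wpartial n c s \<tau>\<bar> \<le> E"
    using wpartial_bound[OF c] by metis
  obtain M where M: "M \<ge> 0" "\<And>i s. s \<in> {0..t} \<Longrightarrow> \<bar>q i s\<bar> \<le> M"
    using letter_bound by blast
  have le: "norm (q i z * wpartial n c (b z) (a z)) \<le> M * E" if "z \<in> {\<tau>..t}" for n z
    using ab[OF that] E(2)[of "a z" "b z" n] M(1) M(2)[of z i] that assms(2) by (auto simp: abs_mult intro!: mult_mono)
  have conv: "(\<lambda>n. q i z * wpartial n c (b z) (a z)) \<longlonglongrightarrow> q i z * wseries q c (b z) (a z)"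
    if "z \<in> {\<tau>..t}" for z
    using ab[OF that] by (intro tendsto_intros wseries_summable c) auto
  have const: "(\<lambda>_. M * E) integrable_on {\<tau>..t}" by (rule integrable_const_ivl)
  show "(\<lambda>z. q i z * wseries q c (b z) (a z)) integrable_on {\<tau>..t}"
    and "(\<lambda>n. integral {\<tau>..t} (\<lambda>z. q i z * wpartial n c (b z) (a z))) \<longlonglongrightarrow>
      integral {\<tau>..t} (\<lambda>z. q i z * wseries q c (b z) (a z))"
    using dominated_convergence[OF int const le conv] by auto
qed

text \<open>For a fixed start time this is the integral form of a forward equation, coupling the
  series to its right shifts; \<open>wseries_cons\<close> is the backward equation in the start
  time, with left shifts. Both are limits of the finite identities for
  \<open>wpartial\<close>.\<close>

lemma wseries_snoc:
  assumes c: "word_growth c" and "0 \<le> \<tau>" "\<tau> \<le> t"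
  shows "(\<lambda>z. q i z * wseries q (\<lambda>s. c (s @ [i])) z \<tau>) integrable_on {\<tau>..t}"
    and "wseries q c t \<tau> = c [] + (\<Sum>i\<in>UNIV. integral {\<tau>..t} (\<lambda>z. q i z * wseries q (\<lambda>s. c (s @ [i])) z \<tau>))"
proof -
  have int: "(\<lambda>z. q i z * wpartial n (\<lambda>s. c (s @ [i])) z \<tau>) integrable_on {\<tau>..t}" for n i
    using assms(2)
    by (intro loc_bdd_meas_integrable loc_bdd_meas_mult q loc_bdd_meas_continuous wpartial_end_continuous)
  note lim = wseries_integral_limit[where a = "\<lambda>_. \<tau>" and b = "\<lambda>z. z", OF word_growth_snoc[OF c] assms(2,3) _ int]
  show "(\<lambda>z. q i z * wseries q (\<lambda>s. c (s @ [i])) z \<tau>) integrable_on {\<tau>..t}"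
    using lim(1) assms(2) by auto
  have "(\<lambda>n. wpartial (Suc n) c t \<tau>) \<longlonglongrightarrow> c [] + (\<Sum>i\<in>UNIV. integral {\<tau>..t} (\<lambda>z. q i z * wseries q (\<lambda>s. c (s @ [i])) z \<tau>))"
    unfolding wpartial_Suc_snoc[OF assms(2)] using assms(2) by (intro tendsto_intros lim(2)) auto
  then show "wseries q c t \<tau> = c [] + (\<Sum>i\<in>UNIV. integral {\<tau>..t} (\<lambda>z. q i z * wseries q (\<lambda>s. c (s @ [i])) z \<tau>))"
    using LIMSEQ_unique LIMSEQ_Suc[OF wseries_summable(2)[OF assms]] by blast
qed

lemma wseries_cons:
  assumes c: "word_growth c" and "0 \<le> \<tau>" "\<tau> \<le> t"
  shows "(\<lambda>z. q i z * wseries q (\<lambda>s. c (i # s)) t z) integrable_on {\<tau>..t}"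
    and "wseries q c t \<tau> = c [] + (\<Sum>i\<in>UNIV. integral {\<tau>..t} (\<lambda>z. q i z * wseries q (\<lambda>s. c (i # s)) t z))"
proof -
  have int: "(\<lambda>z. q i z * wpartial n (\<lambda>s. c (i # s)) t z) integrable_on {\<tau>..t}" for n i
    using assms(2,3) by (intro integrable_mult_continuous(2)[OF q] wpartial_start_continuous) auto
  note lim = wseries_integral_limit[where a = "\<lambda>z. z" and b = "\<lambda>_. t", OF word_growth_cons[OF c] assms(2,3) _ int]
  show "(\<lambda>z. q i z * wseries q (\<lambda>s. c (i # s)) t z) integrable_on {\<tau>..t}"
    using lim(1) assms(2) by auto
  have "(\<lambda>n. wpartial (Suc n) c t \<tau>) \<longlonglongrightarrow> c [] + (\<Sum>i\<in>UNIV. integral {\<tau>..t} (\<lambda>z. q i z * wseries q (\<lambda>s. c (i # s)) t z))"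
    unfolding wpartial_Suc_cons[OF assms(2,3)] using assms(2) by (intro tendsto_intros lim(2)) auto
  then show "wseries q c t \<tau> = c [] + (\<Sum>i\<in>UNIV. integral {\<tau>..t} (\<lambda>z. q i z * wseries q (\<lambda>s. c (i # s)) t z))"
    using LIMSEQ_unique LIMSEQ_Suc[OF wseries_summable(2)[OF assms]] by blast
qed

lemma wseries_end_continuous:
  assumes c: "word_growth c" and "0 \<le> \<tau>"
  shows "continuous_on {\<tau>..T} (\<lambda>t. wseries q c t \<tau>)"
proof (cases "\<tau> \<le> T")
  case True
  have "continuous_on {\<tau>..T} (\<lambda>t. c [] + (\<Sum>i\<in>UNIV. integral {\<tau>..t} (\<lambda>z. q i z * wseries q (\<lambda>s. c (s @ [i])) z \<tau>)))"
    using assms True by (intro continuous_intros indefinite_integral_continuous_1 wseries_snoc)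
  then show ?thesis
    by (rule continuous_on_eq) (use wseries_snoc(2)[OF c assms(2)] in auto)
qed simp

lemma wseries_start_continuous:
  assumes c: "word_growth c"
  shows "continuous_on {0..t} (\<lambda>\<tau>. wseries q c t \<tau>)"
proof (cases "0 \<le> t")
  case True
  have "continuous_on {0..t} (\<lambda>\<tau>. c [] + (\<Sum>i\<in>UNIV. integral {\<tau>..t} (\<lambda>z. q i z * wseries q (\<lambda>s. c (i # s)) t z)))"
    using assms True by (intro continuous_intros indefinite_integral_continuous_1' wseries_cons) auto
  then show ?thesis
    by (rule continuous_on_eq) (use wseries_cons(2)[OF c] in auto)
qed simp

lemma wseries_sum:
  assumes c: "\<And>k. k \<in> A \<Longrightarrow> word_growth (c k)" and "0 \<le> \<tau>" "\<tau> \<le> t"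
  shows "wseries q (\<lambda>s. \<Sum>k\<in>A. a k * c k s) t \<tau> = (\<Sum>k\<in>A. a k * wseries q (c k) t \<tau>)"
proof -
  have g: "word_growth (\<lambda>s. \<Sum>k\<in>A. a k * c k s)"
    by (intro word_growth_sum word_growth_mult c)
  have "wpartial n (\<lambda>s. \<Sum>k\<in>A. a k * c k s) t \<tau> = (\<Sum>k\<in>A. a k * wpartial n (c k) t \<tau>)" for n
    unfolding wpartial_def sum_distrib_left sum_distrib_right by (subst sum.swap) (simp add: mult.assoc)
  moreover have "(\<lambda>n. \<Sum>k\<in>A. a k * wpartial n (c k) t \<tau>) \<longlonglongrightarrow> (\<Sum>k\<in>A. a k * wseries q (c k) t \<tau>)"
    using assms by (intro tendsto_intros wseries_summable)
  ultimately show ?thesis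
    using LIMSEQ_unique[OF wseries_summable(2)[OF g assms(2,3)]] by auto
qed

lemma wseries_diff:
  assumes "word_growth c" "word_growth d" and "0 \<le> \<tau>" "\<tau> \<le> t"
  shows "wseries q (\<lambda>s. c s - d s) t \<tau> = wseries q c t \<tau> - wseries q d t \<tau>"
  using wseries_sum[of UNIV "\<lambda>b. if b then c else d" \<tau> t "\<lambda>b. if b then 1 else -1"] assms by (simp add: UNIV_bool)

end

section \<open>Linear systems and Hankel matrices\<close>

lemma sum_fun_apply: "(\<Sum>i\<in>A. f i) x = (\<Sum>i\<in>A. f i x)"
  by (induction A rule: infinite_finite_induct) auto

text \<open>Homogenization: the extra component \<open>sched q None = 1\<close> makes affine
  dependence linear, so that the constant coefficient is treated like all others.\<close>

lemma affine_dep_eq_sum_sched: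
  fixes M :: "'p::finite option \<Rightarrow> 'a::real_vector"
  shows "affine_dep M q = (\<Sum>i\<in>UNIV. sched q i *\<^sub>R M i)"
proof -
  have "(\<Sum>i\<in>UNIV. sched q i *\<^sub>R M i) = sched q None *\<^sub>R M None + (\<Sum>i\<in>range Some. sched q i *\<^sub>R M i)"
    unfolding UNIV_option_conv by (subst sum.insert) auto
  also have "(\<Sum>i\<in>range Some. sched q i *\<^sub>R M i) = (\<Sum>i\<in>UNIV. sched q (Some i) *\<^sub>R M (Some i))"
    by (subst sum.reindex) auto
  finally show ?thesis by (simp add: affine_dep_def sched_def)
qed

text \<open>The zero set of the combination is affine and contains \<open>P\<close>, hence is the
  whole space. Evaluation at 0 isolates \<open>a None\<close>, and the unit vectors then give the
  other coefficients.\<close>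

lemma sched_combination_zero:
  fixes P :: "(real^'p::finite) set" and a :: "'p option \<Rightarrow> real"
  assumes P: "affine hull P = UNIV" and 0: "\<And>q. q \<in> P \<Longrightarrow> (\<Sum>i\<in>UNIV. sched q i * a i) = 0"
  shows "a i = 0"
proof -
  define X where "X = {q :: real^'p. (\<Sum>i\<in>UNIV. sched q i * a i) = 0}"
  have eq: "(\<Sum>i\<in>UNIV. sched q i * a i) = a None + (\<Sum>k\<in>UNIV. q $ k * a (Some k))" for q :: "real^'p"
    using affine_dep_eq_sum_sched[of a q] by (simp add: affine_dep_def)
  have "affine X"
    unfolding affine_def X_def eq
  proof (safe, goal_cases)
    case (1 x y u v)
    have "a None + (\<Sum>k\<in>UNIV. (u *\<^sub>R x + v *\<^sub>R y) $ k * a (Some k))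
       = u * (a None + (\<Sum>k\<in>UNIV. x $ k * a (Some k))) + v * (a None + (\<Sum>k\<in>UNIV. y $ k * a (Some k)))
         + (1 - (u + v)) * a None"
      by (simp add: sum_distrib_left sum.distrib algebra_simps)
    then show ?case using 1 by simp
  qed
  moreover have "P \<subseteq> X" using 0 by (auto simp: X_def)
  ultimately have "X = UNIV" using P hull_minimal[of P X affine] by auto
  then have *: "a None + (\<Sum>k\<in>UNIV. q $ k * a (Some k)) = 0" for q :: "real^'p"
    unfolding X_def eq by auto
  have N: "a None = 0" using *[of 0] by simp
  show ?thesis
  proof (cases i)
    case (Some k)
    have "(\<Sum>l\<in>UNIV. axis k 1 $ l * a (Some l)) = (\<Sum>l\<in>UNIV. if l = k then a (Some l) else 0)"
      by (rule sum.cong) (auto simp: axis_def)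
    then show ?thesis using *[of "axis k 1"] N Some by simp
  qed (use N in simp)
qed

text \<open>The uniqueness argument common to both time domains: \<open>V c\<close> says that the generating series
  with coefficients \<open>c\<close> vanishes along all scheduling signals, and extending the scheduling
  signal by the value \<open>q\<close> removes the last letter of the words.\<close>

lemma word_coefficients_vanish:
  fixes P :: "(real^'p::finite) set" and c :: "'p option list \<Rightarrow> real"
  assumes P: "affine hull P = UNIV" and "V c"
    and Nil: "\<And>c. V c \<Longrightarrow> c [] = 0"
    and snoc: "\<And>c q. V c \<Longrightarrow> q \<in> P \<Longrightarrow> V (\<lambda>s. \<Sum>i\<in>UNIV. sched q i * c (s @ [i]))"
  shows "c s = 0"
  using \<open>V c\<close>
proof (induction s arbitrary: c rule: rev_induct)
  case (snoc i s)
  \<comment> \<open>The induction hypothesis is applied to the stripped family rather than to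
    \<open>c\<close>: its coefficient at \<open>s\<close> is exactly this combination.\<close>
  have "(\<Sum>i\<in>UNIV. sched q i * c (s @ [i])) = 0" if "q \<in> P" for q
    using snoc.IH[OF assms(4)[OF snoc.prems that]] .
  then show ?case by (rule sched_combination_zero[OF P])
qed (rule Nil)

section \<open>Impulse response coefficients of a realization\<close>

definition state_op :: "('p, 'u, 'y) lpv_ssa \<Rightarrow> 'p option \<Rightarrow> (nat \<Rightarrow> real) \<Rightarrow> nat \<Rightarrow> real"
  where "state_op S i v = (\<lambda>k. \<Sum>l<sdim S. Acoef S i k l * v l)"

text \<open>With \<open>foldl\<close> the first letter acts first, so a word s_1 ... s_n denotes the
  product A_(s_n) ... A_(s_1), in the order of time.\<close>

definition word_op :: "('p, 'u, 'y) lpv_ssa \<Rightarrow> 'p option list \<Rightarrow> (nat \<Rightarrow> real) \<Rightarrow> nat \<Rightarrow> real"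
  where "word_op S s v = foldl (\<lambda>v i. state_op S i v) v s"

definition out_coef :: "('p, 'u, 'y) lpv_ssa \<Rightarrow> 'p option \<Rightarrow> 'y \<Rightarrow> (nat \<Rightarrow> real) \<Rightarrow> real"
  where "out_coef S i r v = (\<Sum>k<sdim S. Ccoef S i r k * v k)"

definition input_vec :: "('p, 'u, 'y) lpv_ssa \<Rightarrow> 'p option \<Rightarrow> 'u \<Rightarrow> nat \<Rightarrow> real"
  where "input_vec S j m = (\<lambda>k. Bcoef S j k m)"

text \<open>The initial state is treated as one more input column; the free response and the impulse
  responses then share all arguments about words.\<close>

definition start_vec :: "('p, 'u, 'y) lpv_ssa \<Rightarrow> (nat \<Rightarrow> real) \<Rightarrow> ('p option \<times> 'u) option \<Rightarrow> nat \<Rightarrow> real"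
  where "start_vec S x0 c = (case c of None \<Rightarrow> x0 | Some (j, m) \<Rightarrow> input_vec S j m)"

definition theta_of ::
  "('p::finite, 'u::finite, 'y::finite) lpv_ssa \<Rightarrow> (nat \<Rightarrow> real) \<Rightarrow> 'p option list \<Rightarrow> ('p, 'u, 'y) theta_mat"
  where "theta_of S x0 s = (\<chi> ir c. out_coef S (fst ir) (snd ir) (word_op S s (start_vec S x0 c)))"

lemma word_op_simps [simp]:
  "word_op S [] v = v"
  "word_op S (i # s) v = word_op S s (state_op S i v)"
  "word_op S (s @ [i]) v = state_op S i (word_op S s v)"
  by (simp_all add: word_op_def)

lemma word_op_append: "word_op S (s @ s') v = word_op S s' (word_op S s v)"
  by (simp add: word_op_def)

lemma output_map_nth:
  fixes S :: "('p::finite, 'u, 'y::finite) lpv_ssa"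
  shows "output_map S q x $ r = (\<Sum>i\<in>UNIV. sched q i * out_coef S i r x)"
proof -
  have "output_map S q x $ r = (\<Sum>l<sdim S. \<Sum>i\<in>UNIV. sched q i * (Ccoef S i r l * x l))"
    by (simp add: output_map_def affine_dep_eq_sum_sched sum_fun_apply sum_distrib_right mult.assoc)
  then show ?thesis
    by (subst (asm) sum.swap) (simp add: out_coef_def sum_distrib_left)
qed

lemma state_rhs_nth:
  fixes S :: "('p::finite, 'u::finite, 'y) lpv_ssa"
  assumes "k < sdim S"
  shows "state_rhs S q x v k = (\<Sum>i\<in>UNIV. sched q i * state_op S i x k)
    + (\<Sum>j\<in>UNIV. \<Sum>m\<in>UNIV. sched q j * v $ m * input_vec S j m k)"
proof -
  have "(\<Sum>l<sdim S. affine_dep (Acoef S) q k l * x l) = (\<Sum>l<sdim S. \<Sum>i\<in>UNIV. sched q i * (Acoef S i k l * x l))"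
    by (simp add: affine_dep_eq_sum_sched sum_fun_apply sum_distrib_right mult.assoc)
  also have "\<dots> = (\<Sum>i\<in>UNIV. sched q i * state_op S i x k)"
    by (subst sum.swap) (simp add: state_op_def sum_distrib_left)
  finally have 1: "(\<Sum>l<sdim S. affine_dep (Acoef S) q k l * x l) = (\<Sum>i\<in>UNIV. sched q i * state_op S i x k)" .
  have "(\<Sum>m\<in>UNIV. affine_dep (Bcoef S) q k m * v $ m) = (\<Sum>m\<in>UNIV. \<Sum>j\<in>UNIV. sched q j * v $ m * input_vec S j m k)"
    by (simp add: affine_dep_eq_sum_sched sum_fun_apply sum_distrib_right sum_distrib_left input_vec_def mult_ac)
  also have "\<dots> = (\<Sum>j\<in>UNIV. \<Sum>m\<in>UNIV. sched q j * v $ m * input_vec S j m k)"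
    by (rule sum.swap)
  finally show ?thesis using 1 assms by (simp add: state_rhs_def)
qed

lemma word_growth_word_op:
  fixes S :: "('p::finite, 'u, 'y) lpv_ssa"
  assumes "k < sdim S"
  shows "word_growth (\<lambda>s. word_op S s v k)"
proof -
  \<comment> \<open>\<open>R\<close> adds up all entries of all state matrices and so dominates
    their operator norms for the l1 norm \<open>N\<close>.\<close>
  define R where "R = (\<Sum>i\<in>UNIV. \<Sum>k<sdim S. \<Sum>l<sdim S. \<bar>Acoef S i k l\<bar>)"
  define N where "N v = (\<Sum>l<sdim S. \<bar>v l\<bar>)" for v :: "nat \<Rightarrow> real"
  have N0: "N v \<ge> 0" for v unfolding N_def by (intro sum_nonneg) auto
  have step: "N (state_op S i v) \<le> R * N v" for i v
  proof -
    have "N (state_op S i v) = (\<Sum>k<sdim S. \<bar>\<Sum>l<sdim S. Acoef S i k l * v l\<bar>)"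
      by (simp add: N_def state_op_def)
    also have "\<dots> \<le> (\<Sum>k<sdim S. \<Sum>l<sdim S. \<bar>Acoef S i k l\<bar> * N v)"
    proof (intro sum_mono order_trans[OF sum_abs])
      fix k l assume "l \<in> {..<sdim S}"
      then have "\<bar>v l\<bar> \<le> N v" unfolding N_def by (intro member_le_sum) auto
      then show "\<bar>Acoef S i k l * v l\<bar> \<le> \<bar>Acoef S i k l\<bar> * N v"
        by (simp add: abs_mult mult_left_mono)
    qed
    also have "\<dots> = (\<Sum>k<sdim S. \<Sum>l<sdim S. \<bar>Acoef S i k l\<bar>) * N v"
      by (simp add: sum_distrib_right)
    also have "(\<Sum>k<sdim S. \<Sum>l<sdim S. \<bar>Acoef S i k l\<bar>) \<le> R"
      unfolding R_def by (rule member_le_sum) (auto intro!: sum_nonneg)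
    finally show ?thesis using N0 by (simp add: mult_right_mono)
  qed
  have "R \<ge> 0" unfolding R_def by (intro sum_nonneg) auto
  have *: "N (word_op S s v) \<le> N v * R ^ length s" for s
  proof (induction s rule: rev_induct)
    case (snoc i s)
    have "N (word_op S (s @ [i]) v) \<le> R * N (word_op S s v)" using step by simp
    also have "\<dots> \<le> R * (N v * R ^ length s)" using snoc \<open>R \<ge> 0\<close> by (rule mult_left_mono)
    finally show ?case by (simp add: mult_ac)
  qed simp
  have "\<bar>word_op S s v k\<bar> \<le> N v * R ^ length s" for s
  proof -
    have "\<bar>word_op S s v k\<bar> \<le> N (word_op S s v)"
      unfolding N_def using assms by (intro member_le_sum) auto
    then show ?thesis using *[of s] by simp
  qed
  then show ?thesis by (rule word_growthI)
qed

text \<open>Each entry is at most the matrix norm, and the matrix norm is at most the sum of the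
  finitely many absolute entries; the constants for the entries combine into one pair.\<close>

lemma growth_bounded_iff:
  "growth_bounded \<theta> \<longleftrightarrow> (\<forall>r c. word_growth (\<lambda>s. \<theta> s $ r $ c))"
proof
  assume "growth_bounded \<theta>"
  then obtain K R where KR: "\<And>s. norm (\<theta> s) \<le> K * R ^ length s" unfolding growth_bounded_def by blast
  have "\<bar>\<theta> s $ r $ c\<bar> \<le> K * R ^ length s" for r c s
    using Finite_Cartesian_Product.norm_nth_le[of "\<theta> s" r] Finite_Cartesian_Product.norm_nth_le[of "\<theta> s $ r" c] KR[of s] by simp
  then show "\<forall>r c. word_growth (\<lambda>s. \<theta> s $ r $ c)" by (intro allI word_growthI)
next
  assume g: "\<forall>r c. word_growth (\<lambda>s. \<theta> s $ r $ c)"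
  have abs: "word_growth (\<lambda>s. \<bar>\<theta> s $ r $ c\<bar>)" for r c
    using g[rule_format, of r c] by (simp add: word_growth_def)
  have "word_growth (\<lambda>s. \<Sum>r\<in>UNIV. \<Sum>c\<in>UNIV. \<bar>\<theta> s $ r $ c\<bar>)"
    by (intro word_growth_sum abs)
  then obtain K R where KR: "K > 0" "R > 0" "\<And>s. \<bar>\<Sum>r\<in>UNIV. \<Sum>c\<in>UNIV. \<bar>\<theta> s $ r $ c\<bar>\<bar> \<le> K * R ^ length s"
    unfolding word_growth_def by blast
  have "norm (\<theta> s) \<le> (\<Sum>r\<in>UNIV. \<Sum>c\<in>UNIV. \<bar>\<theta> s $ r $ c\<bar>)" for s
  proof -
    have "norm (\<theta> s) \<le> (\<Sum>r\<in>UNIV. norm (\<theta> s $ r))"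
      unfolding norm_vec_def by (rule L2_set_le_sum) simp
    also have "\<dots> \<le> (\<Sum>r\<in>UNIV. \<Sum>c\<in>UNIV. \<bar>\<theta> s $ r $ c\<bar>)"
      by (intro sum_mono norm_le_l1_cart)
    finally show ?thesis .
  qed
  then have "norm (\<theta> s) \<le> K * R ^ length s" for s
    using KR(3)[of s] by (meson abs_ge_self order_trans)
  then show "growth_bounded \<theta>" unfolding growth_bounded_def using KR(1,2) by (intro exI conjI allI)
qed

lemma word_growth_out_coef:
  fixes S :: "('p::finite, 'u, 'y) lpv_ssa"
  shows "word_growth (\<lambda>s. out_coef S i r (word_op S s v))"
  unfolding out_coef_def by (intro word_growth_sum word_growth_mult word_growth_word_op) auto

lemma growth_bounded_theta_of: "growth_bounded (theta_of S x0)"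
  unfolding growth_bounded_iff by (simp add: theta_of_def word_growth_out_coef)

text \<open>Linearity in the start vector, expanded in unit vectors. Only entries below
  \<open>sdim S\<close> are read, so \<open>v\<close> may be any function on the naturals.\<close>

lemma out_coef_word_op_linear:
  "out_coef S i r (word_op S s v) = (\<Sum>l<sdim S. v l * out_coef S i r (word_op S s (\<lambda>k. if k = l then 1 else 0)))"
proof (induction s arbitrary: v)
  case Nil
  show ?case by (simp add: out_coef_def if_distrib[of "\<lambda>x. _ * x"] mult.commute cong: if_cong)
next
  case (Cons j s)
  let ?e = "\<lambda>l k. if k = l then 1 else 0 :: real"
  let ?o = "\<lambda>k. out_coef S i r (word_op S s (?e k))"
  have e: "state_op S j (?e l) k = Acoef S j k l" if "l < sdim S" for l k
    using that by (simp add: state_op_def if_distrib[of "\<lambda>x. _ * x"] cong: if_cong)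
  have "out_coef S i r (word_op S (j # s) v) = (\<Sum>k<sdim S. state_op S j v k * ?o k)"
    using Cons[of "state_op S j v"] by simp
  also have "\<dots> = (\<Sum>k<sdim S. \<Sum>l<sdim S. v l * (Acoef S j k l * ?o k))"
    by (simp add: state_op_def sum_distrib_right mult_ac)
  also have "\<dots> = (\<Sum>l<sdim S. v l * (\<Sum>k<sdim S. Acoef S j k l * ?o k))"
    by (subst sum.swap) (simp add: sum_distrib_left)
  also have "\<dots> = (\<Sum>l<sdim S. v l * out_coef S i r (word_op S (j # s) (?e l)))"
    using Cons[of "state_op S j (?e l)" for l] by (intro sum.cong) (simp_all add: e)
  finally show ?case .
qed

section \<open>Column spaces of Hankel matrices\<close>

lemma col_rank_le:
  assumes "finite G" "range (\<lambda>c r. H r c) \<subseteq> span G"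
  shows "col_rank H \<le> enat (card G)"
proof -
  let ?V = "span (range (\<lambda>c r. H r c))"
  have sub: "?V \<subseteq> span G" using assms(2) by (simp add: span_minimal)
  obtain B where B: "B \<subseteq> ?V" "independent B" "?V \<subseteq> span B" "card B = dim ?V"
    using basis_exists by blast
  have "finite B" using independent_span_bound[OF assms(1) B(2)] B(1) sub by auto
  moreover have "?V = span B" using span_minimal[OF B(1) subspace_span] B(3) by (rule equalityI[rotated])
  \<comment> \<open>An explicit finite basis selects the finite branch of \<open>col_rank\<close>;
    only then may its value be compared by \<open>dim\<close>.\<close>
  ultimately have ex: "\<exists>B. finite B \<and> ?V = span B" by (intro exI[of _ B] conjI)
  have "dim ?V \<le> card G" using sub assms(1) by (rule dim_le_card)
  then show ?thesis unfolding col_rank_def Let_def if_P[OF ex] by simp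
qed

lemma col_rank_finite_basis:
  assumes "col_rank H = enat n"
  obtains b where "span (range (\<lambda>c r. H r c)) = span (b ` {..<n})"
proof -
  let ?V = "span (range (\<lambda>c r. H r c))"
  obtain G where G: "finite G" "?V = span G" and dim: "dim ?V = n"
    using assms unfolding col_rank_def Let_def by (auto split: if_splits)
  obtain B where B: "B \<subseteq> ?V" "independent B" "?V \<subseteq> span B" "card B = dim ?V"
    using basis_exists by blast
  have "finite B" using independent_span_bound[OF G(1) B(2)] B(1) G(2) by auto
  then obtain b where "bij_betw b {..<n} B"
    using B(4) dim ex_bij_betw_nat_finite[of B] by (metis atLeast0LessThan)
  then have "b ` {..<n} = B" by (simp add: bij_betw_def)
  moreover have "?V = span B" using span_minimal[OF B(1) subspace_span] B(3) by (rule equalityI[rotated])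
  ultimately show ?thesis using that[of b] by simp
qed

text \<open>The number of predecessors is strictly monotone for a total order, hence injective, so
  the definite description recovers each word from its own count. It follows that every word labels
  a block row and a block column of the Hankel matrix.\<close>

lemma surj_word_enum: "surj (word_enum :: nat \<Rightarrow> 'a::{finite, linorder} list)"
proof -
  let ?R = "lenlex {(a, b). a < (b :: 'a)}"
  define f where "f s = card {r. (r, s) \<in> ?R}" for s :: "'a list"
  have fin: "finite {r. (r, s) \<in> ?R}" for s :: "'a list"
    by (rule finite_subset[OF _ finite_words_le[of "length s"]]) (auto dest: lenlex_length)
  have tr: "trans {(a, b). a < (b :: 'a)}" by (auto simp: trans_def)
  have irr: "(s, s) \<notin> ?R" for s by (rule lenlex_irreflexive) auto
  have less: "f r < f s" if "(r, s) \<in> ?R" for r s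
    unfolding f_def
  proof (rule psubset_card_mono[OF fin])
    show "{t. (t, r) \<in> ?R} \<subset> {t. (t, s) \<in> ?R}"
      using that irr[of r] transD[OF lenlex_transI[OF tr]] by blast
  qed
  have "inj f"
  proof (rule injI)
    fix r s assume eq: "f r = f s"
    have "total ?R" by (rule total_lenlex) (auto simp: total_on_def)
    then have "r = s \<or> (r, s) \<in> ?R \<or> (s, r) \<in> ?R" by (auto simp: total_on_def)
    then show "r = s" using less eq by fastforce
  qed
  then have "word_enum (f s) = s" for s
    unfolding word_enum_def f_def[symmetric] by (auto simp: inj_eq)
  then show ?thesis by (metis surj_def)
qed

text \<open>The matrix factors through the state space: the column word produces a state
  \<open>?v\<close>, and the row words observe it. \<open>g k\<close> is the column of observations
  of the \<open>k\<close>-th unit vector, and the entries of \<open>?v\<close> are the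
  coefficients.\<close>

lemma col_rank_hankel_theta_of:
  fixes S :: "('p::{finite, linorder}, 'u::finite, 'y::finite) lpv_ssa"
  shows "col_rank (hankel (theta_of S x0)) \<le> enat (sdim S)"
proof -
  define g where "g k = (\<lambda>(i, r). out_coef S (fst r) (snd r) (word_op S (word_enum i) (\<lambda>l. if l = k then 1 else 0)))"
    for k :: nat
  have "col_rank (hankel (theta_of S x0)) \<le> enat (card (g ` {..<sdim S}))"
  proof (rule col_rank_le)
    show "range (\<lambda>c r. hankel (theta_of S x0) r c) \<subseteq> span (g ` {..<sdim S})"
    proof (rule image_subsetI)
      fix c :: "nat \<times> ('p option \<times> 'u) option"
      obtain j c' where c: "c = (j, c')" by fastforce
      let ?v = "word_op S (word_enum j) (start_vec S x0 c')"
      have "(\<lambda>r. hankel (theta_of S x0) r c) = (\<Sum>k<sdim S. ?v k *\<^sub>R g k)"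
        unfolding c hankel_def
        by (auto simp: fun_eq_iff sum_fun_apply theta_of_def word_op_append g_def out_coef_word_op_linear[of S _ _ _ ?v])
      then show "(\<lambda>r. hankel (theta_of S x0) r c) \<in> span (g ` {..<sdim S})"
        by (simp only:) (intro span_sum span_scale span_base imageI)
    qed
  qed simp
  also have "card (g ` {..<sdim S}) \<le> sdim S" using card_image_le[of "{..<sdim S}" g] by simp
  finally show ?thesis by simp
qed

lemma span_image_lessThan:
  assumes "f \<in> span (b ` {..<n :: nat})"
  shows "\<exists>a. f = (\<Sum>k<n. a k *\<^sub>R b k)"
  using assms
proof (induction rule: span_induct_alt)
  case base
  show ?case by (intro exI[of _ "\<lambda>_. 0"]) simp
next
  case (step c x y)
  then obtain a k where "y = (\<Sum>k<n. a k *\<^sub>R b k)" "x = b k" "k < n" by auto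
  then have "c *\<^sub>R x + y = (\<Sum>l<n. (a l + (if l = k then c else 0)) *\<^sub>R b l)"
    by (simp add: scaleR_add_left sum.distrib if_distrib[of "\<lambda>x. x *\<^sub>R _"] cong: if_cong)
  then show ?case by (intro exI[of _ "\<lambda>l. a l + (if l = k then c else 0)"])
qed

text \<open>The state space of the realization is the column space of the Hankel matrix, and the letter
  \<open>i\<close> acts by the shift that sends the column of the word \<open>w\<close> to the column of \<open>wi\<close>.\<close>

lemma hankel_realization:
  fixes \<theta> :: "'p option list \<Rightarrow> ('p::{finite, linorder}, 'u::finite, 'y::finite) theta_mat"
  assumes rank: "col_rank (hankel \<theta>) = enat n"
  obtains S x0 where "sdim S = n" "x0 \<in> state_space S" "theta_of S x0 = \<theta>"
proof -
  define idx :: "'p option list \<Rightarrow> nat" where "idx = inv word_enum"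
  have idx [simp]: "word_enum (idx w) = w" for w
    unfolding idx_def by (rule surj_f_inv_f[OF surj_word_enum])
  define col where "col w c = (\<lambda>r. hankel \<theta> r (idx w, c))" for w c
  have col: "col w c (i, r) = \<theta> (w @ word_enum i) $ r $ c" for w c i r
    by (simp add: col_def hankel_def)
  \<comment> \<open>Entries depend only on the concatenated word, so prefixing the row word by
    \<open>i\<close> has the same effect as appending \<open>i\<close> to the column word. Acting on
    rows makes the shift a well-defined linear map on all functions, with no choice of column
    representatives.\<close>
  define shift :: "'p option \<Rightarrow> (nat \<times> ('p option \<times> 'y) \<Rightarrow> real) \<Rightarrow> nat \<times> ('p option \<times> 'y) \<Rightarrow> real"
    where "shift i f = (\<lambda>(m, r). f (idx (i # word_enum m), r))" for i f
  let ?V = "span (range (\<lambda>c r. hankel \<theta> r c))"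
  obtain b where V: "?V = span (b ` {..<n})" using col_rank_finite_basis[OF rank] by blast
  have colV: "col w c \<in> ?V" for w c
    unfolding col_def by (intro span_base) auto
  have shift_sum: "shift i (\<Sum>k\<in>A. a k *\<^sub>R f k) = (\<Sum>k\<in>A. a k *\<^sub>R shift i (f k))" for i f a and A :: "nat set"
    by (auto simp: shift_def fun_eq_iff sum_fun_apply)
  have shiftV: "shift i f \<in> ?V" if "f \<in> ?V" for i f
    using that
  proof (induction rule: span_induct_alt)
    case base
    have "shift i 0 = 0" by (auto simp: shift_def fun_eq_iff)
    then show ?case by (simp only: span_zero)
  next
    case (step a x y)
    then obtain j c where x: "x = (\<lambda>r. hankel \<theta> r (j, c))" by auto
    have "shift i x = col (word_enum j @ [i]) c"
      by (auto simp: shift_def x fun_eq_iff hankel_def col)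
    moreover have "shift i (a *\<^sub>R x + y) = a *\<^sub>R shift i x + shift i y"
      by (auto simp: shift_def fun_eq_iff)
    ultimately show ?case by (simp only:) (intro span_add span_scale colV step)
  qed
  \<comment> \<open>\<open>crd\<close> is any choice of coordinates; all that is used is that they
    recombine to the given function.\<close>
  have "\<forall>f\<in>?V. \<exists>a. f = (\<Sum>k<n. a k *\<^sub>R b k)"
    unfolding V by (intro ballI span_image_lessThan)
  then have "\<exists>crd. \<forall>f\<in>?V. f = (\<Sum>k<n. crd f k *\<^sub>R b k)" by (rule bchoice)
  then obtain crd where "\<forall>f\<in>?V. f = (\<Sum>k<n. crd f k *\<^sub>R b k)" by (elim exE)
  then have crd: "f = (\<Sum>k<n. crd f k *\<^sub>R b k)" if "f \<in> ?V" for f using that by (rule bspec)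
  have bV: "b k \<in> ?V" if "k < n" for k
    unfolding V using that by (auto intro: span_base)
  \<comment> \<open>The state matrices are the shifts written in the family \<open>b\<close>, the
    input matrices and the initial state are coordinates of the columns of the empty word, and the
    output reads off the row of the empty word.\<close>
  define S :: "('p, 'u, 'y) lpv_ssa" where
    "S = LPV_SSA n (\<lambda>i k l. crd (shift i (b l)) k) (\<lambda>j k m. crd (col [] (Some (j, m))) k) (\<lambda>i r k. b k (idx [], (i, r)))"
  define x0 where "x0 = restrict (crd (col [] None)) {..<n}"
  have state: "(\<Sum>k<n. state_op S i a k *\<^sub>R b k) = shift i (\<Sum>k<n. a k *\<^sub>R b k)" for i a
  proof -
    have "(\<Sum>k<n. state_op S i a k *\<^sub>R b k) = (\<Sum>k<n. \<Sum>l<n. a l *\<^sub>R (crd (shift i (b l)) k *\<^sub>R b k))"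
      by (simp add: state_op_def S_def scaleR_sum_left mult.commute)
    also have "\<dots> = (\<Sum>l<n. a l *\<^sub>R (\<Sum>k<n. crd (shift i (b l)) k *\<^sub>R b k))"
      by (subst sum.swap) (simp add: scaleR_sum_right)
    also have "\<dots> = (\<Sum>l<n. a l *\<^sub>R shift i (b l))"
      using crd[OF shiftV[OF bV]] by (intro sum.cong) auto
    finally show ?thesis by (simp add: shift_sum)
  qed
  have word: "(\<Sum>k<n. word_op S s a k *\<^sub>R b k) (m, r) = (\<Sum>k<n. a k *\<^sub>R b k) (idx (s @ word_enum m), r)" for s a m r
  proof (induction s arbitrary: a)
    case Nil
    \<comment> \<open>Surjectivity of \<open>word_enum\<close> gives only a right inverse
      \<open>idx\<close>. Changing the row index is harmless here because elements of the column
      space depend on it only through its word.\<close>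
    have "b k (idx (word_enum m), r) = b k (m, r)" if "k < n" for k
      using bV[OF that]
    proof (induction rule: span_induct_alt)
      case (step c x y)
      then obtain c' where "x = (\<lambda>r. hankel \<theta> r c')" by auto
      then show ?case using step by (simp add: hankel_def split: prod.splits)
    qed simp
    then show ?case by (simp add: sum_fun_apply)
  next
    case (Cons i s)
    have "shift i f (idx (s @ word_enum m), r) = f (idx ((i # s) @ word_enum m), r)" for f
      by (simp add: shift_def)
    then show ?case unfolding word_op_simps Cons[of "state_op S i a"] state .
  qed
  have out: "out_coef S i r (word_op S s a) = col [] c (idx s, (i, r))"
    if "(\<Sum>k<n. a k *\<^sub>R b k) = col [] c" for i r s a c
  proof -
    have "out_coef S i r (word_op S s a) = (\<Sum>k<n. word_op S s a k *\<^sub>R b k) (idx [], (i, r))"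
      by (simp add: out_coef_def S_def sum_fun_apply mult.commute)
    then show ?thesis by (simp add: word that)
  qed
  have start: "(\<Sum>k<n. start_vec S x0 c k *\<^sub>R b k) = col [] c" for c
    using crd[OF colV[of "[]" c]]
    by (auto simp: start_vec_def x0_def input_vec_def S_def split: option.splits)
  have "theta_of S x0 = \<theta>"
    by (auto simp: theta_of_def fun_eq_iff vec_eq_iff out[OF start] col)
  moreover have "sdim S = n" by (simp add: S_def)
  moreover have "x0 \<in> state_space S" by (simp add: x0_def state_space_def S_def)
  ultimately show ?thesis using that by blast
qed

section \<open>Discrete time\<close>

lemma sched_combination_zero2:
  fixes P :: "(real^'p::finite) set"
  assumes P: "affine hull P = UNIV"
    and 0: "\<And>q q'. q \<in> P \<Longrightarrow> q' \<in> P \<Longrightarrow> (\<Sum>i\<in>UNIV. \<Sum>j\<in>UNIV. sched q i * sched q' j * a i j) = 0"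
  shows "a i j = 0"
proof (rule sched_combination_zero[OF P])
  fix q' assume "q' \<in> P"
  show "(\<Sum>j\<in>UNIV. sched q' j * a i j) = 0"
  proof (rule sched_combination_zero[OF P])
    fix q assume "q \<in> P"
    show "(\<Sum>i\<in>UNIV. sched q i * (\<Sum>j\<in>UNIV. sched q' j * a i j)) = 0"
      using 0[OF \<open>q \<in> P\<close> \<open>q' \<in> P\<close>] by (simp add: sum_distrib_left mult.assoc)
  qed
qed

lemma theta_of_nth:
  "theta_of S x0 s $ (i, r) $ None = out_coef S i r (word_op S s x0)"
  "theta_of S x0 s $ (i, r) $ Some (j, m) = out_coef S i r (word_op S s (input_vec S j m))"
  by (simp_all add: theta_of_def start_vec_def)

lemma state_op_cong: "(\<And>l. l < sdim S \<Longrightarrow> v l = w l) \<Longrightarrow> state_op S i v = state_op S i w"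
  by (simp add: state_op_def)

lemma out_coef_cong: "(\<And>l. l < sdim S \<Longrightarrow> v l = w l) \<Longrightarrow> out_coef S i r v = out_coef S i r w"
  by (simp add: out_coef_def)

lemma state_op_linear:
  "state_op S i (\<lambda>l. v l + w l) k = state_op S i v k + state_op S i w k"
  "state_op S i (\<lambda>l. a * v l) k = a * state_op S i v k"
  "state_op S i (\<lambda>l. \<Sum>x\<in>A. f x l) k = (\<Sum>x\<in>A. state_op S i (f x) k)"
  by (simp_all add: state_op_def sum.distrib sum_distrib_left algebra_simps) (subst sum.swap, rule refl)

lemma out_coef_linear:
  "out_coef S i r (\<lambda>l. v l + w l) = out_coef S i r v + out_coef S i r w"
  "out_coef S i r (\<lambda>l. a * v l) = a * out_coef S i r v"
  "out_coef S i r (\<lambda>l. \<Sum>x\<in>A. f x l) = (\<Sum>x\<in>A. out_coef S i r (f x))"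
  by (simp_all add: out_coef_def sum.distrib sum_distrib_left algebra_simps) (subst sum.swap, rule refl)

text \<open>The discrete series with exclusive end time: letters are read at times \<tau> to
  \<open>t - 1\<close>, so it matches \<open>dt_w\<close> at end time \<open>t - 1\<close>. For
  \<open>t = \<tau>\<close> only the empty word remains, in agreement with \<open>wseries\<close>
  over an interval of length zero.\<close>

definition dser :: "(nat \<Rightarrow> real^'p::finite) \<Rightarrow> ('p option list \<Rightarrow> real) \<Rightarrow> nat \<Rightarrow> nat \<Rightarrow> real"
  where "dser p c t \<tau> = (\<Sum>s | length s = t - \<tau>. c s * (\<Prod>k<t - \<tau>. sched (p (\<tau> + k)) (s ! k)))"

lemma finite_words_eq: "finite {s :: 'i::finite list. length s = n}"
  by (rule finite_subset[OF _ finite_words_le[of n]]) auto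

lemma infsum_dt_w:
  fixes f :: "'p::finite option list \<Rightarrow> 'a::real_normed_vector"
  assumes "\<tau> \<le> t"
  shows "(\<Sum>\<^sub>\<infinity>s. (a * dt_w s p (int t - 1) (int \<tau>)) *\<^sub>R f s)
    = (\<Sum>s | length s = t - \<tau>. (a * (\<Prod>k<t - \<tau>. sched (p (\<tau> + k)) (s ! k))) *\<^sub>R f s)"
proof -
  have w: "dt_w s p (int t - 1) (int \<tau>) = (if length s = t - \<tau> then \<Prod>k<t - \<tau>. sched (p (\<tau> + k)) (s ! k) else 0)" for s
    using assms by (auto simp: dt_w_def nat_add_distrib)
  have "(\<Sum>\<^sub>\<infinity>s. (a * dt_w s p (int t - 1) (int \<tau>)) *\<^sub>R f s)
     = (\<Sum>\<^sub>\<infinity>s\<in>{s. length s = t - \<tau>}. (a * dt_w s p (int t - 1) (int \<tau>)) *\<^sub>R f s)"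
    by (rule infsum_cong_neutral) (auto simp: w)
  then show ?thesis by (simp add: infsum_finite finite_words_eq w)
qed

lemma dt_g_nth: "dt_g \<theta> p t $ r = (\<Sum>i\<in>UNIV. sched (p t) i * dser p (\<lambda>s. \<theta> s $ (i, r) $ None) t 0)"
proof -
  note w = infsum_dt_w[of 0 t _ p, unfolded of_nat_0, OF le0]
  show ?thesis
    unfolding dt_g_def w by (simp add: dser_def eta_block_def sum_distrib_left mult_ac)
qed

lemma dt_h_nth:
  fixes \<theta> :: "'p option list \<Rightarrow> ('p::finite, 'u::finite, 'y::finite) theta_mat"
  assumes "d < t"
  shows "dt_h \<theta> p d t $ r $ m =
    (\<Sum>i\<in>UNIV. \<Sum>j\<in>UNIV. sched (p t) i * sched (p d) j * dser p (\<lambda>s. \<theta> s $ (i, r) $ Some (j, m)) t (Suc d))"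
proof -
  have w: "(\<Sum>\<^sub>\<infinity>s. (a * dt_w s p (int t - 1) (int d + 1)) *\<^sub>R f s)
    = (\<Sum>s | length s = t - Suc d. (a * (\<Prod>k<t - Suc d. sched (p (Suc d + k)) (s ! k))) *\<^sub>R f s)"
    for a and f :: "'p option list \<Rightarrow> real^'u^'y"
    using infsum_dt_w[of "Suc d" t a p f] assms by (simp add: add.commute)
  show ?thesis
    unfolding dt_h_def w by (simp add: dser_def theta_block_def sum_distrib_left mult_ac)
qed

lemma dser_refl: "dser p c t t = c []"
  by (simp add: dser_def)

text \<open>The discrete counterpart of \<open>wseries_snoc\<close>: the last letter is read at time
  \<open>t\<close> and all others earlier, so that \<open>p t\<close> can be varied on its
  own.\<close>

lemma dser_Suc:
  assumes "\<tau> \<le> t"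
  shows "dser p c (Suc t) \<tau> = (\<Sum>i\<in>UNIV. sched (p t) i * dser p (\<lambda>s. c (s @ [i])) t \<tau>)"
proof -
  let ?n = "t - \<tau>"
  let ?w = "\<lambda>n s. \<Prod>k<n. sched (p (\<tau> + k)) (s ! k)"
  let ?f = "\<lambda>(i, s). s @ [i :: 'a option]"
  have im: "{s. length s = Suc ?n} = ?f ` (UNIV \<times> {s. length s = ?n})"
    by (auto simp: length_Suc_conv_rev image_iff)
  have "dser p c (Suc t) \<tau> = sum (\<lambda>s. c s * ?w (Suc ?n) s) (?f ` (UNIV \<times> {s. length s = ?n}))"
    using assms by (simp add: dser_def Suc_diff_le im)
  also have "\<dots> = (\<Sum>(i, s)\<in>UNIV \<times> {s. length s = ?n}. c (s @ [i]) * ?w (Suc ?n) (s @ [i]))"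
    by (subst sum.reindex) (auto simp: inj_on_def intro!: sum.cong)
  also have "\<dots> = (\<Sum>(i, s)\<in>UNIV \<times> {s. length s = ?n}. sched (p t) i * (c (s @ [i]) * ?w ?n s))"
    using assms by (intro sum.cong) (auto simp: nth_append)
  also have "\<dots> = (\<Sum>i\<in>UNIV. \<Sum>s | length s = ?n. sched (p t) i * (c (s @ [i]) * ?w ?n s))"
    by (rule sum.cartesian_product[symmetric])
  finally show ?thesis by (simp add: dser_def sum_distrib_left)
qed

lemma dser_cong:
  assumes "\<And>k. \<tau> \<le> k \<Longrightarrow> k < t \<Longrightarrow> p k = p' k"
  shows "dser p c t \<tau> = dser p' c t \<tau>"
  unfolding dser_def using assms by (intro sum.cong arg_cong2[where f = "(*)"] prod.cong) auto

lemma dser_sum: "dser p (\<lambda>s. \<Sum>x\<in>A. a x * c x s) t \<tau> = (\<Sum>x\<in>A. a x * dser p (c x) t \<tau>)"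
  unfolding dser_def sum_distrib_left sum_distrib_right by (subst sum.swap) (simp add: mult.assoc)

lemma dser_diff: "dser p (\<lambda>s. c s - d s) t \<tau> = dser p c t \<tau> - dser p d t \<tau>"
  by (simp add: dser_def left_diff_distrib sum_subtractf)

lemma dser_word_op_Suc:
  assumes "\<tau> \<le> t"
  shows "dser p (\<lambda>s. word_op S s v k) (Suc t) \<tau> =
    (\<Sum>i\<in>UNIV. sched (p t) i * state_op S i (\<lambda>l. dser p (\<lambda>s. word_op S s v l) t \<tau>) k)"
  unfolding dser_Suc[OF assms] word_op_simps by (simp add: state_op_def dser_sum)

text \<open>Variation of constants. An input applied at \<open>d\<close> first appears in the state
  at \<open>Suc d\<close>, where its series starts. In the step, linearity advances all earlier
  responses, and the new summand \<open>d = t\<close> is a column of the input matrix, by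
  \<open>dser_refl\<close>.\<close>

lemma dt_state_eq:
  fixes S :: "('p::finite, 'u::finite, 'y::finite) lpv_ssa"
  assumes "k < sdim S"
  shows "dt_state S x0 u p t k = dser p (\<lambda>s. word_op S s x0 k) t 0 +
    (\<Sum>d<t. \<Sum>j\<in>UNIV. \<Sum>m\<in>UNIV. sched (p d) j * u d $ m * dser p (\<lambda>s. word_op S s (input_vec S j m) k) t (Suc d))"
  using assms
proof (induction t arbitrary: k)
  case 0
  then show ?case by (simp add: dser_refl)
next
  case (Suc t)
  let ?h = "\<lambda>d j m l. dser p (\<lambda>s. word_op S s (input_vec S j m) l) t (Suc d)"
  let ?z = "\<lambda>l. dser p (\<lambda>s. word_op S s x0 l) t 0 +
    (\<Sum>d<t. \<Sum>j\<in>UNIV. \<Sum>m\<in>UNIV. sched (p d) j * u d $ m * ?h d j m l)"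
  have "state_op S i (dt_state S x0 u p t) = state_op S i ?z" for i
    by (rule state_op_cong) (use Suc.IH in auto)
  then have "dt_state S x0 u p (Suc t) k = (\<Sum>i\<in>UNIV. sched (p t) i * state_op S i ?z k)
    + (\<Sum>j\<in>UNIV. \<Sum>m\<in>UNIV. sched (p t) j * u t $ m * input_vec S j m k)"
    using Suc.prems by (simp add: state_rhs_nth)
  also have "(\<Sum>i\<in>UNIV. sched (p t) i * state_op S i ?z k)
    = dser p (\<lambda>s. word_op S s x0 k) (Suc t) 0 + (\<Sum>i\<in>UNIV. \<Sum>d<t. \<Sum>j\<in>UNIV. \<Sum>m\<in>UNIV.
        sched (p d) j * u d $ m * (sched (p t) i * state_op S i (?h d j m) k))"
    by (simp add: state_op_linear dser_word_op_Suc distrib_left sum.distrib sum_distrib_left mult_ac)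
  also have "(\<Sum>i\<in>UNIV. \<Sum>d<t. \<Sum>j\<in>UNIV. \<Sum>m\<in>UNIV.
        sched (p d) j * u d $ m * (sched (p t) i * state_op S i (?h d j m) k))
     = (\<Sum>d<t. \<Sum>j\<in>UNIV. \<Sum>m\<in>UNIV. \<Sum>i\<in>UNIV.
        sched (p d) j * u d $ m * (sched (p t) i * state_op S i (?h d j m) k))"
    by (subst sum.swap, rule sum.cong[OF refl], subst sum.swap, rule sum.cong[OF refl], subst sum.swap, rule refl)
  also have "\<dots> = (\<Sum>d<t. \<Sum>j\<in>UNIV. \<Sum>m\<in>UNIV.
      sched (p d) j * u d $ m * dser p (\<lambda>s. word_op S s (input_vec S j m) k) (Suc t) (Suc d))"
    by (intro sum.cong refl) (simp add: dser_word_op_Suc sum_distrib_left)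
  finally show ?case by (simp add: dser_refl)
qed

lemma out_coef_dser: "out_coef S i r (\<lambda>l. dser p (\<lambda>s. word_op S s v l) t \<tau>) = dser p (\<lambda>s. out_coef S i r (word_op S s v)) t \<tau>"
  by (simp add: out_coef_def dser_sum)

lemma dt_is_iir_theta_of:
  fixes S :: "('p::finite, 'u::finite, 'y::finite) lpv_ssa"
  shows "dt_is_iir P (dt_output S x0) (theta_of S x0)"
  unfolding dt_is_iir_def
proof (intro conjI ballI allI growth_bounded_theta_of)
  fix u p t
  let ?g = "\<lambda>i r. dser p (\<lambda>s. out_coef S i r (word_op S s x0)) t 0"
  let ?h = "\<lambda>i r d j m. dser p (\<lambda>s. out_coef S i r (word_op S s (input_vec S j m))) t (Suc d)"
  show "dt_output S x0 (u, p) t = dt_g (theta_of S x0) p t + (\<Sum>d<t. dt_h (theta_of S x0) p d t *v u d)"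
    unfolding vec_eq_iff
  proof
    fix r
    let ?z = "\<lambda>l. dser p (\<lambda>s. word_op S s x0 l) t 0 +
      (\<Sum>d<t. \<Sum>j\<in>UNIV. \<Sum>m\<in>UNIV. sched (p d) j * u d $ m * dser p (\<lambda>s. word_op S s (input_vec S j m) l) t (Suc d))"
    have "out_coef S i r (dt_state S x0 u p t) = out_coef S i r ?z" for i
      by (rule out_coef_cong) (rule dt_state_eq)
    then have "dt_output S x0 (u, p) t $ r = (\<Sum>i\<in>UNIV. sched (p t) i * ?g i r)
       + (\<Sum>i\<in>UNIV. \<Sum>d<t. \<Sum>j\<in>UNIV. \<Sum>m\<in>UNIV. sched (p t) i * sched (p d) j * ?h i r d j m * u d $ m)"
      by (simp add: dt_output_def output_map_nth out_coef_linear out_coef_dser distrib_left sum.distrib sum_distrib_left mult_ac)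
    also have "(\<Sum>i\<in>UNIV. \<Sum>d<t. \<Sum>j\<in>UNIV. \<Sum>m\<in>UNIV. sched (p t) i * sched (p d) j * ?h i r d j m * u d $ m)
       = (\<Sum>d<t. \<Sum>m\<in>UNIV. \<Sum>i\<in>UNIV. \<Sum>j\<in>UNIV. sched (p t) i * sched (p d) j * ?h i r d j m * u d $ m)"
    proof (subst sum.swap, rule sum.cong[OF refl])
      fix d
      show "(\<Sum>i\<in>UNIV. \<Sum>j\<in>UNIV. \<Sum>m\<in>UNIV. sched (p t) i * sched (p d) j * ?h i r d j m * u d $ m)
         = (\<Sum>m\<in>UNIV. \<Sum>i\<in>UNIV. \<Sum>j\<in>UNIV. sched (p t) i * sched (p d) j * ?h i r d j m * u d $ m)"
        by (subst (2) sum.swap, rule sum.cong[OF refl], subst (2) sum.swap, rule refl)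
    qed
    also have "\<dots> = (\<Sum>d<t. (dt_h (theta_of S x0) p d t *v u d) $ r)"
      by (intro sum.cong refl) (simp add: matrix_vector_mult_def dt_h_nth theta_of_nth sum_distrib_right)
    finally show "dt_output S x0 (u, p) t $ r = (dt_g (theta_of S x0) p t + (\<Sum>d<t. dt_h (theta_of S x0) p d t *v u d)) $ r"
      by (simp add: dt_g_nth theta_of_nth)
  qed
qed

text \<open>Overwriting \<open>p\<close> at \<open>t\<close> leaves the series up to
  \<open>t\<close> unchanged, while the series up to \<open>Suc t\<close> acquires the chosen value
  as the factor of its last letter. Quantifying over all later end times makes the property stable
  under this stripping.\<close>

lemma dser_coefficients_vanish:
  fixes P :: "(real^'p::finite) set"
  assumes P: "affine hull P = UNIV"
    and 0: "\<And>p t. p \<in> dt_signals P \<Longrightarrow> \<tau> \<le> t \<Longrightarrow> dser p c t \<tau> = 0"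
  shows "c s = 0"
proof (rule word_coefficients_vanish[OF P, where V = "\<lambda>c. \<forall>p\<in>dt_signals P. \<forall>t\<ge>\<tau>. dser p c t \<tau> = 0"])
  show "\<forall>p\<in>dt_signals P. \<forall>t\<ge>\<tau>. dser p c t \<tau> = 0" using 0 by blast
next
  fix c assume V: "\<forall>p\<in>dt_signals P. \<forall>t\<ge>\<tau>. dser p c t \<tau> = 0"
  have "P \<noteq> {}" using P by auto
  then obtain q where "q \<in> P" by blast
  then have "(\<lambda>_. q) \<in> dt_signals P" by (simp add: dt_signals_def)
  then show "c [] = 0" using V dser_refl by (metis order_refl)
next
  fix c q assume V: "\<forall>p\<in>dt_signals P. \<forall>t\<ge>\<tau>. dser p c t \<tau> = 0" and q: "q \<in> P"
  show "\<forall>p\<in>dt_signals P. \<forall>t\<ge>\<tau>. dser p (\<lambda>s. \<Sum>i\<in>UNIV. sched q i * c (s @ [i])) t \<tau> = 0"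
  proof (intro ballI allI impI)
    fix p t assume p: "p \<in> dt_signals P" and t: "\<tau> \<le> t"
    have "dser p (\<lambda>s. \<Sum>i\<in>UNIV. sched q i * c (s @ [i])) t \<tau> = (\<Sum>i\<in>UNIV. sched q i * dser p (\<lambda>s. c (s @ [i])) t \<tau>)"
      by (rule dser_sum)
    also have "\<dots> = dser (p(t := q)) c (Suc t) \<tau>"
      unfolding dser_Suc[OF t] using dser_cong[of \<tau> t p "p(t := q)"] by simp
    also have "\<dots> = 0"
    proof -
      have "p(t := q) \<in> dt_signals P" using p q by (auto simp: dt_signals_def)
      then show ?thesis using V t by simp
    qed
    finally show "dser p (\<lambda>s. \<Sum>i\<in>UNIV. sched q i * c (s @ [i])) t \<tau> = 0" .
  qed
qed

text \<open>Zero input isolates \<open>dt_g\<close>, and an impulse at time 0 isolates the kernel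
  started there. The remaining factors involve \<open>p\<close> at the final time and at time 0,
  neither of which the series itself reads, so they can be separated by independent choices from
  \<open>P\<close>.\<close>

lemma dt_is_iir_unique:
  fixes P :: "(real^'p::finite) set"
    and \<theta> :: "'p option list \<Rightarrow> ('p, 'u::finite, 'y::finite) theta_mat"
  assumes P: "affine hull P = UNIV" and \<theta>: "dt_is_iir P F \<theta>" and \<theta>': "dt_is_iir P F \<theta>'"
  shows "\<theta> = \<theta>'"
proof -
  let ?d = "\<lambda>r c s. \<theta> s $ r $ c - \<theta>' s $ r $ c"
  have sig: "u \<in> dt_signals UNIV" for u :: "nat \<Rightarrow> real^'u" by (simp add: dt_signals_def)
  have eq: "dt_g \<theta> p t + (\<Sum>d<t. dt_h \<theta> p d t *v u d) = dt_g \<theta>' p t + (\<Sum>d<t. dt_h \<theta>' p d t *v u d)"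
    if "p \<in> dt_signals P" for p u t
  proof -
    have "F (u, p) t = dt_g \<eta> p t + (\<Sum>d<t. dt_h \<eta> p d t *v u d)" if "dt_is_iir P F \<eta>" for \<eta>
      using that sig[of u] \<open>p \<in> dt_signals P\<close> unfolding dt_is_iir_def by blast
    from this[OF \<theta>] this[OF \<theta>'] show ?thesis by (rule trans[OF sym])
  qed
  have g: "dt_g \<theta> p t = dt_g \<theta>' p t" if "p \<in> dt_signals P" for p t
    using eq[OF that, of t "\<lambda>_. 0"] by simp
  have upd: "p(t := q) \<in> dt_signals P" if "p \<in> dt_signals P" "q \<in> P" for p t q
    using that by (auto simp: dt_signals_def)
  have None: "?d (i, r) None s = 0" for i r s
  proof (rule dser_coefficients_vanish[OF P, where \<tau> = 0])
    fix p t assume p: "p \<in> dt_signals P"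
    show "dser p (?d (i, r) None) t 0 = 0"
    proof (rule sched_combination_zero[OF P])
      fix q assume q: "q \<in> P"
      have "(\<Sum>i\<in>UNIV. sched q i * dser p (?d (i, r) None) t 0)
          = (\<Sum>i\<in>UNIV. sched ((p(t := q)) t) i * dser (p(t := q)) (?d (i, r) None) t 0)"
        using dser_cong[of 0 t p "p(t := q)"] by simp
      also have "\<dots> = dt_g \<theta> (p(t := q)) t $ r - dt_g \<theta>' (p(t := q)) t $ r"
        unfolding dt_g_nth dser_diff by (simp add: right_diff_distrib sum_subtractf)
      finally show "(\<Sum>i\<in>UNIV. sched q i * dser p (?d (i, r) None) t 0) = 0"
        using g[OF upd[OF p q]] by simp
    qed
  qed
  have h: "dt_h \<theta> p 0 t $ r $ m = dt_h \<theta>' p 0 t $ r $ m" if p: "p \<in> dt_signals P" and t: "0 < t" for p t r m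
  proof -
    let ?u = "\<lambda>d. if d = 0 then axis m 1 else 0 :: real^'u"
    have "(\<Sum>d<t. dt_h \<theta> p d t *v ?u d) = dt_h \<theta> p 0 t *v axis m 1" for \<theta> :: "'p option list \<Rightarrow> ('p, 'u, 'y) theta_mat"
      using t by (simp add: if_distrib[of "\<lambda>x. _ *v x"] sum.delta cong: if_cong)
    then have "dt_h \<theta> p 0 t *v axis m 1 = dt_h \<theta>' p 0 t *v axis m 1"
      using eq[OF p, of t ?u] g[OF p] by simp
    then show ?thesis by (simp add: matrix_vector_mult_basis column_def vec_eq_iff)
  qed
  have Some: "?d (i, r) (Some (j, m)) s = 0" for i r j m s
  proof (rule dser_coefficients_vanish[OF P, where \<tau> = 1])
    fix p t assume p: "p \<in> dt_signals P" and t: "1 \<le> (t :: nat)"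
    show "dser p (?d (i, r) (Some (j, m))) t 1 = 0"
    proof (rule sched_combination_zero2[OF P])
      fix q q' assume q: "q \<in> P" "q' \<in> P"
      \<comment> \<open>Since \<open>1 \<le> t\<close>, the two updates concern different instants,
        and both lie outside the times 1 to \<open>t - 1\<close> read by the series.\<close>
      let ?p = "p(t := q, 0 := q')"
      have "(\<Sum>i\<in>UNIV. \<Sum>j\<in>UNIV. sched q i * sched q' j * dser p (?d (i, r) (Some (j, m))) t 1)
          = (\<Sum>i\<in>UNIV. \<Sum>j\<in>UNIV. sched (?p t) i * sched (?p 0) j * dser ?p (?d (i, r) (Some (j, m))) t (Suc 0))"
        using dser_cong[of 1 t p ?p] t by simp
      also have "\<dots> = dt_h \<theta> ?p 0 t $ r $ m - dt_h \<theta>' ?p 0 t $ r $ m"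
        using t by (subst (1 2) dt_h_nth) (simp_all add: dser_diff right_diff_distrib sum_subtractf)
      finally show "(\<Sum>i\<in>UNIV. \<Sum>j\<in>UNIV. sched q i * sched q' j * dser p (?d (i, r) (Some (j, m))) t 1) = 0"
        using h[OF upd[OF upd[OF p q(1)] q(2)]] t by simp
    qed
  qed
  have "\<theta> s $ r $ c = \<theta>' s $ r $ c" for s r c
    using None[of s "fst r" "snd r"] Some[of s "fst r" "snd r" "fst (the c)" "snd (the c)"] by (cases c) auto
  then show ?thesis by (simp add: fun_eq_iff vec_eq_iff)
qed

section \<open>Continuous time: realizations have impulse responses\<close>

abbreviation letter_of :: "(real \<Rightarrow> real^'p) \<Rightarrow> 'p option \<Rightarrow> real \<Rightarrow> real"
  where "letter_of p \<equiv> (\<lambda>i z. sched (p z) i)"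

lemma ct_signals_nth: "f \<in> ct_signals X \<Longrightarrow> loc_bdd_meas (\<lambda>t. f t $ k)"
  unfolding ct_signals_def
  by (auto intro: piecewise_continuous_loc_bdd_meas piecewise_continuous_vec_nth)

lemma loc_bdd_meas_sched: "p \<in> ct_signals X \<Longrightarrow> loc_bdd_meas (\<lambda>z. sched (p z) i)"
  by (cases i) (auto simp: sched_def intro: ct_signals_nth loc_bdd_meas_const)

lemma letters_letter_of: "p \<in> ct_signals X \<Longrightarrow> letters (letter_of p)"
  for p :: "real \<Rightarrow> real^'p::finite"
  by unfold_locales (rule loc_bdd_meas_sched)

section \<open>Components of the impulse response formula\<close>

lemma has_sum_vec:
  fixes f :: "'x \<Rightarrow> 'a::real_normed_vector^'n::finite"
  assumes "\<And>r. ((\<lambda>s. f s $ r) has_sum a $ r) A"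
  shows "(f has_sum a) A"
  using assms unfolding has_sum_def by (intro vec_tendstoI) (simp add: sum_component)

lemma has_integral_vec:
  fixes f :: "real \<Rightarrow> real^'n::finite"
  assumes "\<And>r. ((\<lambda>x. f x $ r) has_integral a $ r) A"
  shows "(f has_integral a) A"
  unfolding has_integral_componentwise_iff[of f]
  using assms by (auto simp: Basis_vec_def inner_axis)

lemma (in letters) has_sum_wseries:
  assumes c: "word_growth c" and "0 \<le> \<tau>" "\<tau> \<le> t"
  shows "((\<lambda>s. a * iter_int q (rev s) t \<tau> * c s) has_sum a * wseries q c t \<tau>) UNIV"
proof -
  have "((\<lambda>s. c s * iter_int q (rev s) t \<tau>) has_sum wseries q c t \<tau>) UNIV"
    using wseries_summable(1)[OF assms] unfolding wseries_def by simp
  then have "((\<lambda>s. a * (c s * iter_int q (rev s) t \<tau>)) has_sum a * wseries q c t \<tau>) UNIV"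
    by (rule has_sum_cmult_right)
  then show ?thesis by (simp add: mult_ac)
qed

lemma ct_g_nth:
  fixes p :: "real \<Rightarrow> real^'p::finite"
  assumes \<theta>: "growth_bounded \<theta>" and p: "p \<in> ct_signals X" and t: "0 \<le> t"
  shows "ct_g \<theta> p t $ r = (\<Sum>i\<in>UNIV. sched (p t) i * wseries (letter_of p) (\<lambda>s. \<theta> s $ (i, r) $ None) t 0)"
proof -
  interpret letters "letter_of p" using p by (rule letters_letter_of)
  have "(\<Sum>\<^sub>\<infinity>s. (sched (p t) i * ct_w s p t 0) *\<^sub>R eta_block (\<theta> s) i)
     = (\<chi> r. sched (p t) i * wseries (letter_of p) (\<lambda>s. \<theta> s $ (i, r) $ None) t 0)" for i
    by (intro infsumI has_sum_vec)
      (use \<theta> t in \<open>simp add: ct_w_conv_iter_int eta_block_def growth_bounded_iff has_sum_wseries\<close>)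
  then show ?thesis by (simp add: ct_g_def)
qed

lemma ct_h_nth:
  fixes p :: "real \<Rightarrow> real^'p::finite"
  assumes \<theta>: "growth_bounded \<theta>" and p: "p \<in> ct_signals X" and t: "0 \<le> z" "z \<le> t"
  shows "ct_h \<theta> p z t $ r $ m = (\<Sum>i\<in>UNIV. \<Sum>j\<in>UNIV. sched (p t) i * sched (p z) j *
    wseries (letter_of p) (\<lambda>s. \<theta> s $ (i, r) $ Some (j, m)) t z)"
proof -
  interpret letters "letter_of p" using p by (rule letters_letter_of)
  have "(\<Sum>\<^sub>\<infinity>s. (sched (p t) i * sched (p z) j * ct_w s p t z) *\<^sub>R theta_block (\<theta> s) i j)
     = (\<chi> r m. sched (p t) i * sched (p z) j * wseries (letter_of p) (\<lambda>s. \<theta> s $ (i, r) $ Some (j, m)) t z)" for i j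
    by (intro infsumI has_sum_vec)
      (use \<theta> t in \<open>simp add: ct_w_conv_iter_int theta_block_def growth_bounded_iff has_sum_wseries\<close>)
  then show ?thesis by (simp add: ct_h_def)
qed

lemma ct_h_has_integral:
  fixes p :: "real \<Rightarrow> real^'p::finite" and u :: "real \<Rightarrow> real^'u::finite"
    and \<theta> :: "'p option list \<Rightarrow> ('p, 'u, 'y::finite) theta_mat"
  assumes \<theta>: "growth_bounded \<theta>" and p: "p \<in> ct_signals X" and u: "u \<in> ct_signals Y" and t: "0 \<le> t"
  shows "((\<lambda>z. ct_h \<theta> p z t *v u z) has_integral (\<chi> r. \<Sum>i\<in>UNIV. \<Sum>j\<in>UNIV. \<Sum>m\<in>UNIV. sched (p t) i *
    integral {0..t} (\<lambda>z. sched (p z) j * u z $ m * wseries (letter_of p) (\<lambda>s. \<theta> s $ (i, r) $ Some (j, m)) t z))) {0..t}"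
proof (rule has_integral_vec)
  fix r
  interpret letters "letter_of p" using p by (rule letters_letter_of)
  let ?W = "\<lambda>i j m. wseries (letter_of p) (\<lambda>s. \<theta> s $ (i, r) $ Some (j, m)) t"
  have int: "(\<lambda>z. sched (p z) j * u z $ m * ?W i j m z) integrable_on {0..t}" for i j m
  proof -
    have "continuous_on {0..t} (?W i j m)"
      using \<theta> unfolding growth_bounded_iff by (intro wseries_start_continuous) blast
    then show ?thesis
      using integrable_mult_continuous(2)[OF loc_bdd_meas_mult[OF loc_bdd_meas_sched[OF p] ct_signals_nth[OF u]] _ order_refl t]
      by blast
  qed
  have "((\<lambda>z. \<Sum>i\<in>UNIV. \<Sum>j\<in>UNIV. \<Sum>m\<in>UNIV. sched (p t) i * (sched (p z) j * u z $ m * ?W i j m z)) has_integral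
    (\<Sum>i\<in>UNIV. \<Sum>j\<in>UNIV. \<Sum>m\<in>UNIV. sched (p t) i * integral {0..t} (\<lambda>z. sched (p z) j * u z $ m * ?W i j m z))) {0..t}"
    by (intro has_integral_sum finite has_integral_mult_right integrable_integral int)
  moreover have "(\<Sum>i\<in>UNIV. \<Sum>j\<in>UNIV. \<Sum>m\<in>UNIV. sched (p t) i * (sched (p z) j * u z $ m * ?W i j m z))
      = (ct_h \<theta> p z t *v u z) $ r" if "z \<in> {0..t}" for z
  proof -
    have "(ct_h \<theta> p z t *v u z) $ r
        = (\<Sum>m\<in>UNIV. \<Sum>i\<in>UNIV. \<Sum>j\<in>UNIV. sched (p t) i * (sched (p z) j * u z $ m * ?W i j m z))"
      using that by (simp add: matrix_vector_mult_def ct_h_nth[OF \<theta> p] sum_distrib_right sum_distrib_left mult_ac)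
    also have "\<dots> = (\<Sum>i\<in>UNIV. \<Sum>j\<in>UNIV. \<Sum>m\<in>UNIV. sched (p t) i * (sched (p z) j * u z $ m * ?W i j m z))"
      by (subst sum.swap, rule sum.cong[OF refl], rule sum.swap)
    finally show ?thesis by simp
  qed
  ultimately show "((\<lambda>z. (ct_h \<theta> p z t *v u z) $ r) has_integral (\<chi> r. \<Sum>i\<in>UNIV. \<Sum>j\<in>UNIV. \<Sum>m\<in>UNIV. sched (p t) i *
    integral {0..t} (\<lambda>z. sched (p z) j * u z $ m * wseries (letter_of p) (\<lambda>s. \<theta> s $ (i, r) $ Some (j, m)) t z)) $ r) {0..t}"
    unfolding vec_lambda_beta by (rule has_integral_eq[rotated])
qed

text \<open>State and input are generated by one word series over the extended alphabet that has an
  additional letter \<open>Inr (j, m)\<close> for each product of a scheduling component with an input component.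
  Such a letter injects a column of \<open>B\<close> if it comes first, and annihilates the state otherwise.\<close>

definition ext_letter :: "(real \<Rightarrow> real^'u) \<Rightarrow> (real \<Rightarrow> real^'p) \<Rightarrow> 'p option + 'p option \<times> 'u \<Rightarrow> real \<Rightarrow> real"
  where "ext_letter u p a z = (case a of Inl i \<Rightarrow> sched (p z) i | Inr (j, m) \<Rightarrow> sched (p z) j * u z $ m)"

definition hom_op ::
  "('p, 'u, 'y) lpv_ssa \<Rightarrow> ('p option + 'p option \<times> 'u) list \<Rightarrow> (nat \<Rightarrow> real) \<Rightarrow> nat \<Rightarrow> real"
  where "hom_op S s v = foldl (\<lambda>v a. case a of Inl i \<Rightarrow> state_op S i v | Inr _ \<Rightarrow> (\<lambda>_. 0)) v s"

definition inhom_op ::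
  "('p, 'u, 'y) lpv_ssa \<Rightarrow> ('p option + 'p option \<times> 'u) list \<Rightarrow> (nat \<Rightarrow> real) \<Rightarrow> nat \<Rightarrow> real"
  where "inhom_op S s v = (case s of Inr (j, m) # s' \<Rightarrow> hom_op S s' (input_vec S j m) | _ \<Rightarrow> hom_op S s v)"

lemma state_op_zero [simp]: "state_op S i (\<lambda>_. 0) = (\<lambda>_. 0)"
  by (simp add: state_op_def)

lemma hom_op_simps [simp]:
  "hom_op S [] v = v"
  "hom_op S (Inl i # s) v = hom_op S s (state_op S i v)"
  "hom_op S (Inr jm # s) v = hom_op S s (\<lambda>_. 0)"
  "hom_op S (s @ [Inl i]) v = state_op S i (hom_op S s v)"
  "hom_op S (s @ [Inr jm]) v = (\<lambda>_. 0)"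
  by (simp_all add: hom_op_def)

lemma hom_op_zero [simp]: "hom_op S s (\<lambda>_. 0) = (\<lambda>_. 0)"
proof (induction s)
  case (Cons a s)
  then show ?case by (cases a) simp_all
qed simp

lemma hom_op_map_Inl: "hom_op S (map Inl s) v = word_op S s v"
  by (induction s arbitrary: v) simp_all

lemma hom_op_not_map_Inl: "s \<notin> range (map Inl) \<Longrightarrow> hom_op S s v = (\<lambda>_. 0)"
proof (induction s arbitrary: v)
  case Nil
  have "[] = map Inl []" by simp
  then show ?case using Nil by (metis rangeI)
next
  case (Cons a s)
  show ?case
  proof (cases a)
    case (Inl i)
    have "s \<notin> range (map Inl)"
    proof
      assume "s \<in> range (map Inl)"
      then obtain s' where "s = map Inl s'" by blast
      then have "a # s = map Inl (i # s')" using Inl by simp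
      then have "a # s \<in> range (map Inl)" by (rule range_eqI)
      then show False using Cons.prems by contradiction
    qed
    then show ?thesis using Inl Cons.IH by simp
  qed simp
qed

lemma inhom_op_Nil: "inhom_op S [] v = v"
  by (simp add: inhom_op_def)

lemma inhom_op_Cons:
  "inhom_op S (Inl i # s) v = hom_op S s (state_op S i v)"
  "inhom_op S (Inr (j, m) # s) v = hom_op S s (input_vec S j m)"
  by (simp_all add: inhom_op_def)

lemma inhom_op_snoc:
  "inhom_op S (s @ [Inl i]) v = state_op S i (inhom_op S s v)"
  "inhom_op S (s @ [Inr (j, m)]) v = (if s = [] then input_vec S j m else (\<lambda>_. 0))"
proof -
  show "inhom_op S (s @ [Inl i]) v = state_op S i (inhom_op S s v)"
  proof (cases s)
    case (Cons a s')
    then show ?thesis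
      by (cases a) (auto simp: inhom_op_Cons hom_op_simps(4)[of S s'])
  qed (simp add: inhom_op_def)
  show "inhom_op S (s @ [Inr (j, m)]) v = (if s = [] then input_vec S j m else (\<lambda>_. 0))"
  proof (cases s)
    case (Cons a s')
    then show ?thesis
      by (cases a) (auto simp: inhom_op_Cons hom_op_simps(5)[of S s'])
  qed (simp add: inhom_op_def)
qed

lemma word_growth_hom_op:
  fixes S :: "('p::finite, 'u, 'y) lpv_ssa"
  assumes "k < sdim S"
  shows "word_growth (\<lambda>s. hom_op S s v k)"
proof -
  obtain K R where KR: "K > 0" "R > 0" "\<And>s. \<bar>word_op S s v k\<bar> \<le> K * R ^ length s"
    using word_growth_word_op[OF assms, of v] unfolding word_growth_def by blast
  have "\<bar>hom_op S s v k\<bar> \<le> K * R ^ length s" for s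
  proof (cases "s \<in> range (map Inl)")
    case True
    then obtain s' where "s = map Inl s'" by blast
    then show ?thesis using KR(3)[of s'] by (simp add: hom_op_map_Inl)
  qed (use KR in \<open>simp add: hom_op_not_map_Inl\<close>)
  then show ?thesis by (rule word_growthI)
qed

lemma word_growth_abs: "word_growth c \<Longrightarrow> word_growth (\<lambda>s. \<bar>c s\<bar>)"
  by (simp add: word_growth_def)

lemma word_growth_tl:
  assumes "word_growth c"
  shows "word_growth (\<lambda>s. c (tl s))"
proof -
  obtain K R where KR: "K > 0" "R > 0" "\<And>s. \<bar>c s\<bar> \<le> K * R ^ length s"
    using assms unfolding word_growth_def by blast
  have "\<bar>c (tl s)\<bar> \<le> K * (R + 1) ^ length s" for s
  proof -
    have "\<bar>c (tl s)\<bar> \<le> K * R ^ (length s - 1)" using KR(3)[of "tl s"] by simp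
    also have "\<dots> \<le> K * (R + 1) ^ (length s - 1)" using KR by (intro mult_left_mono power_mono) auto
    also have "\<dots> \<le> K * (R + 1) ^ length s" using KR by (intro mult_left_mono power_increasing) auto
    finally show ?thesis .
  qed
  then show ?thesis by (rule word_growthI)
qed

text \<open>On every word \<open>inhom_op\<close> is one of finitely many homogeneous evolutions, of
  the word from \<open>v\<close> or of its tail from an input column; the sum of their absolute
  values dominates it.\<close>

lemma word_growth_inhom_op:
  fixes S :: "('p::finite, 'u::finite, 'y) lpv_ssa"
  assumes "k < sdim S"
  shows "word_growth (\<lambda>s. inhom_op S s v k)"
proof -
  let ?t = "\<lambda>s. \<Sum>jm\<in>UNIV. \<bar>hom_op S (tl s) (input_vec S (fst jm) (snd jm)) k\<bar>"
  have "word_growth (\<lambda>s. \<bar>hom_op S s v k\<bar> + ?t s)"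
    by (intro word_growth_add word_growth_sum word_growth_abs word_growth_tl word_growth_hom_op assms)
  then obtain K R where KR: "K > 0" "R > 0" "\<And>s. \<bar>\<bar>hom_op S s v k\<bar> + ?t s\<bar> \<le> K * R ^ length s"
    unfolding word_growth_def by blast
  have "\<bar>inhom_op S s v k\<bar> \<le> \<bar>hom_op S s v k\<bar> + ?t s" for s
  proof -
    have t0: "?t s \<ge> 0" by (intro sum_nonneg) simp
    show ?thesis
    proof (cases s)
      case Nil
      then show ?thesis using t0 by (simp add: inhom_op_Nil)
    next
      case (Cons a s')
      show ?thesis
      proof (cases a)
        case (Inl i)
        then show ?thesis using t0 Cons by (simp add: inhom_op_Cons)
      next
        case (Inr jm)
        have "\<bar>hom_op S s' (input_vec S (fst jm) (snd jm)) k\<bar> \<le> ?t s"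
          using member_le_sum[of jm UNIV "\<lambda>jm. \<bar>hom_op S (tl s) (input_vec S (fst jm) (snd jm)) k\<bar>"] Cons by simp
        moreover have "inhom_op S s v = hom_op S s' (input_vec S (fst jm) (snd jm))"
          using Inr Cons inhom_op_Cons(2)[of S "fst jm" "snd jm" s' v] by simp
        ultimately show ?thesis by simp
      qed
    qed
  qed
  then have "\<bar>inhom_op S s v k\<bar> \<le> K * R ^ length s" for s
    using KR(3)[of s] by (meson abs_ge_self order_trans)
  then show ?thesis by (rule word_growthI)
qed

lemma letters_ext_letter:
  fixes p :: "real \<Rightarrow> real^'p::finite" and u :: "real \<Rightarrow> real^'u::finite"
  assumes "p \<in> ct_signals X" "u \<in> ct_signals Y"
  shows "letters (ext_letter u p)"
proof
  fix a
  show "loc_bdd_meas (ext_letter u p a)"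
    unfolding ext_letter_def
    by (cases a) (auto intro!: loc_bdd_meas_mult loc_bdd_meas_sched[OF assms(1)] ct_signals_nth[OF assms(2)])
qed

lemma sum_ext_alphabet:
  fixes f :: "'a::finite + 'b::finite \<times> 'c::finite \<Rightarrow> real"
  shows "sum f UNIV = (\<Sum>i\<in>UNIV. f (Inl i)) + (\<Sum>j\<in>UNIV. \<Sum>m\<in>UNIV. f (Inr (j, m)))"
proof -
  have "sum f UNIV = sum f (UNIV <+> UNIV)" by simp
  also have "\<dots> = sum (f \<circ> Inl) UNIV + sum (f \<circ> Inr) UNIV" by (rule sum.Plus) auto
  also have "sum (f \<circ> Inr) UNIV = (\<Sum>(j, m)\<in>UNIV \<times> UNIV. f (Inr (j, m)))"
    by (rule sum.cong) auto
  also have "\<dots> = (\<Sum>j\<in>UNIV. \<Sum>m\<in>UNIV. f (Inr (j, m)))"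
    by (rule sum.cartesian_product[symmetric])
  finally show ?thesis by simp
qed

lemma wseries_only_Nil: "wseries q (\<lambda>s. if s = [] then a else 0) t \<tau> = a"
proof -
  have "wseries q (\<lambda>s. if s = [] then a else 0) t \<tau> = (\<Sum>\<^sub>\<infinity>s\<in>{[]}. a * iter_int q (rev s) t \<tau>)"
    unfolding wseries_def by (rule infsum_cong_neutral) auto
  then show ?thesis by simp
qed

text \<open>A word containing an input letter has coefficient 0, so the sum runs over words of
  scheduling letters alone and the input disappears from the series.\<close>

lemma wseries_hom_op:
  "wseries (ext_letter u p) (\<lambda>s. hom_op S s v k) t \<tau> = wseries (letter_of p) (\<lambda>s. word_op S s v k) t \<tau>"
proof -
  have l: "(\<lambda>i. ext_letter u p (Inl i)) = letter_of p"
    by (simp add: ext_letter_def fun_eq_iff)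
  have "wseries (ext_letter u p) (\<lambda>s. hom_op S s v k) t \<tau>
      = (\<Sum>\<^sub>\<infinity>s\<in>range (map Inl). hom_op S s v k * iter_int (ext_letter u p) (rev s) t \<tau>)"
    unfolding wseries_def by (rule infsum_cong_neutral) (auto simp: hom_op_not_map_Inl)
  also have "\<dots> = (\<Sum>\<^sub>\<infinity>s. hom_op S (map Inl s) v k * iter_int (ext_letter u p) (rev (map Inl s)) t \<tau>)"
    by (subst infsum_reindex) (auto simp: comp_def intro!: inj_mapI)
  also have "\<dots> = wseries (letter_of p) (\<lambda>s. word_op S s v k) t \<tau>"
    unfolding wseries_def by (simp add: hom_op_map_Inl rev_map iter_int_map l)
  finally show ?thesis .
qed

definition ct_sol ::
  "('p::finite, 'u::finite, 'y) lpv_ssa \<Rightarrow> (nat \<Rightarrow> real) \<Rightarrow> (real \<Rightarrow> real^'u) \<Rightarrow> (real \<Rightarrow> real^'p) \<Rightarrow> real \<Rightarrow> nat \<Rightarrow> real"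
  where "ct_sol S x0 u p t k = wseries (ext_letter u p) (\<lambda>s. inhom_op S s x0 k) t 0"

lemma loc_bdd_meas_state_rhs:
  fixes S :: "('p::finite, 'u::finite, 'y) lpv_ssa"
  assumes p: "p \<in> ct_signals X" and u: "u \<in> ct_signals Y" and k: "k < sdim S"
    and x: "\<And>l. l < sdim S \<Longrightarrow> continuous_on {0..} (\<lambda>t. x t l)"
  shows "loc_bdd_meas (\<lambda>z. state_rhs S (p z) (x z) (u z) k)"
  unfolding state_rhs_nth[OF k] state_op_def
  by (intro loc_bdd_meas_add loc_bdd_meas_sum loc_bdd_meas_mult loc_bdd_meas_const
      loc_bdd_meas_sched[OF p] ct_signals_nth[OF u] loc_bdd_meas_continuous x) auto

lemma ct_sol_continuous:
  fixes S :: "('p::finite, 'u::finite, 'y) lpv_ssa"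
  assumes p: "p \<in> ct_signals X" and u: "u \<in> ct_signals Y" and k: "k < sdim S"
  shows "continuous_on {0..} (\<lambda>t. ct_sol S x0 u p t k)"
proof -
  interpret letters "ext_letter u p" using p u by (rule letters_ext_letter)
  show ?thesis unfolding ct_sol_def
    by (intro continuous_on_Ici wseries_end_continuous word_growth_inhom_op k) simp
qed

text \<open>A scheduling letter in last position applies a state matrix to the remaining series. An
  input letter in last position has a nonzero coefficient only if it is the whole word, and
  therefore contributes exactly the input term of the state equation.\<close>

lemma ct_sol_integral:
  fixes S :: "('p::finite, 'u::finite, 'y) lpv_ssa"
  assumes p: "p \<in> ct_signals X" and u: "u \<in> ct_signals Y" and k: "k < sdim S" and t: "0 \<le> t"
  shows "ct_sol S x0 u p t k = x0 k + integral {0..t} (\<lambda>z. state_rhs S (p z) (ct_sol S x0 u p z) (u z) k)"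
proof -
  interpret letters "ext_letter u p" using p u by (rule letters_ext_letter)
  note gr = word_growth_inhom_op[OF k, of x0]
  let ?f = "\<lambda>a z. ext_letter u p a z * wseries (ext_letter u p) (\<lambda>s. inhom_op S (s @ [a]) x0 k) z 0"
  have "ct_sol S x0 u p t k = x0 k + (\<Sum>a\<in>UNIV. integral {0..t} (?f a))"
    unfolding ct_sol_def using wseries_snoc(2)[OF gr order_refl t] by (simp add: inhom_op_Nil)
  also have "(\<Sum>a\<in>UNIV. integral {0..t} (?f a)) = integral {0..t} (\<lambda>z. \<Sum>a\<in>UNIV. ?f a z)"
    by (intro integral_sum[symmetric] wseries_snoc(1)[OF gr order_refl t]) simp
  also have "\<dots> = integral {0..t} (\<lambda>z. state_rhs S (p z) (ct_sol S x0 u p z) (u z) k)"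
  proof (rule Henstock_Kurzweil_Integration.integral_cong)
    fix z assume "z \<in> {0..t}"
    then have d: "0 \<le> z" by simp
    have "wseries (ext_letter u p) (\<lambda>s. state_op S i (inhom_op S s x0) k) z 0 = state_op S i (ct_sol S x0 u p z) k" for i
      unfolding state_op_def ct_sol_def using d by (intro wseries_sum word_growth_inhom_op) auto
    then show "(\<Sum>a\<in>UNIV. ?f a z) = state_rhs S (p z) (ct_sol S x0 u p z) (u z) k"
      unfolding sum_ext_alphabet state_rhs_nth[OF k]
      by (simp add: inhom_op_snoc ext_letter_def if_distrib[of "\<lambda>f. f k"] wseries_only_Nil cong: if_cong)
  qed
  finally show ?thesis .
qed

text \<open>An input letter in first position starts a homogeneous evolution from an input column at
  that instant, which is the convolution kernel. This gives the variation of constants formula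
  without inverting a transition matrix.\<close>

lemma ct_sol_io:
  fixes S :: "('p::finite, 'u::finite, 'y) lpv_ssa"
  assumes p: "p \<in> ct_signals X" and u: "u \<in> ct_signals Y" and k: "k < sdim S" and t: "0 \<le> t"
  shows "ct_sol S x0 u p t k = wseries (letter_of p) (\<lambda>s. word_op S s x0 k) t 0 +
    (\<Sum>j\<in>UNIV. \<Sum>m\<in>UNIV. integral {0..t} (\<lambda>z. sched (p z) j * u z $ m *
       wseries (letter_of p) (\<lambda>s. word_op S s (input_vec S j m) k) t z))"
proof -
  interpret letters "ext_letter u p" using p u by (rule letters_ext_letter)
  \<comment> \<open>The terms with a scheduling letter in first position. They occur identically in
    the expansions of the homogeneous series and of the solution, so comparing the two recombines
    them with \<open>x0\<close> into the free response.\<close>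
  let ?H = "\<Sum>i\<in>UNIV. integral {0..t} (\<lambda>z. sched (p z) i * wseries (ext_letter u p) (\<lambda>s. hom_op S s (state_op S i x0) k) t z)"
  have zero: "wseries (ext_letter u p) (\<lambda>s. 0) t z = 0" for z
    by (simp add: wseries_def)
  have "wseries (ext_letter u p) (\<lambda>s. hom_op S s x0 k) t 0 = x0 k + ?H"
    using wseries_cons(2)[OF word_growth_hom_op[OF k, of x0] order_refl t]
    by (simp add: sum_ext_alphabet ext_letter_def zero)
  moreover have "ct_sol S x0 u p t k = x0 k + (?H + (\<Sum>j\<in>UNIV. \<Sum>m\<in>UNIV. integral {0..t} (\<lambda>z. sched (p z) j * u z $ m *
       wseries (ext_letter u p) (\<lambda>s. hom_op S s (input_vec S j m) k) t z)))"
    unfolding ct_sol_def using wseries_cons(2)[OF word_growth_inhom_op[OF k, of x0] order_refl t]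
    by (simp add: sum_ext_alphabet ext_letter_def inhom_op_Nil inhom_op_Cons)
  ultimately show ?thesis by (simp add: wseries_hom_op)
qed

section \<open>Existence of state trajectories\<close>

lemma negligible_discontinuities:
  assumes "piecewise_continuous f"
  shows "negligible {t. 0 \<le> t \<and> \<not> continuous (at t within {0..}) f}"
proof -
  have "{t. 0 \<le> t \<and> \<not> continuous (at t within {0..}) f}
      = (\<Union>n. {t \<in> {0..real n}. \<not> continuous (at t within {0..}) f})"
    using real_arch_simple by fastforce
  moreover have "negligible {t \<in> {0..real n}. \<not> continuous (at t within {0..}) f}" for n
    using assms unfolding piecewise_continuous_def by (intro negligible_finite) blast
  ultimately show ?thesis
    by (simp only:) (rule negligible_countable_Union; auto)
qed

text \<open>The integral equation has a locally bounded integrand, so the solution is Lipschitz on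
  compact intervals. Where both signals are continuous the integrand is continuous too and the
  integral can be differentiated; the remaining times form a null set.\<close>

lemma ct_is_trajectory_ct_sol:
  fixes S :: "('p::finite, 'u::finite, 'y) lpv_ssa"
  assumes p: "p \<in> ct_signals X" and u: "u \<in> ct_signals Y" and x0: "x0 \<in> state_space S"
  shows "ct_is_trajectory S x0 u p (\<lambda>t\<in>{0..}. \<lambda>k\<in>{..<sdim S}. ct_sol S x0 u p t k)" (is "ct_is_trajectory _ _ _ _ ?x")
  unfolding ct_is_trajectory_def
proof (intro conjI allI impI)
  show "?x \<in> {0..} \<rightarrow>\<^sub>E state_space S" by (auto simp: state_space_def)
  have "ct_sol S x0 u p 0 k = x0 k" for k by (simp add: ct_sol_def wseries_refl inhom_op_Nil)
  then show "?x 0 = x0" using x0 by (auto simp: state_space_def restrict_def fun_eq_iff PiE_def extensional_def)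
  let ?r = "\<lambda>k z. state_rhs S (p z) (ct_sol S x0 u p z) (u z) k"
  have lbm: "loc_bdd_meas (?r k)" if "k < sdim S" for k
    using that by (intro loc_bdd_meas_state_rhs[OF p u] ct_sol_continuous[OF p u])
  have x: "?x t k = x0 k + integral {0..t} (?r k)" if "0 \<le> t" "k < sdim S" for t k
    using ct_sol_integral[OF p u that(2,1)] that by simp
  show "absolutely_continuous_on {0..T} (\<lambda>t. ?x t k)" if kT: "k < sdim S" "0 \<le> T" for k T
  proof -
    obtain B where B: "B \<ge> 0" "\<And>t. t \<in> {0..T} \<Longrightarrow> \<bar>?r k t\<bar> \<le> B"
      using loc_bdd_meas_bound[OF lbm[OF kT(1)]] by metis
    show ?thesis
    proof (rule lipschitz_imp_absolutely_continuous[OF _ B(1)])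
      fix s t assume st: "s \<in> {0..T}" "t \<in> {0..T}" "s \<le> t"
      then show "\<bar>?x t k - ?x s k\<bar> \<le> B * (t - s)"
        using loc_bdd_meas_integral_lipschitz[OF lbm[OF kT(1)] order_refl, of s t T B] B(2)
        by (simp only: x[OF _ kT(1)] atLeastAtMost_iff) simp
    qed
  qed
  define N where "N = {t. 0 \<le> t \<and> \<not> continuous (at t within {0..}) p} \<union> {t. 0 \<le> t \<and> \<not> continuous (at t within {0..}) u}"
  have "negligible N"
    using p u unfolding N_def ct_signals_def by (auto intro: negligible_Un negligible_discontinuities)
  then have "AE t in lebesgue. t \<notin> N" by (intro AE_not_in) (simp add: negligible_iff_null_sets)
  then show "AE t in lebesgue. t \<ge> 0 \<longrightarrow> (\<forall>k<sdim S.
       ((\<lambda>\<tau>. ?x \<tau> k) has_real_derivative state_rhs S (p t) (?x t) (u t) k) (at t within {0..}))"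
  proof eventually_elim
    case (elim t)
    show ?case
    proof (intro impI allI)
      fix k assume t: "0 \<le> t" and k: "k < sdim S"
      \<comment> \<open>Differentiation of an integral is available on compact intervals; enlarging
        past \<open>t\<close> keeps the same local filter.\<close>
      have w: "at t within {0..t+1} = at t within {0..}"
        by (rule at_within_nhd[of _ "{..<t+1}"]) auto
      have pu: "continuous (at t within {0..}) p" "continuous (at t within {0..}) u"
        using elim t by (auto simp: N_def)
      have xl: "continuous (at t within {0..}) (\<lambda>z. ct_sol S x0 u p z l)" if "l < sdim S" for l
        using ct_sol_continuous[OF p u that] t by (simp add: continuous_on_eq_continuous_within)
      have sc: "continuous (at t within {0..}) (\<lambda>z. sched (p z) i)" for i
        using pu(1) by (cases i) (auto simp: sched_def intro: continuous_intros)
      have um: "continuous (at t within {0..}) (\<lambda>z. u z $ m)" for m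
        using pu(2) by (intro continuous_intros)
      have "continuous (at t within {0..}) (?r k)"
        unfolding state_rhs_nth[OF k] state_op_def
        by (intro continuous_add continuous_sum continuous_mult continuous_const sc xl um) auto
      then have "continuous (at t within {0..t+1}) (?r k)" by (simp add: w)
      then have "((\<lambda>\<tau>. integral {0..\<tau>} (?r k)) has_vector_derivative ?r k t) (at t within {0..t+1})"
        using integral_has_vector_derivative_continuous_at[of "?r k" 0 "t + 1" t "{}"] t
          loc_bdd_meas_integrable[OF lbm[OF k]] by simp
      then have "((\<lambda>\<tau>. x0 k + integral {0..\<tau>} (?r k)) has_real_derivative ?r k t) (at t within {0..})"
        unfolding has_real_derivative_iff_has_vector_derivative w
        by (auto intro!: derivative_eq_intros)
      then have "((\<lambda>\<tau>. ?x \<tau> k) has_real_derivative ?r k t) (at t within {0..})"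
        by (rule has_field_derivative_transform_within[where d = 1]) (use t x[OF _ k] in auto)
      moreover have "?r k t = state_rhs S (p t) (?x t) (u t) k"
        using t by (simp add: state_rhs_def)
      ultimately show "((\<lambda>\<tau>. ?x \<tau> k) has_real_derivative state_rhs S (p t) (?x t) (u t) k) (at t within {0..})"
        by simp
    qed
  qed
qed

section \<open>Uniqueness of state trajectories\<close>

lemma ct_is_trajectory_has_integral:
  assumes x: "ct_is_trajectory S x0 u p x" and k: "k < sdim S" and t: "0 \<le> t"
  shows "((\<lambda>z. state_rhs S (p z) (x z) (u z) k) has_integral (x t k - x0 k)) {0..t}"
proof -
  let ?P = "\<lambda>t. t \<ge> 0 \<longrightarrow> (\<forall>k<sdim S.
       ((\<lambda>\<tau>. x \<tau> k) has_real_derivative state_rhs S (p t) (x t) (u t) k) (at t within {0..}))"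
  have "AE t in lebesgue. ?P t" using x by (simp add: ct_is_trajectory_def)
  then obtain N where N: "\<And>t. t \<in> space lebesgue - N \<Longrightarrow> ?P t" "N \<in> null_sets lebesgue"
    by (rule AE_E3) blast
  have "((\<lambda>z. state_rhs S (p z) (x z) (u z) k) has_integral (x t k - x 0 k)) {0..t}"
  proof (rule absolutely_continuous_imp_has_integral[OF t])
    show "absolutely_continuous_on {0..t} (\<lambda>t. x t k)" using x k t by (simp add: ct_is_trajectory_def)
    show "negligible N" using N by (simp add: negligible_iff_null_sets)
    fix s assume s: "s \<in> {0..t} - N"
    then have "?P s" by (intro N(1)) simp
    then have "((\<lambda>\<tau>. x \<tau> k) has_real_derivative state_rhs S (p s) (x s) (u s) k) (at s within {0..})"
      using s k by simp
    then show "((\<lambda>\<tau>. x \<tau> k) has_real_derivative state_rhs S (p s) (x s) (u s) k) (at s within {0..t})"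
      by (rule DERIV_subset) auto
  qed
  moreover have "x 0 = x0" using x by (simp add: ct_is_trajectory_def)
  ultimately show ?thesis by simp
qed

text \<open>The input terms cancel in the difference of two trajectories, so its l1 norm
  \<open>f\<close> is bounded by a multiple of its own integral and Gronwall's inequality applies.
  Extensionality settles the arguments outside the half line and the state indices.\<close>

lemma ct_is_trajectory_unique:
  fixes S :: "('p::finite, 'u::finite, 'y) lpv_ssa"
  assumes p: "p \<in> ct_signals X"
    and x: "ct_is_trajectory S x0 u p x" and y: "ct_is_trajectory S x0 u p y"
  shows "x = y"
proof -
  define d where "d k t = x t k - y t k" for k t
  define f where "f t = (\<Sum>k<sdim S. \<bar>d k t\<bar>)" for t
  have eq: "d k T = 0" if k: "k < sdim S" and T: "0 \<le> T" for k T
  proof -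
    have dc: "continuous_on {0..T} (d k)" if "k < sdim S" for k
      unfolding d_def using x y that T
      by (intro continuous_intros absolutely_continuous_imp_continuous) (auto simp: ct_is_trajectory_def)
    have fc: "continuous_on {0..T} f"
      unfolding f_def by (intro continuous_intros dc) auto
    interpret letters "letter_of p" using p by (rule letters_letter_of)
    obtain M where M: "M \<ge> 0" "\<And>i s. s \<in> {0..T} \<Longrightarrow> \<bar>sched (p s) i\<bar> \<le> M"
      using letter_bound by blast
    \<comment> \<open>A bound, on \<open>{0..T}\<close>, for the absolute row sum of row
      \<open>k\<close> of the scheduled state matrix.\<close>
    define C where "C k = (\<Sum>i\<in>UNIV. M * (\<Sum>l<sdim S. \<bar>Acoef S i k l\<bar>))" for k
    have C0: "C k \<ge> 0" for k unfolding C_def using M by (intro sum_nonneg mult_nonneg_nonneg) auto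
    have dk: "\<bar>d k t\<bar> \<le> C k * integral {0..t} f" if k: "k < sdim S" and t: "t \<in> {0..T}" for k t
    proof -
      have fint: "f integrable_on {0..t}"
        by (rule integrable_continuous_real, rule continuous_on_subset[OF fc]) (use t in auto)
      have "((\<lambda>z. state_rhs S (p z) (x z) (u z) k - state_rhs S (p z) (y z) (u z) k) has_integral
          (x t k - x0 k) - (y t k - x0 k)) {0..t}"
        using t by (intro has_integral_diff ct_is_trajectory_has_integral[OF x k] ct_is_trajectory_has_integral[OF y k]) auto
      moreover have "state_rhs S (p z) (x z) (u z) k - state_rhs S (p z) (y z) (u z) k
          = (\<Sum>i\<in>UNIV. sched (p z) i * (\<Sum>l<sdim S. Acoef S i k l * d l z))" for z
        by (simp add: state_rhs_nth[OF k] state_op_def d_def right_diff_distrib sum_subtractf)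
      ultimately have I: "((\<lambda>z. \<Sum>i\<in>UNIV. sched (p z) i * (\<Sum>l<sdim S. Acoef S i k l * d l z)) has_integral d k t) {0..t}"
        by (simp add: d_def)
      have "norm (integral {0..t} (\<lambda>z. \<Sum>i\<in>UNIV. sched (p z) i * (\<Sum>l<sdim S. Acoef S i k l * d l z)))
          \<le> integral {0..t} (\<lambda>z. C k * f z)"
      proof (rule integral_norm_bound_integral)
        show "(\<lambda>z. \<Sum>i\<in>UNIV. sched (p z) i * (\<Sum>l<sdim S. Acoef S i k l * d l z)) integrable_on {0..t}"
          using I by blast
        show "(\<lambda>z. C k * f z) integrable_on {0..t}" using fint by (rule integrable_on_mult_right)
        fix z assume z: "z \<in> {0..t}"
        have "\<bar>\<Sum>i\<in>UNIV. sched (p z) i * (\<Sum>l<sdim S. Acoef S i k l * d l z)\<bar>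
            \<le> (\<Sum>i\<in>UNIV. M * (\<Sum>l<sdim S. \<bar>Acoef S i k l\<bar> * f z))"
        proof (intro order_trans[OF sum_abs] sum_mono)
          fix i
          have "\<bar>\<Sum>l<sdim S. Acoef S i k l * d l z\<bar> \<le> (\<Sum>l<sdim S. \<bar>Acoef S i k l\<bar> * f z)"
          proof (intro order_trans[OF sum_abs] sum_mono)
            fix l assume "l \<in> {..<sdim S}"
            then have "\<bar>d l z\<bar> \<le> f z" unfolding f_def by (intro member_le_sum) auto
            then show "\<bar>Acoef S i k l * d l z\<bar> \<le> \<bar>Acoef S i k l\<bar> * f z"
              unfolding abs_mult by (rule mult_left_mono) simp
          qed
          then show "\<bar>sched (p z) i * (\<Sum>l<sdim S. Acoef S i k l * d l z)\<bar> \<le> M * (\<Sum>l<sdim S. \<bar>Acoef S i k l\<bar> * f z)"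
            using M(1) M(2)[of z i] z t unfolding abs_mult by (intro mult_mono) auto
        qed
        also have "\<dots> = C k * f z" by (simp add: C_def sum_distrib_right mult.assoc)
        finally show "norm (\<Sum>i\<in>UNIV. sched (p z) i * (\<Sum>l<sdim S. Acoef S i k l * d l z)) \<le> C k * f z" by simp
      qed
      then show ?thesis using integral_unique[OF I] by simp
    qed
    have "f T = 0"
    proof (rule gronwall_zero[OF fc, of "\<Sum>k<sdim S. C k"])
      show "0 \<le> (\<Sum>k<sdim S. C k)" using C0 by (intro sum_nonneg)
      show "0 \<le> f t" for t unfolding f_def by (intro sum_nonneg) simp
      show "f t \<le> (\<Sum>k<sdim S. C k) * integral {0..t} f" if "t \<in> {0..T}" for t
        unfolding f_def[of t] sum_distrib_right using dk that by (intro sum_mono) auto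
    qed (use T in auto)
    moreover have "\<bar>d k T\<bar> \<le> f T" unfolding f_def using k by (intro member_le_sum) auto
    ultimately show ?thesis by simp
  qed
  have E: "x \<in> {0..} \<rightarrow>\<^sub>E state_space S" "y \<in> {0..} \<rightarrow>\<^sub>E state_space S"
    using x y by (auto simp: ct_is_trajectory_def)
  show ?thesis
  proof (rule PiE_ext[OF E])
    fix t :: real assume t: "t \<in> {0..}"
    then have "x t \<in> state_space S" "y t \<in> state_space S" using E by auto
    then show "x t = y t"
      unfolding state_space_def by (rule PiE_ext) (use eq t in \<open>auto simp: d_def\<close>)
  qed
qed

lemma ct_state_eq_ct_sol:
  fixes S :: "('p::finite, 'u::finite, 'y) lpv_ssa"
  assumes p: "p \<in> ct_signals X" and u: "u \<in> ct_signals Y" and x0: "x0 \<in> state_space S"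
    and "0 \<le> t" "k < sdim S"
  shows "ct_state S x0 u p t k = ct_sol S x0 u p t k"
proof -
  have "ct_state S x0 u p = (\<lambda>t\<in>{0..}. \<lambda>k\<in>{..<sdim S}. ct_sol S x0 u p t k)"
    unfolding ct_state_def
    by (rule the_equality[where P = "ct_is_trajectory S x0 u p", OF ct_is_trajectory_ct_sol[OF p u x0]])
      (rule ct_is_trajectory_unique[OF p _ ct_is_trajectory_ct_sol[OF p u x0]])
  then show ?thesis using assms(4,5) by simp
qed

text \<open>The output coefficients are finite linear combinations of state components, so they
  commute with the series (\<open>O\<close>) and with the time integrals (\<open>OI\<close>);
  applying them to \<open>ct_sol_io\<close> gives the impulse response formula.\<close>

lemma ct_is_iir_theta_of:
  fixes S :: "('p::finite, 'u::finite, 'y::finite) lpv_ssa"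
  assumes x0: "x0 \<in> state_space S"
  shows "ct_is_iir P (ct_output S x0) (theta_of S x0)"
  unfolding ct_is_iir_def
proof (intro conjI ballI allI impI growth_bounded_theta_of)
  fix u :: "real \<Rightarrow> real^'u" and p :: "real \<Rightarrow> real^'p" and t :: real
  assume u: "u \<in> ct_signals UNIV" and p: "p \<in> ct_signals P" and t: "0 \<le> t"
  interpret letters "letter_of p" using p by (rule letters_letter_of)
  let ?W = "\<lambda>v k. wseries (letter_of p) (\<lambda>s. word_op S s v k) t"
  let ?O = "\<lambda>i r v. wseries (letter_of p) (\<lambda>s. out_coef S i r (word_op S s v)) t"
  have O: "out_coef S i r (\<lambda>k. ?W v k z) = ?O i r v z" if "0 \<le> z" "z \<le> t" for i r v z
    unfolding out_coef_def using that by (intro wseries_sum[symmetric] word_growth_word_op) auto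
  let ?I = "\<lambda>g j m. integral {0..t} (\<lambda>z. sched (p z) j * u z $ m * g z)"
  have int: "(\<lambda>z. sched (p z) j * u z $ m * ?W v k z) integrable_on {0..t}" if "k < sdim S" for j m v k
  proof -
    have "continuous_on {0..t} (?W v k)"
      using that by (intro wseries_start_continuous word_growth_word_op)
    then show ?thesis
      using integrable_mult_continuous(2)[OF loc_bdd_meas_mult[OF loc_bdd_meas_sched[OF p] ct_signals_nth[OF u]] _ order_refl t]
      by blast
  qed
  have OI: "out_coef S i r (\<lambda>k. ?I (?W v k) j m) = ?I (?O i r v) j m" for i r v j m
  proof -
    have "out_coef S i r (\<lambda>k. ?I (?W v k) j m)
        = integral {0..t} (\<lambda>z. \<Sum>k<sdim S. Ccoef S i r k * (sched (p z) j * u z $ m * ?W v k z))"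
      by (subst integral_sum) (simp_all add: out_coef_def integrable_on_mult_right int)
    also have "\<dots> = ?I (?O i r v) j m"
    proof (rule Henstock_Kurzweil_Integration.integral_cong)
      fix z assume "z \<in> {0..t}"
      then have "0 \<le> z" "z \<le> t" by auto
      note o = trans[OF sym[OF O[OF this]] out_coef_def, of i r v]
      show "(\<Sum>k<sdim S. Ccoef S i r k * (sched (p z) j * u z $ m * ?W v k z)) = sched (p z) j * u z $ m * ?O i r v z"
        unfolding o by (simp add: sum_distrib_left mult_ac)
    qed
    finally show ?thesis .
  qed
  show "ct_output S x0 (u, p) t = ct_g (theta_of S x0) p t + integral {0..t} (\<lambda>z. ct_h (theta_of S x0) p z t *v u z)"
    unfolding vec_eq_iff integral_unique[OF ct_h_has_integral[OF growth_bounded_theta_of p u t]]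
  proof
    fix r
    have "out_coef S i r (ct_state S x0 u p t)
        = out_coef S i r (\<lambda>k. ?W x0 k 0 + (\<Sum>j\<in>UNIV. \<Sum>m\<in>UNIV. ?I (?W (input_vec S j m) k) j m))" for i
      using ct_sol_io[OF p u _ t] by (intro out_coef_cong) (simp add: ct_state_eq_ct_sol[OF p u x0 t])
    then have "ct_output S x0 (u, p) t $ r = (\<Sum>i\<in>UNIV. sched (p t) i * (?O i r x0 0 +
        (\<Sum>j\<in>UNIV. \<Sum>m\<in>UNIV. ?I (?O i r (input_vec S j m)) j m)))"
      using t by (simp add: ct_output_def output_map_nth out_coef_linear O OI)
    then show "ct_output S x0 (u, p) t $ r = (ct_g (theta_of S x0) p t + (\<chi> r. \<Sum>i\<in>UNIV. \<Sum>j\<in>UNIV. \<Sum>m\<in>UNIV. sched (p t) i *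
        integral {0..t} (\<lambda>z. sched (p z) j * u z $ m * wseries (letter_of p) (\<lambda>s. theta_of S x0 s $ (i, r) $ Some (j, m)) t z))) $ r"
      by (simp add: ct_g_nth[OF growth_bounded_theta_of p t] theta_of_nth distrib_left sum.distrib sum_distrib_left)
  qed
qed

section \<open>Continuous time: uniqueness of the impulse response\<close>

lemma integral_zero_imp_zero:
  fixes f :: "real \<Rightarrow> real"
  assumes "continuous_on {a..b} f" "a < b" and 0: "\<And>t. t \<in> {a..b} \<Longrightarrow> integral {a..t} f = 0" and x: "x \<in> {a..b}"
  shows "f x = 0"
proof -
  have "((\<lambda>t. integral {a..t} f) has_vector_derivative f x) (at x within {a..b})"
    by (rule integral_has_vector_derivative[OF assms(1) x])
  then have "((\<lambda>t. 0) has_vector_derivative f x) (at x within {a..b})"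
    by (rule has_vector_derivative_transform[OF x, rotated]) (simp add: 0)
  then show ?thesis
    using vector_derivative_unique_within_closed_interval[of a b x "\<lambda>t. 0" "f x" 0] assms(2) x by simp
qed

text \<open>The second signal takes over at \<open>t\<close> itself. Series ending at
  \<open>t\<close> thus see only the first signal, whereas the outer factor evaluated at
  \<open>t\<close> sees the second.\<close>

definition switch_at :: "real \<Rightarrow> (real \<Rightarrow> 'a) \<Rightarrow> (real \<Rightarrow> 'a) \<Rightarrow> real \<Rightarrow> 'a"
  where "switch_at t f g s = (if s < t then f s else g s)"

lemma piecewise_continuous_limits:
  assumes f: "piecewise_continuous f" and t: "0 \<le> t"
  shows "\<exists>l. (f \<longlongrightarrow> l) (at_right t)" and "0 < t \<Longrightarrow> \<exists>l. (f \<longlongrightarrow> l) (at_left t)"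
proof -
  consider "continuous (at t within {0..}) f" | "\<not> continuous (at t within {0..}) f" by blast
  then have "(\<exists>l. (f \<longlongrightarrow> l) (at_right t)) \<and> (0 < t \<longrightarrow> (\<exists>l. (f \<longlongrightarrow> l) (at_left t)))"
  proof cases
    case 1
    then have l: "(f \<longlongrightarrow> f t) (at t within {0..})" by (simp add: continuous_within)
    have "(f \<longlongrightarrow> f t) (at_right t)"
      using t by (intro tendsto_within_subset[OF l]) auto
    moreover have "(f \<longlongrightarrow> f t) (at_left t)" if "0 < t"
    proof -
      have "at t within {0..} = at t"
        by (rule at_within_interior) (use that in auto)
      then show ?thesis using tendsto_within_subset[OF l[unfolded \<open>at t within {0..} = at t\<close>], of "{..<t}"] by simp
    qed
    ultimately show ?thesis by blast
  next
    case 2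
    then show ?thesis using f[unfolded piecewise_continuous_def, THEN conjunct2, rule_format, OF t] by blast
  qed
  then show "\<exists>l. (f \<longlongrightarrow> l) (at_right t)" and "0 < t \<Longrightarrow> \<exists>l. (f \<longlongrightarrow> l) (at_left t)" by auto
qed

lemma piecewise_continuous_switch_at:
  assumes f: "piecewise_continuous f" and g: "piecewise_continuous g" and t: "0 \<le> t"
  shows "piecewise_continuous (switch_at t f g)"
proof -
  let ?h = "switch_at t f g"
  have ef: "eventually (\<lambda>x. ?h x = f x) (at s within X)" if "s < t" for s X
  proof -
    have "eventually (\<lambda>x. x < t) (nhds s)" using that by (intro eventually_nhds_in_open[of "{..<t}", simplified]) auto
    then have "eventually (\<lambda>x. x < t) (at s within X)" by (rule eventually_at_filter[THEN iffD2, OF eventually_mono]) simp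
    then show ?thesis by eventually_elim (simp add: switch_at_def)
  qed
  have eg: "eventually (\<lambda>x. ?h x = g x) (at s within X)" if "t < s" for s X
  proof -
    have "eventually (\<lambda>x. t < x) (nhds s)" using that by (intro eventually_nhds_in_open[of "{t<..}", simplified]) auto
    then have "eventually (\<lambda>x. t < x) (at s within X)" by (rule eventually_at_filter[THEN iffD2, OF eventually_mono]) simp
    then show ?thesis by eventually_elim (simp add: switch_at_def)
  qed
  have cf: "continuous (at s within {0..}) ?h" if "s < t" "continuous (at s within {0..}) f" for s
    using that tendsto_cong[OF ef[OF that(1), of "{0..}"]] switch_at_def[of t f g s] by (simp add: continuous_within)
  have cg: "continuous (at s within {0..}) ?h" if "t < s" "continuous (at s within {0..}) g" for s
    using that tendsto_cong[OF eg[OF that(1), of "{0..}"]] switch_at_def[of t f g s] by (simp add: continuous_within)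
  have lf: "\<exists>l. (f \<longlongrightarrow> l) F \<Longrightarrow> eventually (\<lambda>x. ?h x = f x) F \<Longrightarrow> \<exists>l. (?h \<longlongrightarrow> l) F" for F
    using tendsto_cong by blast
  have lg: "\<exists>l. (g \<longlongrightarrow> l) F \<Longrightarrow> eventually (\<lambda>x. ?h x = g x) F \<Longrightarrow> \<exists>l. (?h \<longlongrightarrow> l) F" for F
    using tendsto_cong by blast
  show ?thesis
    unfolding piecewise_continuous_def
  proof (intro conjI allI impI)
    fix a b :: real assume "0 \<le> a"
    show "finite {s \<in> {a..b}. \<not> continuous (at s within {0..}) ?h}"
    proof (rule finite_subset)
      show "{s \<in> {a..b}. \<not> continuous (at s within {0..}) ?h} \<subseteq> {t} \<union> {s \<in> {a..b}. \<not> continuous (at s within {0..}) f}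
          \<union> {s \<in> {a..b}. \<not> continuous (at s within {0..}) g}"
        using cf cg by (auto simp: linorder_neq_iff)
      show "finite ({t} \<union> {s \<in> {a..b}. \<not> continuous (at s within {0..}) f} \<union> {s \<in> {a..b}. \<not> continuous (at s within {0..}) g})"
        using f g \<open>0 \<le> a\<close> unfolding piecewise_continuous_def by blast
    qed
  next
    fix s :: real assume s: "0 \<le> s"
    show "\<exists>l. (?h \<longlongrightarrow> l) (at_right s)"
    proof (cases "s < t")
      case True
      show ?thesis using lf[OF piecewise_continuous_limits(1)[OF f s] ef[OF True]] .
    next
      case False
      have "eventually (\<lambda>x. ?h x = g x) (at_right s)"
        using eventually_at_right_less[of s] by eventually_elim (use False in \<open>auto simp: switch_at_def\<close>)
      then show ?thesis using lg[OF piecewise_continuous_limits(1)[OF g s]] by blast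
    qed
    assume s0: "0 < s"
    show "\<exists>l. (?h \<longlongrightarrow> l) (at_left s)"
    proof (cases "s \<le> t")
      case True
      have "eventually (\<lambda>x. x < s) (at_left s)" by (simp add: eventually_at_filter)
      then have "eventually (\<lambda>x. ?h x = f x) (at_left s)"
        by eventually_elim (use True in \<open>auto simp: switch_at_def\<close>)
      then show ?thesis using lf[OF piecewise_continuous_limits(2)[OF f s s0]] by blast
    next
      case False
      then show ?thesis using lg[OF piecewise_continuous_limits(2)[OF g s s0] eg] by simp
    qed
  qed
qed

lemma switch_at_ct_signals:
  assumes "f \<in> ct_signals X" "g \<in> ct_signals X" "0 \<le> t"
  shows "switch_at t f g \<in> ct_signals X"
proof -
  have "piecewise_continuous (switch_at t f g)"
    using assms by (intro piecewise_continuous_switch_at) (auto simp: ct_signals_def)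
  moreover have "switch_at t f g \<in> {0..} \<rightarrow>\<^sub>E X"
    using assms by (auto simp: ct_signals_def switch_at_def PiE_def extensional_def Pi_def)
  ultimately show ?thesis by (simp add: ct_signals_def)
qed

lemma const_ct_signals:
  assumes "q \<in> X"
  shows "(\<lambda>_\<in>{0..}. q) \<in> ct_signals X"
proof -
  have "continuous_on {0..} (\<lambda>_\<in>{0::real..}. q)"
    by (rule continuous_on_eq[of _ "\<lambda>_. q"]) auto
  then have "continuous (at t within {0..}) (\<lambda>_\<in>{0::real..}. q)" if "0 \<le> t" for t
    unfolding continuous_on_eq_continuous_within by (rule bspec) (use that in simp)
  then have "piecewise_continuous (\<lambda>_\<in>{0..}. q)"
    unfolding piecewise_continuous_def by (auto intro!: finite_subset[OF _ finite.emptyI] dest: order_trans)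
  then show ?thesis using assms by (auto simp: ct_signals_def)
qed

text \<open>After a switch to the constant \<open>q\<close> at time \<open>t\<close>, the series of
  \<open>c\<close> still vanishes on \<open>{t..t+1}\<close>. By \<open>wseries_snoc\<close> its
  increments are integrals of the stripped series, which is continuous, so the right derivative at
  \<open>t\<close> gives the claim there; up to \<open>t\<close> the switch is invisible.\<close>

lemma wseries_coefficients_vanish:
  fixes P :: "(real^'p::finite) set"
  assumes P: "affine hull P = UNIV" and \<tau>: "0 \<le> \<tau>" and c: "word_growth c"
    and 0: "\<And>p t. p \<in> ct_signals P \<Longrightarrow> \<tau> \<le> t \<Longrightarrow> wseries (letter_of p) c t \<tau> = 0"
  shows "c s = 0"
proof (rule word_coefficients_vanish[OF P,
    where V = "\<lambda>c. word_growth c \<and> (\<forall>p\<in>ct_signals P. \<forall>t\<ge>\<tau>. wseries (letter_of p) c t \<tau> = 0)"])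
  show "word_growth c \<and> (\<forall>p\<in>ct_signals P. \<forall>t\<ge>\<tau>. wseries (letter_of p) c t \<tau> = 0)" using 0 c by blast
next
  fix c assume V: "word_growth c \<and> (\<forall>p\<in>ct_signals P. \<forall>t\<ge>\<tau>. wseries (letter_of p) c t \<tau> = 0)"
  have "P \<noteq> {}" using P by auto
  then obtain q where "q \<in> P" by blast
  then have "wseries (letter_of (\<lambda>_\<in>{0..}. q)) c \<tau> \<tau> = 0" using V const_ct_signals by blast
  then show "c [] = 0" by (simp add: wseries_refl)
next
  fix c q assume V: "word_growth c \<and> (\<forall>p\<in>ct_signals P. \<forall>t\<ge>\<tau>. wseries (letter_of p) c t \<tau> = 0)" and q: "q \<in> P"
  then have c: "word_growth c" by simp
  let ?d = "\<lambda>s. \<Sum>i\<in>UNIV. sched q i * c (s @ [i])"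
  show "word_growth ?d \<and> (\<forall>p\<in>ct_signals P. \<forall>t\<ge>\<tau>. wseries (letter_of p) ?d t \<tau> = 0)"
  proof (intro conjI ballI allI impI)
    show "word_growth ?d" by (intro word_growth_sum word_growth_mult word_growth_snoc c)
    fix p t assume p: "p \<in> ct_signals P" and t: "\<tau> \<le> t"
    have t0: "0 \<le> t" using t \<tau> by simp
    define p' where "p' = switch_at t p (\<lambda>_\<in>{0..}. q)"
    have p': "p' \<in> ct_signals P"
      unfolding p'_def by (intro switch_at_ct_signals p const_ct_signals q t0)
    interpret letters "letter_of p'" using p' by (rule letters_letter_of)
    let ?W = "\<lambda>i z. wseries (letter_of p') (\<lambda>s. c (s @ [i])) z \<tau>"
    let ?\<phi> = "\<lambda>z. \<Sum>i\<in>UNIV. sched q i * ?W i z"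
    have cont: "continuous_on {t..t+1} ?\<phi>"
      by (intro continuous_intros continuous_on_subset[OF wseries_end_continuous[OF word_growth_snoc[OF c] \<tau>, of "t + 1"]])
        (use t in auto)
    have "integral {t..s} ?\<phi> = 0" if s: "s \<in> {t..t+1}" for s
    proof -
      have \<tau>s: "\<tau> \<le> s" using s t by simp
      have int: "(\<lambda>z. sched (p' z) i * ?W i z) integrable_on {\<tau>..s}" for i
        by (rule wseries_snoc(1)[OF c \<tau> \<tau>s])
      have "integral {t..s} ?\<phi> = integral {t..s} (\<lambda>z. \<Sum>i\<in>UNIV. sched (p' z) i * ?W i z)"
        using t0 by (intro Henstock_Kurzweil_Integration.integral_cong) (simp add: p'_def switch_at_def)
      also have "\<dots> = (\<Sum>i\<in>UNIV. integral {t..s} (\<lambda>z. sched (p' z) i * ?W i z))"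
        using t by (intro integral_sum finite integrable_subinterval_real[OF int]) auto
      also have "\<dots> = (\<Sum>i\<in>UNIV. integral {\<tau>..s} (\<lambda>z. sched (p' z) i * ?W i z) - integral {\<tau>..t} (\<lambda>z. sched (p' z) i * ?W i z))"
        using Henstock_Kurzweil_Integration.integral_combine[OF t _ int] s by (intro sum.cong) (auto simp: algebra_simps)
      also have "\<dots> = wseries (letter_of p') c s \<tau> - wseries (letter_of p') c t \<tau>"
        using wseries_snoc(2)[OF c \<tau> \<tau>s] wseries_snoc(2)[OF c \<tau> t] by (simp add: sum_subtractf)
      also have "\<dots> = 0" using V p' \<tau>s t by simp
      finally show ?thesis .
    qed
    then have "?\<phi> t = 0" using integral_zero_imp_zero[OF cont, of t] by simp
    moreover have "wseries (letter_of p) ?d t \<tau> = wseries (letter_of p') ?d t \<tau>"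
      by (rule wseries_cong) (simp add: p'_def switch_at_def)
    moreover have "wseries (letter_of p') ?d t \<tau> = ?\<phi> t"
      by (intro wseries_sum word_growth_snoc c \<tau> t)
    ultimately show "wseries (letter_of p) ?d t \<tau> = 0" by simp
  qed
qed

text \<open>Zero input isolates \<open>ct_g\<close>. There are no impulses, so a unit vector
  switched off at time \<open>a\<close> is used instead: it shows that the kernel difference has
  integral 0 over \<open>{0..a}\<close> for every \<open>a\<close>. With constant scheduling on an
  initial interval, that difference is continuous in the start time and can be recovered by
  differentiation.\<close>

lemma ct_is_iir_unique:
  fixes P :: "(real^'p::finite) set"
    and \<theta> :: "'p option list \<Rightarrow> ('p, 'u::finite, 'y::finite) theta_mat"
  assumes P: "affine hull P = UNIV" and \<theta>: "ct_is_iir P F \<theta>" and \<theta>': "ct_is_iir P F \<theta>'"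
  shows "\<theta> = \<theta>'"
proof -
  let ?d = "\<lambda>r c s. \<theta> s $ r $ c - \<theta>' s $ r $ c"
  let ?W = "\<lambda>p c t. wseries (letter_of p) c t"
  let ?const = "\<lambda>q. \<lambda>_\<in>{0..}. q"
  have gb: "growth_bounded \<theta>" "growth_bounded \<theta>'" using \<theta> \<theta>' by (auto simp: ct_is_iir_def)
  then have gr: "word_growth (\<lambda>s. \<theta> s $ r $ c)" "word_growth (\<lambda>s. \<theta>' s $ r $ c)" for r c
    unfolding growth_bounded_iff by blast+
  have grd: "word_growth (?d r c)" for r c
    using word_growth_add[OF gr(1) word_growth_mult[OF gr(2), of "-1"], of r c r c] by simp
  have Wd: "?W p (?d r c) t \<tau> = ?W p (\<lambda>s. \<theta> s $ r $ c) t \<tau> - ?W p (\<lambda>s. \<theta>' s $ r $ c) t \<tau>"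
    if "p \<in> ct_signals P" "0 \<le> \<tau>" "\<tau> \<le> t" for p r c t \<tau>
    using that letters.wseries_diff[OF letters_letter_of gr(1) gr(2)] by blast
  have F: "F (u, p) t = ct_g \<eta> p t + integral {0..t} (\<lambda>z. ct_h \<eta> p z t *v u z)"
    if "ct_is_iir P F \<eta>" "p \<in> ct_signals P" "u \<in> ct_signals UNIV" "0 \<le> t" for p u t \<eta>
    using that unfolding ct_is_iir_def by blast
  have eq: "ct_g \<theta> p t + integral {0..t} (\<lambda>z. ct_h \<theta> p z t *v u z)
      = ct_g \<theta>' p t + integral {0..t} (\<lambda>z. ct_h \<theta>' p z t *v u z)"
    if "p \<in> ct_signals P" "u \<in> ct_signals UNIV" "0 \<le> t" for p u t
    using F[OF \<theta> that] F[OF \<theta>' that] by (rule trans[OF sym])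
  have g: "ct_g \<theta> p t = ct_g \<theta>' p t" if p: "p \<in> ct_signals P" and t: "0 \<le> t" for p t
  proof -
    have "integral {0..t} (\<lambda>z. ct_h \<eta> p z t *v ?const (0 :: real^'u) z) = integral {0..t} (\<lambda>z. 0)"
      for \<eta> :: "'p option list \<Rightarrow> ('p, 'u, 'y) theta_mat"
      by (rule Henstock_Kurzweil_Integration.integral_cong) simp
    then show ?thesis using eq[OF p const_ct_signals[OF UNIV_I] t, of 0] by simp
  qed
  have None: "?d (i, r) None s = 0" for i r s
  proof (rule wseries_coefficients_vanish[OF P order_refl grd])
    fix p and t :: real assume p: "p \<in> ct_signals P" and t: "0 \<le> t"
    show "?W p (?d (i, r) None) t 0 = 0"
    proof (rule sched_combination_zero[OF P])
      fix q assume q: "q \<in> P"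
      let ?p = "switch_at t p (?const q)"
      have p': "?p \<in> ct_signals P" by (intro switch_at_ct_signals p const_ct_signals q t)
      have "?p t = q" using t by (simp add: switch_at_def)
      moreover have "?W p (?d (i, r) None) t 0 = ?W ?p (?d (i, r) None) t 0" for i
        by (rule wseries_cong) (simp add: switch_at_def)
      ultimately have "(\<Sum>i\<in>UNIV. sched q i * ?W p (?d (i, r) None) t 0)
          = (\<Sum>i\<in>UNIV. sched (?p t) i * ?W ?p (?d (i, r) None) t 0)" by simp
      also have "\<dots> = ct_g \<theta> ?p t $ r - ct_g \<theta>' ?p t $ r"
        using t by (simp add: ct_g_nth[OF gb(1) p' t] ct_g_nth[OF gb(2) p' t] Wd[OF p'] right_diff_distrib sum_subtractf)
      finally show "(\<Sum>i\<in>UNIV. sched q i * ?W p (?d (i, r) None) t 0) = 0" using g[OF p' t] by simp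
    qed
  qed
  have h: "integral {0..a} (\<lambda>z. ct_h \<theta> p z t $ r $ m - ct_h \<theta>' p z t $ r $ m) = 0"
    if p: "p \<in> ct_signals P" and a: "0 \<le> a" "a \<le> t" for p a t r m
  proof -
    have t: "0 \<le> t" using a by simp
    define u where "u = switch_at a (?const (axis m 1 :: real^'u)) (?const 0)"
    have u: "u \<in> ct_signals UNIV"
      unfolding u_def by (intro switch_at_ct_signals const_ct_signals UNIV_I a)
    have I: "(\<lambda>z. ct_h \<eta> p z t $ r $ m) integrable_on {0..a} \<and>
        integral {0..t} (\<lambda>z. ct_h \<eta> p z t *v u z) $ r = integral {0..a} (\<lambda>z. ct_h \<eta> p z t $ r $ m)"
      if \<eta>: "growth_bounded \<eta>" for \<eta> :: "'p option list \<Rightarrow> ('p, 'u, 'y) theta_mat"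
    proof -
      let ?f = "\<lambda>z. ct_h \<eta> p z t *v u z"
      have "?f integrable_on {0..t}" using ct_h_has_integral[OF \<eta> p u t] by blast
      then have f: "((\<lambda>z. ?f z $ r) has_integral (integral {0..t} ?f $ r)) {0..t}"
        using has_integral_linear[OF integrable_integral bounded_linear_vec_nth] by (simp add: comp_def)
      \<comment> \<open>At \<open>a\<close> the input is already 0 although \<open>{0..a}\<close>
        contains \<open>a\<close>; this single point is left to a negligible set.\<close>
      have "?f z $ r = (if z \<in> {0..a} then ct_h \<eta> p z t $ r $ m else 0)" if "z \<in> {0..t} - {a}" for z
        using that by (auto simp: u_def switch_at_def matrix_vector_mult_basis column_def)
      then have "((\<lambda>z. if z \<in> {0..a} then ct_h \<eta> p z t $ r $ m else 0) has_integral (integral {0..t} ?f $ r)) {0..t}"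
        by (intro has_integral_spike[OF negligible_sing[of a] _ f]) auto
      then have "((\<lambda>z. ct_h \<eta> p z t $ r $ m) has_integral (integral {0..t} ?f $ r)) {0..a}"
        using a by (subst (asm) has_integral_restrict) auto
      then show ?thesis by (auto simp: has_integral_iff)
    qed
    have "integral {0..t} (\<lambda>z. ct_h \<theta> p z t *v u z) = integral {0..t} (\<lambda>z. ct_h \<theta>' p z t *v u z)"
      using eq[OF p u t] g[OF p t] by simp
    then show ?thesis
      using I[OF gb(1)] I[OF gb(2)] by (simp add: Henstock_Kurzweil_Integration.integral_diff)
  qed
  have Some: "?d (i, r) (Some (j, m)) s = 0" for i r j m s
  proof (rule wseries_coefficients_vanish[OF P zero_le_one grd])
    fix p and t :: real assume p: "p \<in> ct_signals P" and t: "1 \<le> t"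
    show "?W p (?d (i, r) (Some (j, m))) t 1 = 0"
    proof (rule sched_combination_zero2[OF P])
      fix q q' assume q: "q \<in> P" "q' \<in> P"
      have t0: "0 \<le> t" using t by simp
      \<comment> \<open>Times before 1 carry \<open>q'\<close>, times from 1 up to \<open>t\<close>
        keep \<open>p\<close>, and \<open>t\<close> itself carries \<open>q\<close>. The series
        started at 1 thus sees only \<open>p\<close>, while the two outer factors are independent;
        choosing start time 1 makes room for the initial interval.\<close>
      define p' where "p' = switch_at 1 (?const q') (switch_at t p (?const q))"
      have p': "p' \<in> ct_signals P"
        unfolding p'_def by (intro switch_at_ct_signals p const_ct_signals q t0 zero_le_one)
      interpret letters "letter_of p'" using p' by (rule letters_letter_of)
      have p't: "p' t = q" using t by (simp add: p'_def switch_at_def)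
      let ?\<psi> = "\<lambda>z. \<Sum>i\<in>UNIV. \<Sum>j\<in>UNIV. sched q i * sched q' j * ?W p' (?d (i, r) (Some (j, m))) t z"
      have cont: "continuous_on {0..1} ?\<psi>"
        by (intro continuous_intros continuous_on_subset[OF wseries_start_continuous[OF grd, of t]]) (use t in auto)
      have "integral {0..a} ?\<psi> = 0" if a: "a \<in> {0..1}" for a
      proof -
        have "integral {0..a} ?\<psi> = integral {0..a} (\<lambda>z. ct_h \<theta> p' z t $ r $ m - ct_h \<theta>' p' z t $ r $ m)"
        \<comment> \<open>For \<open>a = 1\<close> the end point lies at the switch, where the
          signal no longer needs to equal \<open>q'\<close>.\<close>
        proof (rule integral_spike[of "{1}"])
          fix z assume "z \<in> {0..a} - {1}"
          then have z: "0 \<le> z" "z < 1" "z \<le> t" using a t by auto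
          then have "p' z = q'" by (simp add: p'_def switch_at_def)
          then show "ct_h \<theta> p' z t $ r $ m - ct_h \<theta>' p' z t $ r $ m = ?\<psi> z"
            by (simp add: ct_h_nth[OF gb(1) p' z(1,3)] ct_h_nth[OF gb(2) p' z(1,3)] Wd[OF p' z(1,3)] p't
                right_diff_distrib sum_subtractf)
        qed simp
        also have "\<dots> = 0" using h[OF p'] a t by simp
        finally show ?thesis .
      qed
      then have "?\<psi> 1 = 0" using integral_zero_imp_zero[OF cont, of 1] by simp
      moreover have "?W p' (?d (i, r) (Some (j, m))) t 1 = ?W p (?d (i, r) (Some (j, m))) t 1" for i j
        by (rule wseries_cong) (simp add: p'_def switch_at_def)
      ultimately show "(\<Sum>i\<in>UNIV. \<Sum>j\<in>UNIV. sched q i * sched q' j * ?W p (?d (i, r) (Some (j, m))) t 1) = 0"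
        by simp
    qed
  qed
  have "\<theta> s $ r $ c = \<theta>' s $ r $ c" for s r c
    using None[of s "fst r" "snd r"] Some[of s "fst r" "snd r" "fst (the c)" "snd (the c)"] by (cases c) auto
  then show ?thesis by (simp add: fun_eq_iff vec_eq_iff)
qed

section \<open>From impulse responses to realizations, for both time domains\<close>

lemma ct_realization_iff:
  fixes F :: "(real \<Rightarrow> real^'u::finite) \<times> (real \<Rightarrow> real^'p::finite) \<Rightarrow> real \<Rightarrow> real^'y::finite"
  assumes F: "F \<in> ct_signals UNIV \<times> ct_signals P \<rightarrow> ct_signals UNIV"
  shows "ct_realization P S F \<longleftrightarrow> (\<exists>x0\<in>state_space S. ct_is_iir P F (theta_of S x0))"
proof
  assume "ct_realization P S F"
  then obtain x0 where x0: "x0 \<in> state_space S" "\<And>w. w \<in> ct_signals UNIV \<times> ct_signals P \<Longrightarrow> F w = ct_output S x0 w"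
    unfolding ct_realization_def by blast
  have "ct_is_iir P F (theta_of S x0)"
    using ct_is_iir_theta_of[OF x0(1), of P] x0(2) by (simp add: ct_is_iir_def)
  then show "\<exists>x0\<in>state_space S. ct_is_iir P F (theta_of S x0)" using x0(1) by blast
next
  assume "\<exists>x0\<in>state_space S. ct_is_iir P F (theta_of S x0)"
  then obtain x0 where x0: "x0 \<in> state_space S" "ct_is_iir P F (theta_of S x0)" by blast
  have "F (u, p) t = ct_output S x0 (u, p) t" if up: "u \<in> ct_signals UNIV" "p \<in> ct_signals P" for u p t
  proof (cases "0 \<le> t")
    case True
    then show ?thesis using x0(2) ct_is_iir_theta_of[OF x0(1), of P] up by (simp add: ct_is_iir_def)
  next
    case False
    \<comment> \<open>An impulse response determines \<open>F\<close> only at nonnegative times; at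
      negative times both sides take the default value of extensional functions.\<close>
    have "F (u, p) \<in> extensional {0..}" using F up by (auto simp: ct_signals_def PiE_def Pi_def)
    then show ?thesis using False by (simp add: extensional_def ct_output_def)
  qed
  then show "ct_realization P S F" unfolding ct_realization_def using x0(1) by (auto simp: fun_eq_iff)
qed

lemma dt_realization_iff:
  fixes F :: "(nat \<Rightarrow> real^'u::finite) \<times> (nat \<Rightarrow> real^'p::finite) \<Rightarrow> nat \<Rightarrow> real^'y::finite"
  shows "dt_realization P S F \<longleftrightarrow> (\<exists>x0\<in>state_space S. dt_is_iir P F (theta_of S x0))"
proof
  assume "dt_realization P S F"
  then obtain x0 where x0: "x0 \<in> state_space S" "\<And>w. w \<in> dt_signals UNIV \<times> dt_signals P \<Longrightarrow> F w = dt_output S x0 w"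
    unfolding dt_realization_def by blast
  have "dt_is_iir P F (theta_of S x0)"
    using dt_is_iir_theta_of[of P S x0] x0(2) by (simp add: dt_is_iir_def)
  then show "\<exists>x0\<in>state_space S. dt_is_iir P F (theta_of S x0)" using x0(1) by blast
next
  assume "\<exists>x0\<in>state_space S. dt_is_iir P F (theta_of S x0)"
  then obtain x0 where x0: "x0 \<in> state_space S" "dt_is_iir P F (theta_of S x0)" by blast
  have "F (u, p) t = dt_output S x0 (u, p) t" if "u \<in> dt_signals UNIV" "p \<in> dt_signals P" for u p t
    using x0(2) dt_is_iir_theta_of[of P S x0] that by (simp add: dt_is_iir_def)
  then show "dt_realization P S F" unfolding dt_realization_def using x0(1) by (auto simp: fun_eq_iff)
qed

text \<open>Stated for abstract predicates so that each time domain is an instance. Uniqueness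
  resolves the definite description, after which \<open>col_rank_hankel_theta_of\<close> bounds
  every dimension from below. \<open>hankel_realization\<close> reproduces the coefficients exactly,
  so its system realizes the same function and attains the bound.\<close>

lemma realization_minimal_dimension:
  fixes realizes :: "('p::{finite, linorder}, 'u::finite, 'y::finite) lpv_ssa \<Rightarrow> bool"
    and iir :: "('p option list \<Rightarrow> ('p, 'u, 'y) theta_mat) \<Rightarrow> bool"
  assumes realizes: "\<And>S. realizes S \<longleftrightarrow> (\<exists>x0\<in>state_space S. iir (theta_of S x0))"
    and unique: "\<And>\<theta> \<theta>'. iir \<theta> \<Longrightarrow> iir \<theta>' \<Longrightarrow> \<theta> = \<theta>'"
  shows "(\<exists>S. realizes S) \<longleftrightarrow> (\<exists>\<theta>. iir \<theta>) \<and> col_rank (hankel (THE \<theta>. iir \<theta>)) < \<infinity>"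
    and "realizes S \<Longrightarrow> (\<And>S'. realizes S' \<Longrightarrow> sdim S \<le> sdim S') \<Longrightarrow>
      enat (sdim S) = col_rank (hankel (THE \<theta>. iir \<theta>))"
proof -
  have the: "(THE \<theta>. iir \<theta>) = \<theta>" if "iir \<theta>" for \<theta>
    using that unique by blast
  have le: "col_rank (hankel (THE \<theta>. iir \<theta>)) \<le> enat (sdim S)" if "realizes S" for S
    using that realizes the col_rank_hankel_theta_of by metis
  have ex: "\<exists>S. realizes S \<and> sdim S = n" if "iir \<theta>" "col_rank (hankel (THE \<theta>. iir \<theta>)) = enat n" for \<theta> n
  proof -
    have "col_rank (hankel \<theta>) = enat n" using that the by simp
    then obtain S x0 where "sdim S = n" "x0 \<in> state_space S" "theta_of S x0 = \<theta>" by (rule hankel_realization)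
    then show ?thesis using realizes \<open>iir \<theta>\<close> by blast
  qed
  show "(\<exists>S. realizes S) \<longleftrightarrow> (\<exists>\<theta>. iir \<theta>) \<and> col_rank (hankel (THE \<theta>. iir \<theta>)) < \<infinity>"
  proof
    assume "\<exists>S. realizes S"
    then obtain S where S: "realizes S" by blast
    then have "col_rank (hankel (THE \<theta>. iir \<theta>)) < \<infinity>"
      using le[OF S] by (metis enat_ord_code(4) order_le_less_trans)
    then show "(\<exists>\<theta>. iir \<theta>) \<and> col_rank (hankel (THE \<theta>. iir \<theta>)) < \<infinity>" using S realizes by blast
  next
    assume "(\<exists>\<theta>. iir \<theta>) \<and> col_rank (hankel (THE \<theta>. iir \<theta>)) < \<infinity>"
    then show "\<exists>S. realizes S" using ex by (metis less_infinityE)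
  qed
  assume S: "realizes S" and min: "\<And>S'. realizes S' \<Longrightarrow> sdim S \<le> sdim S'"
  obtain n where n: "col_rank (hankel (THE \<theta>. iir \<theta>)) = enat n"
    using le[OF S] by (metis enat_ile)
  obtain \<theta> where "iir \<theta>" using S realizes by blast
  then obtain S' where "realizes S'" "sdim S' = n" using ex[OF _ n] by blast
  then have "sdim S \<le> n" using min by blast
  then show "enat (sdim S) = col_rank (hankel (THE \<theta>. iir \<theta>))" using le[OF S] n by simp
qed

theorem theorem7:
  fixes P :: "(real^'p::{finite, linorder}) set"
  assumes "affine hull P = UNIV"
  shows
    "(\<forall>F :: (real \<Rightarrow> real^'u::finite) \<times> (real \<Rightarrow> real^'p::{finite, linorder}) \<Rightarrow> (real \<Rightarrow> real^'y::finite).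
        F \<in> ct_signals UNIV \<times> ct_signals P \<rightarrow> ct_signals UNIV \<longrightarrow>
        ((\<exists>S. ct_realization P S F) \<longleftrightarrow>
           ct_has_iir P F \<and> col_rank (hankel (ct_theta P F)) < \<infinity>) \<and>
        (\<forall>S. ct_minimal_realization P S F \<longrightarrow>
           enat (sdim S) = col_rank (hankel (ct_theta P F)))) \<and>
     (\<forall>F :: (nat \<Rightarrow> real^'u::finite) \<times> (nat \<Rightarrow> real^'p::{finite, linorder}) \<Rightarrow> (nat \<Rightarrow> real^'y::finite).
        F \<in> dt_signals UNIV \<times> dt_signals P \<rightarrow> dt_signals UNIV \<longrightarrow>
        ((\<exists>S. dt_realization P S F) \<longleftrightarrow>
           dt_has_iir P F \<and> col_rank (hankel (dt_theta P F)) < \<infinity>) \<and>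
        (\<forall>S. dt_minimal_realization P S F \<longrightarrow>
           enat (sdim S) = col_rank (hankel (dt_theta P F))))"
proof (intro conjI allI impI)
  fix F :: "(real \<Rightarrow> real^'u) \<times> (real \<Rightarrow> real^'p::{finite, linorder}) \<Rightarrow> real \<Rightarrow> real^'y"
  assume F: "F \<in> ct_signals UNIV \<times> ct_signals P \<rightarrow> ct_signals UNIV"
  note min = realization_minimal_dimension[where realizes = "\<lambda>S. ct_realization P S F" and iir = "ct_is_iir P F",
      OF ct_realization_iff[OF F] ct_is_iir_unique[OF assms]]
  show "(\<exists>S. ct_realization P S F) \<longleftrightarrow> ct_has_iir P F \<and> col_rank (hankel (ct_theta P F)) < \<infinity>"
    unfolding ct_has_iir_def ct_theta_def by (rule min(1))
  show "enat (sdim S) = col_rank (hankel (ct_theta P F))" if "ct_minimal_realization P S F" for S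
    unfolding ct_theta_def using that by (intro min(2)) (auto simp: ct_minimal_realization_def)
next
  fix F :: "(nat \<Rightarrow> real^'u) \<times> (nat \<Rightarrow> real^'p::{finite, linorder}) \<Rightarrow> nat \<Rightarrow> real^'y"
  note min = realization_minimal_dimension[where realizes = "\<lambda>S. dt_realization P S F" and iir = "dt_is_iir P F",
      OF dt_realization_iff dt_is_iir_unique[OF assms]]
  show "(\<exists>S. dt_realization P S F) \<longleftrightarrow> dt_has_iir P F \<and> col_rank (hankel (dt_theta P F)) < \<infinity>"
    unfolding dt_has_iir_def dt_theta_def by (rule min(1))
  show "enat (sdim S) = col_rank (hankel (dt_theta P F))" if "dt_minimal_realization P S F" for S
    unfolding dt_theta_def using that by (intro min(2)) (auto simp: dt_minimal_realization_def)
qed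

end
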